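(* Let $P$ be the transition matrix of a Markov chain on a finite state space $\Omega$, with stationary distribution $\pi$, and let $\pi_* = \min_{x \in \mathrm{supp}(\pi)} \pi(x)$. Assume every step of the chain can be simulated in constant time and the whole transition matrix $P$ can be computed in time $O(|\Omega|^4)$. (1) If $P$ mixes in time $T$ to within $1/4$ in total variation distance of $\pi$, i.e. $\max_{x\in\Omega} d_{TV}(P^T(x,\cdot),\pi) \le 1/4$, then there is a perfect sampler for $\pi$ with expected running time $O\left(T \ln \frac{|\Omega|}{\pi_*}\right)$. (2) If $P$ is reversible and has absolute spectral gap $\gamma_*$, then there is a perfect sampler for $\pi$ with expected running time $O\left(\frac{1}{\gamma_*} \ln \frac{|\Omega|}{\pi_*}\right)$.
   Context: A perfect sampler for a distribution $\pi$ is a randomized algorithm that terminates with probability $1$ and whose output is distributed exactly according to $\pi$. $P^t(x,\cdot)$ denotes the distribution of the chain after $t$ steps started at $x$, and $d_{TV}(\mu,\nu)=\frac12\sum_y|\mu(y)-\nu(y)|$. $P$ is reversible if $\pi(x)P(x,y)=\pi(y)P(y,x)$ for all $x,y$. The absolute spectral gap is $\gamma_* = \min\{1-|\lambda| : \lambda \neq 1 \text{ is an eigenvalue of } P\}$.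
   Formalization: In (2) π is assumed to be the only stationary distribution (with two disjoint components P does not determine π and the claim fails); the sampler is given a start state in supp(π); for |Ω| = 1, where the logarithm is 0, the time bound is a constant. *)

theory Defs
  imports
    "HOL-Probability.Probability"
    "Jordan_Normal_Form.Char_Poly"
begin

section \<open>Finite Markov chains\<close>

text \<open>
  The finite state space is \<open>{..<n}\<close>; the row \<open>P(x, -)\<close> of the transition matrix is the
  pmf \<open>K x\<close>.  Values of \<open>K\<close> outside \<open>{..<n}\<close> are irrelevant.
\<close>

definition markov_chain :: "nat \<Rightarrow> (nat \<Rightarrow> nat pmf) \<Rightarrow> bool" where
  "markov_chain n K \<longleftrightarrow> (\<forall>x<n. set_pmf (K x) \<subseteq> {..<n})"

definition transition_matrix :: "nat \<Rightarrow> (nat \<Rightarrow> nat pmf) \<Rightarrow> real mat" where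
  "transition_matrix n K = mat n n (\<lambda>(x, y). pmf (K x) y)"

primrec step_dist :: "(nat \<Rightarrow> nat pmf) \<Rightarrow> nat \<Rightarrow> nat \<Rightarrow> nat pmf" where
  "step_dist K 0 x = return_pmf x"
| "step_dist K (Suc t) x = bind_pmf (step_dist K t x) K"

definition stationary :: "nat \<Rightarrow> (nat \<Rightarrow> nat pmf) \<Rightarrow> nat pmf \<Rightarrow> bool" where
  "stationary n K \<pi> \<longleftrightarrow> set_pmf \<pi> \<subseteq> {..<n} \<and> bind_pmf \<pi> K = \<pi>"

definition unique_stationary :: "nat \<Rightarrow> (nat \<Rightarrow> nat pmf) \<Rightarrow> nat pmf \<Rightarrow> bool" where
  "unique_stationary n K \<pi> \<longleftrightarrow>
     stationary n K \<pi> \<and> (\<forall>\<rho>. stationary n K \<rho> \<longrightarrow> \<rho> = \<pi>)"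

definition reversible :: "nat \<Rightarrow> (nat \<Rightarrow> nat pmf) \<Rightarrow> nat pmf \<Rightarrow> bool" where
  "reversible n K \<pi> \<longleftrightarrow>
     (\<forall>x<n. \<forall>y<n. pmf \<pi> x * pmf (K x) y = pmf \<pi> y * pmf (K y) x)"

definition d_TV :: "nat \<Rightarrow> nat pmf \<Rightarrow> nat pmf \<Rightarrow> real" where
  "d_TV n \<mu> \<nu> = (1 / 2) * (\<Sum>y<n. \<bar>pmf \<mu> y - pmf \<nu> y\<bar>)"

definition mixes_in_time :: "nat \<Rightarrow> (nat \<Rightarrow> nat pmf) \<Rightarrow> nat pmf \<Rightarrow> nat \<Rightarrow> bool" where
  "mixes_in_time n K \<pi> T \<longleftrightarrow> Max ((\<lambda>x. d_TV n (step_dist K T x) \<pi>) ` {..<n}) \<le> 1 / 4"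

definition pi_min :: "nat pmf \<Rightarrow> real" where
  "pi_min \<pi> = Min (pmf \<pi> ` set_pmf \<pi>)"

text \<open>
  Eigenvalues are taken over the complex numbers.  For \<open>n = 1\<close> the set is empty and the value
  is unspecified.
\<close>

definition abs_spectral_gap :: "nat \<Rightarrow> (nat \<Rightarrow> nat pmf) \<Rightarrow> real" where
  "abs_spectral_gap n K =
     Min {1 - cmod l | l. eigenvalue (map_mat complex_of_real (transition_matrix n K)) l \<and> l \<noteq> 1}"


section \<open>Randomized algorithms with access to a Markov chain\<close>

text \<open>
  Algorithms are programs of a structured real-RAM language.  Memory consists of natural-number
  variables and two-dimensional real arrays (a real scalar is the entry at index (0, 0)), all
  initially zero except for the inputs.  There is no conversion from reals to naturals, so that
  the unit-cost arithmetic cannot be abused for integer tricks such as rounding.  Real constants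
  are not part of the syntax either: a program cannot hard-wire anything about a particular chain.
\<close>

type_synonym vname = string

datatype nexp =
    NConst nat
  | NVar vname
  | NPlus nexp nexp
  | NMinus nexp nexp

datatype rexp =
    OfNat nexp
  | Entry vname nexp nexp
  | RPlus rexp rexp
  | RMinus rexp rexp
  | RTimes rexp rexp
  | RDivide rexp rexp

datatype bexp =
    NLess nexp nexp
  | RLess rexp rexp
  | Neg bexp
  | Conj bexp bexp

text \<open>
  \<open>Flip x p\<close> sets \<open>x\<close> to 1 with probability \<open>p\<close> (clamped to the unit interval) and to 0
  otherwise.  \<open>Step x a\<close> stores in \<open>x\<close> the result of one step of the chain from state \<open>a\<close>.
  \<open>LoadMatrix A\<close> computes the whole transition matrix and stores it in the array \<open>A\<close>.
\<close>

datatype com =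
    Skip
  | NAssign vname nexp
  | RAssign vname nexp nexp rexp
  | Flip vname rexp
  | Step vname nexp
  | LoadMatrix vname
  | Seq com com
  | Cond bexp com com
  | While bexp com

text \<open>
  How a program can access a chain: the number of states, the transition kernel, the time needed
  to simulate one step, and the time needed to compute the whole matrix.
\<close>

record chain_access =
  num_states :: nat
  trans_kernel :: "nat \<Rightarrow> nat pmf"
  step_time :: nat
  matrix_time :: nat

text \<open>The clock records the running time; programs cannot read it.\<close>

record store =
  nvars :: "vname \<Rightarrow> nat"
  arrays :: "vname \<Rightarrow> nat \<Rightarrow> nat \<Rightarrow> real"
  clock :: nat

primrec nval :: "nexp \<Rightarrow> store \<Rightarrow> nat" where
  "nval (NConst k) s = k"
| "nval (NVar x) s = nvars s x"
| "nval (NPlus a b) s = nval a s + nval b s"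
| "nval (NMinus a b) s = nval a s - nval b s"

primrec rval :: "rexp \<Rightarrow> store \<Rightarrow> real" where
  "rval (OfNat a) s = real (nval a s)"
| "rval (Entry A a b) s = arrays s A (nval a s) (nval b s)"
| "rval (RPlus p q) s = rval p s + rval q s"
| "rval (RMinus p q) s = rval p s - rval q s"
| "rval (RTimes p q) s = rval p s * rval q s"
| "rval (RDivide p q) s = rval p s / rval q s"

primrec bval :: "bexp \<Rightarrow> store \<Rightarrow> bool" where
  "bval (NLess a b) s \<longleftrightarrow> nval a s < nval b s"
| "bval (RLess p q) s \<longleftrightarrow> rval p s < rval q s"
| "bval (Neg b) s \<longleftrightarrow> \<not> bval b s"
| "bval (Conj b c) s \<longleftrightarrow> bval b s \<and> bval c s"

definition set_nvar :: "vname \<Rightarrow> nat \<Rightarrow> store \<Rightarrow> store" where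
  "set_nvar x k s = s\<lparr>nvars := (nvars s)(x := k)\<rparr>"

definition set_entry :: "vname \<Rightarrow> nat \<Rightarrow> nat \<Rightarrow> real \<Rightarrow> store \<Rightarrow> store" where
  "set_entry A i j r s =
     s\<lparr>arrays := (arrays s)(A := (arrays s A)(i := (arrays s A i)(j := r)))\<rparr>"

definition set_matrix :: "vname \<Rightarrow> real mat \<Rightarrow> store \<Rightarrow> store" where
  "set_matrix A M s =
     s\<lparr>arrays := (arrays s)(A := (\<lambda>i j.
        if i < dim_row M \<and> j < dim_col M then M $$ (i, j) else arrays s A i j))\<rparr>"

definition tick :: "nat \<Rightarrow> store \<Rightarrow> store" where
  "tick k s = s\<lparr>clock := clock s + k\<rparr>"

text \<open>Least fixed point in \<open>spmf\<close>: the missing mass is the probability of divergence.\<close>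

partial_function (spmf) loop :: "('s \<Rightarrow> bool) \<Rightarrow> ('s \<Rightarrow> 's spmf) \<Rightarrow> 's \<Rightarrow> 's spmf" where
  "loop b f s = (if b s then bind_spmf (f s) (loop b f) else return_spmf s)"

text \<open>
  Every executed instruction and every evaluated guard costs one unit of time; a chain step and
  a matrix computation additionally cost their access time.  The expressions of a fixed program
  have bounded size, so counting individual arithmetic operations changes the running time by at
  most a constant factor that depends only on the program.
\<close>

primrec exec :: "chain_access \<Rightarrow> com \<Rightarrow> store \<Rightarrow> store spmf" where
  "exec M Skip s = return_spmf (tick 1 s)"
| "exec M (NAssign x a) s = return_spmf (tick 1 (set_nvar x (nval a s) s))"
| "exec M (RAssign A a b p) s =
     return_spmf (tick 1 (set_entry A (nval a s) (nval b s) (rval p s) s))"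
| "exec M (Flip x p) s =
     map_spmf (\<lambda>c. tick 1 (set_nvar x (if c then 1 else 0) s))
       (spmf_of_pmf (bernoulli_pmf (rval p s)))"
| "exec M (Step x a) s =
     map_spmf (\<lambda>y. tick (1 + step_time M) (set_nvar x y s))
       (spmf_of_pmf (trans_kernel M (nval a s)))"
| "exec M (LoadMatrix A) s =
     return_spmf (tick (1 + matrix_time M)
       (set_matrix A (transition_matrix (num_states M) (trans_kernel M)) s))"
| "exec M (Seq c d) s = bind_spmf (exec M c s) (exec M d)"
| "exec M (Cond b c d) s = (if bval b s then exec M c (tick 1 s) else exec M d (tick 1 s))"
| "exec M (While b c) s = map_spmf (tick 1) (loop (bval b) (\<lambda>s. exec M c (tick 1 s)) s)"

text \<open>The result of a program is the final value of the variable \<open>out\<close>.\<close>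

definition perfect_sampler :: "chain_access \<Rightarrow> com \<Rightarrow> store \<Rightarrow> nat pmf \<Rightarrow> bool" where
  "perfect_sampler M A s \<pi> \<longleftrightarrow>
     lossless_spmf (exec M A s) \<and>
     map_spmf (\<lambda>s'. nvars s' ''out'') (exec M A s) = spmf_of_pmf \<pi>"

text \<open>
  Diverging runs do not contribute to this integral, so it is the expected running time only for
  programs that terminate with probability 1, as perfect samplers do.
\<close>

definition expected_time :: "chain_access \<Rightarrow> com \<Rightarrow> store \<Rightarrow> ennreal" where
  "expected_time M A s = (\<integral>\<^sup>+ s'. of_nat (clock s') \<partial>measure_spmf (exec M A s))"

text \<open>
  Inputs of the two samplers: the number of states, a start state, \<open>\<pi>\<^sub>*\<close>, and the mixing time
  or the absolute spectral gap.
\<close>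

definition mixing_input :: "nat \<Rightarrow> nat \<Rightarrow> real \<Rightarrow> nat \<Rightarrow> store" where
  "mixing_input n x\<^sub>0 p T =
     set_nvar ''T'' T
    (set_nvar ''start'' x\<^sub>0
    (set_nvar ''n'' n
    (set_entry ''pi_min'' 0 0 p
     \<lparr>nvars = (\<lambda>_. 0), arrays = (\<lambda>_ _ _. 0), clock = 0\<rparr>)))"

definition gap_input :: "nat \<Rightarrow> nat \<Rightarrow> real \<Rightarrow> real \<Rightarrow> store" where
  "gap_input n x\<^sub>0 p g =
     set_entry ''gap'' 0 0 g
    (set_nvar ''start'' x\<^sub>0
    (set_nvar ''n'' n
    (set_entry ''pi_min'' 0 0 p
     \<lparr>nvars = (\<lambda>_. 0), arrays = (\<lambda>_ _ _. 0), clock = 0\<rparr>)))"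

text \<open>
  One step can be simulated in constant time and the matrix can be computed in time \<open>O(n\<^sup>4)\<close>,
  with implied constants \<open>c_step\<close> and \<open>c_mat\<close>.
\<close>

definition efficient_access :: "nat \<Rightarrow> nat \<Rightarrow> chain_access \<Rightarrow> bool" where
  "efficient_access c_step c_mat M \<longleftrightarrow>
     markov_chain (num_states M) (trans_kernel M) \<and>
     step_time M \<le> c_step \<and> matrix_time M \<le> c_mat * num_states M ^ 4"

end

theory Submission
  imports Defs "Jordan_Normal_Form.Spectral_Radius"
begin

text \<open>
  Run the chain for so many steps that its law \<open>\<mu>\<close> satisfies \<open>(1 - \<epsilon>) \<mu> \<le> \<pi>\<close> pointwise with
  \<open>\<epsilon> = n\<^sup>-\<^sup>4\<close>.  With probability \<open>1 - \<epsilon>\<close> output the final state; otherwise sample exactly from the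
  residual \<open>(\<pi> - (1 - \<epsilon>) \<mu>) / \<epsilon>\<close>, at a polynomial cost that the factor \<open>\<epsilon>\<close> absorbs.

  The residual is sampled without ever computing \<open>\<pi>\<close>.  The column minima
  \<open>m\<^sub>t(y) = min\<^sub>x P\<^sup>t(x, y)\<close> over the support of \<open>\<pi>\<close> increase to \<open>\<pi>(y)\<close>, so one may sample
  sequentially from their increments, computing further powers of \<open>P\<close> only as needed.  It suffices
  to bound the output probabilities from below by \<open>\<pi>\<close>: equality and termination with probability 1
  follow, since the masses add up.

  For reversible chains the rate comes from the deflated matrix \<open>P - 1 \<pi>\<^sup>T\<close>, whose nonzero eigenvalues
  are eigenvalues of \<open>P\<close> other than 1 by uniqueness of the stationary distribution.
\<close>

section \<open>Loops and sequential sampling\<close>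

text \<open>Closeness in total variation alone does not give
  \<open>(1 - eps) \<mu> \<le> \<pi>\<close>: on small atoms the error must be small relative to
  \<pi>. A relative error \<eta> of order \<open>\<rho> ^ k / pi_min\<close> suffices once
  \<open>2 \<eta> \<le> eps\<close>, and this takes k of order ln (n / pi_min) / (1 - \<rho>),
  whence the logarithm in both time bounds. Mixing gives \<rho> = 1/2 per T steps, a gap \<gamma>
  gives \<rho> = 1 - \<gamma> per step; beyond that the two parts share one program.

  The exponent 4 balances the costs: loading the matrix takes O(n^4), each of the t0 preparatory
  products O(n^3), and a level of the search has n + 1 rounds charged O(n^3) each. Weighted by eps,
  all of this stays within the stated bounds.

  The levels reach \<pi> only in the limit, so the search has no fixed bound on its length. Its
  expected length is finite because the missing mass decays geometrically, while correctness needs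
  only finite unrollings: each level bounds the output law from below, and the limit is taken
  afterwards.\<close>

lemma nn_integral_bind_spmf:
  "(\<integral>\<^sup>+ x. f x \<partial>measure_spmf (bind_spmf p g)) =
   (\<integral>\<^sup>+ y. (\<integral>\<^sup>+ x. f x \<partial>measure_spmf (g y)) \<partial>measure_spmf p)"
  by (simp add: measure_spmf_bind, subst nn_integral_bind[where B="count_space UNIV"])
     (auto simp: space_subprob_algebra intro!: measure_spmf.subprob_space_axioms)

lemma nn_integral_return_spmf: "(\<integral>\<^sup>+ x. f x \<partial>measure_spmf (return_spmf s)) = f s"
  by (simp add: measure_spmf_return_spmf nn_integral_return)

lemma nn_integral_lub_spmf_le:
  fixes f :: "'a \<Rightarrow> ennreal"
  assumes chain: "Complete_Partial_Order.chain (ord_spmf (=)) Y" and Y: "Y \<noteq> {}"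
    and le: "\<And>p. p \<in> Y \<Longrightarrow> (\<integral>\<^sup>+ x. f x \<partial>measure_spmf p) \<le> c"
  shows "(\<integral>\<^sup>+ x. f x \<partial>measure_spmf (lub_spmf Y)) \<le> c"
proof -
  \<comment> \<open>The support of the limit is countable, which is what monotone convergence over a
    possibly uncountable chain \<open>Y\<close> requires.\<close>
  let ?B = "set_spmf (lub_spmf Y)"
  have "(\<integral>\<^sup>+ x. f x \<partial>measure_spmf (lub_spmf Y)) =
      (\<integral>\<^sup>+ x. (SUP p\<in>Y. ennreal (spmf p x) * f x) \<partial>count_space ?B)"
    by (simp add: nn_integral_measure_spmf' ennreal_spmf_lub_spmf[OF chain Y] SUP_mult_right_ennreal Y)
  also have "\<dots> = (SUP p\<in>Y. \<integral>\<^sup>+ x. ennreal (spmf p x) * f x \<partial>count_space ?B)"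
  proof (rule nn_integral_monotone_convergence_SUP_countable[OF Y])
    have "(\<lambda>i x. ennreal (spmf i x) * f x) ` Y = (\<lambda>g x. g x * f x) ` (\<lambda>p x. ennreal (spmf p x)) ` Y"
      by (simp add: image_image)
    also have "Complete_Partial_Order.chain (\<le>) \<dots>" using chain_ord_spmf_eqD[OF chain]
      by (rule chain_imageI) (auto simp: le_fun_def mult_right_mono)
    finally show "Complete_Partial_Order.chain (\<le>) ((\<lambda>i x. ennreal (spmf i x) * f x) ` Y)" .
  qed simp
  also have "\<dots> \<le> c"
  proof (rule SUP_least)
    fix p assume "p \<in> Y"
    have "(\<integral>\<^sup>+ x. ennreal (spmf p x) * f x \<partial>count_space ?B) \<le> (\<integral>\<^sup>+ x. ennreal (spmf p x) * f x \<partial>count_space UNIV)"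
      by (auto simp: nn_integral_count_space_indicator intro!: nn_integral_mono split: split_indicator)
    also have "\<dots> \<le> c" using le[OF \<open>p \<in> Y\<close>] by (simp add: nn_integral_measure_spmf)
    finally show "(\<integral>\<^sup>+ x. ennreal (spmf p x) * f x \<partial>count_space ?B) \<le> c" .
  qed
  finally show ?thesis .
qed

text \<open>Admissibility makes an integral bound accessible to fixpoint induction over
  \<open>loop\<close>: the bound passes from the approximations to their limit.\<close>

lemma admissible_nn_integral_spmf_le [cont_intro]:
  "mcont lub ord lub_spmf (ord_spmf (=)) g \<Longrightarrow>
   ccpo.admissible lub ord (\<lambda>x. (\<integral>\<^sup>+ y. f y \<partial>measure_spmf (g x)) \<le> c)"
  by (rule admissible_subst[where P="\<lambda>p. (\<integral>\<^sup>+ y. f y \<partial>measure_spmf p) \<le> c"])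
     (auto intro!: ccpo.admissibleI nn_integral_lub_spmf_le)

text \<open>Park induction; the ghost index \<open>k\<close> lets the bound depend on how far the loop has progressed.\<close>

lemma nn_integral_loop_le:
  fixes f :: "'s \<Rightarrow> ennreal" and I :: "'k \<Rightarrow> 's \<Rightarrow> ennreal"
  assumes exit: "\<And>k s. J k s \<Longrightarrow> \<not> b s \<Longrightarrow> f s \<le> I k s"
    and step: "\<And>k s g. J k s \<Longrightarrow> b s \<Longrightarrow>
        (\<And>k' s'. J k' s' \<Longrightarrow> (\<integral>\<^sup>+ x. f x \<partial>measure_spmf (g s')) \<le> I k' s') \<Longrightarrow>
        (\<integral>\<^sup>+ s'. (\<integral>\<^sup>+ x. f x \<partial>measure_spmf (g s')) \<partial>measure_spmf (c s)) \<le> I k s"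
    and "J k s"
  shows "(\<integral>\<^sup>+ x. f x \<partial>measure_spmf (loop b c s)) \<le> I k s"
proof -
  have "\<forall>k s. J k s \<longrightarrow> (\<integral>\<^sup>+ x. f x \<partial>measure_spmf (loop b c s)) \<le> I k s"
  proof (induction rule: loop.fixp_induct)
    case 1
    show ?case by simp
  next
    case 2
    then show ?case by simp
  next
    case (3 g)
    show ?case
    proof (intro allI impI)
      fix k s assume "J k s"
      then show "(\<integral>\<^sup>+ x. f x \<partial>measure_spmf (if b s then bind_spmf (c s) (g b c) else return_spmf s)) \<le> I k s"
        using exit[OF \<open>J k s\<close>] step[OF \<open>J k s\<close>, of "g b c"] 3
        by (cases "b s") (auto simp: nn_integral_bind_spmf nn_integral_return_spmf)
    qed
  qed
  then show ?thesis using \<open>J k s\<close> by blast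
qed

text \<open>
  Stopping at round \<open>k\<close> with conditional probability \<open>w k / rem k\<close>, where \<open>rem k\<close> is the mass not
  yet assigned, makes the unconditional probability of stopping there \<open>w k / rem 0\<close>.  Rounds with
  \<open>rem k = 0\<close> are reached with probability 0, which the convention \<open>x / 0 = 0\<close> hides below.
\<close>

locale sequential_sampler =
  fixes b :: "'s \<Rightarrow> bool" and body :: "'s \<Rightarrow> 's spmf" and St :: "nat \<Rightarrow> 's \<Rightarrow> bool"
    and w rem :: "nat \<Rightarrow> real" and val :: "'s \<Rightarrow> nat" and clk :: "'s \<Rightarrow> nat"
    and lab :: "nat \<Rightarrow> nat" and d :: nat
  assumes step: "\<And>k s. St k s \<Longrightarrow> b s \<and> (\<exists>s1 s2.
      body s = map_spmf (\<lambda>c. if c then s1 else s2) (spmf_of_pmf (bernoulli_pmf (w k / rem k))) \<and>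
      \<not> b s1 \<and> (w k \<noteq> 0 \<longrightarrow> val s1 = lab k) \<and> clk s1 \<le> clk s + d \<and> St (Suc k) s2 \<and> clk s2 \<le> clk s + d)"
    and w_nonneg: "\<And>k. 0 \<le> w k" and rem_nonneg: "\<And>k. 0 \<le> rem k"
    and rem_Suc: "\<And>k. rem (Suc k) = rem k - w k"
    and d_pos: "0 < d"
begin

lemma sum_w: "(\<Sum>i<m. w (k + i)) = rem k - rem (k + m)"
  by (induction m) (auto simp: rem_Suc)

lemma sum_lab_le: "(\<Sum>i<m. if lab (k + i) = y then w (k + i) else 0) \<le> rem k"
proof -
  have "(\<Sum>i<m. if lab (k + i) = y then w (k + i) else 0) \<le> (\<Sum>i<m. w (k + i))"
    by (intro sum_mono) (auto simp: w_nonneg)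
  also have "\<dots> \<le> rem k" using rem_nonneg[of "k + m"] by (simp add: sum_w)
  finally show ?thesis .
qed

lemma w_le_rem: "w k \<le> rem k"
  using rem_nonneg[of "Suc k"] by (simp add: rem_Suc)

lemma nn_integral_step:
  fixes F :: "'s \<Rightarrow> ennreal"
  shows "(\<integral>\<^sup>+ x. F x \<partial>measure_spmf (map_spmf (\<lambda>c. if c then s1 else s2) (spmf_of_pmf (bernoulli_pmf (w k / rem k)))))
     = F s1 * ennreal (w k / rem k) + F s2 * ennreal (1 - w k / rem k)"
proof -
  \<comment> \<open>Within these bounds \<open>bernoulli_pmf\<close> does not clamp. They also hold
    for \<open>rem k = 0\<close>, where the quotient is 0.\<close>
  have "0 \<le> w k / rem k" "w k / rem k \<le> 1"
    using w_nonneg[of k] rem_nonneg[of k] w_le_rem[of k] by (auto simp: divide_le_eq_1)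
  then show ?thesis by (simp del: map_spmf_of_pmf)
qed

text \<open>Unrolling the loop \<open>m\<close> times already produces the mass of the first
  \<open>m\<close> stopping rounds, so a lower bound on the output law needs neither a limit nor a
  termination argument.\<close>

lemma loop_ge:
  "St k s \<Longrightarrow> ennreal ((\<Sum>i<m. if lab (k + i) = y then w (k + i) else 0) / rem k)
     \<le> (\<integral>\<^sup>+ x. indicator {y} (val x) \<partial>measure_spmf (loop b body s))"
proof (induction m arbitrary: k s)
  case 0
  then show ?case by simp
next
  case (Suc m)
  obtain s1 s2 where *: "b s" "body s = map_spmf (\<lambda>c. if c then s1 else s2) (spmf_of_pmf (bernoulli_pmf (w k / rem k)))"
      "\<not> b s1" "w k \<noteq> 0 \<longrightarrow> val s1 = lab k" "St (Suc k) s2"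
    using step[OF Suc.prems] by blast
  let ?S = "\<Sum>i<m. if lab (Suc k + i) = y then w (Suc k + i) else 0"
  let ?S1 = "\<Sum>i<Suc m. if lab (k + i) = y then w (k + i) else 0"
  have S: "?S1 = (if lab k = y then w k else 0) + ?S"
    by (subst sum.lessThan_Suc_shift) (simp cong: if_cong)
  have S_le: "?S \<le> rem (Suc k)" by (rule sum_lab_le)
  have S_nn: "0 \<le> ?S" by (intro sum_nonneg) (auto simp: w_nonneg)
  have q: "0 \<le> w k / rem k" "w k / rem k \<le> 1"
    using w_nonneg[of k] rem_nonneg[of k] w_le_rem[of k] by (auto simp: divide_le_eq_1)
  show ?case
  proof (cases "rem k = 0")
    case True
    then show ?thesis by simp
  next
    case False
    then have pos: "rem k > 0" using rem_nonneg[of k] by simp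
    have eq: "?S1 / rem k = (if lab k = y then 1 else 0) * (w k / rem k) + ?S / rem (Suc k) * (1 - w k / rem k)"
    proof (cases "rem (Suc k) = 0")
      \<comment> \<open>Nothing is left to assign, so the tail sum is 0 and agrees with the quotient
        by zero.\<close>
      case True
      then have "?S = 0" using S_le S_nn by linarith
      then show ?thesis by (simp only: S) simp
    next
      case False
      then show ?thesis using pos by (simp only: S) (simp add: rem_Suc field_simps)
    qed
    define t where "t = ?S / rem (Suc k)"
    have t: "0 \<le> t" unfolding t_def using S_nn rem_nonneg[of "Suc k"] by (rule divide_nonneg_nonneg)
    have "ennreal (?S1 / rem k) = ennreal (if lab k = y then 1 else 0) * ennreal (w k / rem k)
        + ennreal t * ennreal (1 - w k / rem k)"
      unfolding eq t_def[symmetric] using q t by (subst ennreal_plus) (auto simp: ennreal_mult)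
    also have "\<dots> \<le> indicator {y} (val s1) * ennreal (w k / rem k)
        + (\<integral>\<^sup>+ x. indicator {y} (val x) \<partial>measure_spmf (loop b body s2)) * ennreal (1 - w k / rem k)"
    proof (intro add_mono)
      show "ennreal (if lab k = y then 1 else 0) * ennreal (w k / rem k) \<le> indicator {y} (val s1) * ennreal (w k / rem k)"
        using *(4) by (cases "w k = 0") auto
    qed (use Suc.IH[OF *(5)] in \<open>auto simp: t_def intro!: mult_right_mono\<close>)
    also have "\<dots> = (\<integral>\<^sup>+ x. indicator {y} (val x) \<partial>measure_spmf (loop b body s))"
      by (subst (2) loop.simps)
         (simp only: *(1) if_True nn_integral_bind_spmf *(2) nn_integral_step,
          subst loop.simps, simp add: *(3) nn_integral_return_spmf)
    finally show ?thesis .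
  qed
qed

text \<open>The loop is still running \<open>i\<close> rounds after round \<open>k\<close> with
  probability \<open>rem (k + i) / rem k\<close>; these survival probabilities sum to the expected
  number of rounds, each of cost at most \<open>d\<close>.\<close>

lemma loop_clock_le:
  assumes "St k s" "rem k > 0"
  shows "(\<integral>\<^sup>+ x. of_nat (clk x) \<partial>measure_spmf (loop b body s))
     \<le> of_nat (clk s) + of_nat d * (\<Sum>i. ennreal (rem (k + i))) / ennreal (rem k)"
proof -
  \<comment> \<open>The index \<open>None\<close> stands for a store whose loop has stopped. For
    running loops, \<open>rem k > 0\<close> keeps the potential \<open>I\<close> free of division by
    zero.\<close>
  define J where "J = (\<lambda>z s. case z of None \<Rightarrow> \<not> b s | Some k \<Rightarrow> St k s \<and> rem k > 0)"
  define I where "I = (\<lambda>z s. of_nat (clk s) + (case z of None \<Rightarrow> 0 |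
      Some k \<Rightarrow> of_nat d * (\<Sum>i. ennreal (rem (k + i))) / ennreal (rem k)))"
  have "(\<integral>\<^sup>+ x. of_nat (clk x) \<partial>measure_spmf (loop b body s)) \<le> I (Some k) s"
  proof (rule nn_integral_loop_le[where J=J])
    show "of_nat (clk s) \<le> I z s" for z s by (simp add: I_def)
    show "J (Some k) s" using assms by (simp add: J_def)
    fix z s g
    assume J: "J z s" and b: "b s"
      and IH: "\<And>z' s'. J z' s' \<Longrightarrow> (\<integral>\<^sup>+ x. of_nat (clk x) \<partial>measure_spmf (g s')) \<le> I z' s'"
    from J b obtain k where z: "z = Some k" "St k s" "rem k > 0"
      by (auto simp: J_def split: option.splits)
    obtain s1 s2 where *: "body s = map_spmf (\<lambda>c. if c then s1 else s2) (spmf_of_pmf (bernoulli_pmf (w k / rem k)))"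
        "\<not> b s1" "clk s1 \<le> clk s + d" "St (Suc k) s2" "clk s2 \<le> clk s + d"
      using step[OF z(2)] by blast
    let ?T = "\<Sum>i. ennreal (rem (Suc k + i))"
    \<comment> \<open>The term \<open>rem k\<close> split off here, divided by \<open>rem k\<close>,
      pays the cost \<open>d\<close> of the current round.\<close>
    have T: "(\<Sum>i. ennreal (rem (k + i))) = ennreal (rem k) + ?T"
      using suminf_offset[of "\<lambda>i. ennreal (rem (k + i))" 1] by (simp add: add.commute)
    have q: "0 \<le> w k / rem k" "w k / rem k \<le> 1" "1 - w k / rem k = rem (Suc k) / rem k"
      using w_nonneg[of k] z(3) w_le_rem[of k] by (auto simp: divide_le_eq_1 rem_Suc field_simps)
    have g1: "(\<integral>\<^sup>+ x. of_nat (clk x) \<partial>measure_spmf (g s1)) \<le> of_nat (clk s + d)"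
    proof -
      have "(\<integral>\<^sup>+ x. of_nat (clk x) \<partial>measure_spmf (g s1)) \<le> of_nat (clk s1)"
        using IH[of None s1] *(2) by (simp add: J_def I_def)
      also have "\<dots> \<le> of_nat (clk s + d)" using *(3) by (simp only: of_nat_le_iff)
      finally show ?thesis .
    qed
    have "(\<integral>\<^sup>+ s'. (\<integral>\<^sup>+ x. of_nat (clk x) \<partial>measure_spmf (g s')) \<partial>measure_spmf (body s))
        = (\<integral>\<^sup>+ x. of_nat (clk x) \<partial>measure_spmf (g s1)) * ennreal (w k / rem k)
        + (\<integral>\<^sup>+ x. of_nat (clk x) \<partial>measure_spmf (g s2)) * ennreal (rem (Suc k) / rem k)"
      by (simp only: *(1) nn_integral_step q(3))
    also have "\<dots> \<le> of_nat (clk s + d) * ennreal (w k / rem k)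
        + (of_nat (clk s + d) * ennreal (rem (Suc k) / rem k) + of_nat d * ?T / ennreal (rem k))"
    proof (intro add_mono mult_right_mono g1)
      show "(\<integral>\<^sup>+ x. of_nat (clk x) \<partial>measure_spmf (g s2)) * ennreal (rem (Suc k) / rem k)
        \<le> of_nat (clk s + d) * ennreal (rem (Suc k) / rem k) + of_nat d * ?T / ennreal (rem k)"
      proof (cases "rem (Suc k) = 0")
        \<comment> \<open>No bound on \<open>g s2\<close> is available here, and its integral may be
          infinite; continuing has probability 0, and 0 times infinity is 0 in
          \<open>ennreal\<close>.\<close>
        case True
        then show ?thesis by simp
      next
        case False
        then have pos: "rem (Suc k) > 0" using rem_nonneg[of "Suc k"] by simp
        have "(\<integral>\<^sup>+ x. of_nat (clk x) \<partial>measure_spmf (g s2)) \<le> I (Some (Suc k)) s2"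
          using IH[of "Some (Suc k)" s2] *(4) pos by (simp add: J_def)
        also have "\<dots> \<le> of_nat (clk s + d) + of_nat d * ?T / ennreal (rem (Suc k))"
          using *(5) unfolding I_def by (auto intro!: add_mono simp del: of_nat_add)
        finally have "(\<integral>\<^sup>+ x. of_nat (clk x) \<partial>measure_spmf (g s2)) * ennreal (rem (Suc k) / rem k)
            \<le> (of_nat (clk s + d) + of_nat d * ?T / ennreal (rem (Suc k))) * ennreal (rem (Suc k) / rem k)"
          by (rule mult_right_mono) simp
        also have "\<dots> = of_nat (clk s + d) * ennreal (rem (Suc k) / rem k)
            + (of_nat d * ?T / ennreal (rem (Suc k))) * ennreal (rem (Suc k) / rem k)"
          by (simp add: distrib_right)
        also have "(of_nat d * ?T / ennreal (rem (Suc k))) * ennreal (rem (Suc k) / rem k)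
            = of_nat d * ?T / ennreal (rem k)"
        proof -
          have "inverse (ennreal (rem (Suc k))) * ennreal (rem (Suc k) / rem k) = inverse (ennreal (rem k))"
            using pos z(3) by (simp add: inverse_ennreal ennreal_mult[symmetric] field_simps)
          then show ?thesis by (simp add: divide_ennreal_def mult.assoc)
        qed
        finally show ?thesis .
      qed
    qed auto
    also have "\<dots> = of_nat (clk s + d) * ennreal (w k / rem k + rem (Suc k) / rem k) + of_nat d * ?T / ennreal (rem k)"
      using q z(3) rem_nonneg[of "Suc k"] by (simp add: ennreal_plus distrib_left add.assoc)
    also have "w k / rem k + rem (Suc k) / rem k = 1" using q(3) by simp
    also have "of_nat (clk s + d) * ennreal 1 + of_nat d * ?T / ennreal (rem k) = I z s"
      using z(3) by (simp add: I_def z(1) T distrib_left add_divide_distrib_ennreal ennreal_mult_divide_eq add.assoc)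
    finally show "(\<integral>\<^sup>+ s'. (\<integral>\<^sup>+ x. of_nat (clk x) \<partial>measure_spmf (g s')) \<partial>measure_spmf (body s)) \<le> I z s" .
  qed
  then show ?thesis by (simp add: I_def)
qed

end

section \<open>A Hoare logic for deterministic programs\<close>

lemma nval_cong: "nvars s = nvars s' \<Longrightarrow> nval a s = nval a s'"
  by (induction a) auto

lemma rval_cong: "nvars s = nvars s' \<Longrightarrow> arrays s = arrays s' \<Longrightarrow> rval p s = rval p s'"
  by (induction p) (auto simp: nval_cong[of s s'])

lemma bval_cong: "nvars s = nvars s' \<Longrightarrow> arrays s = arrays s' \<Longrightarrow> bval b s = bval b s'"
  by (induction b) (auto simp: nval_cong[of s s'] rval_cong[of s s'])

text \<open>Assertions cannot mention the clock, since no expression can read it; the clock value 0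
  in \<open>mem\<close> is therefore arbitrary.\<close>

type_synonym assn = "(vname \<Rightarrow> nat) \<Rightarrow> (vname \<Rightarrow> nat \<Rightarrow> nat \<Rightarrow> real) \<Rightarrow> bool"

abbreviation mem :: "(vname \<Rightarrow> nat) \<Rightarrow> (vname \<Rightarrow> nat \<Rightarrow> nat \<Rightarrow> real) \<Rightarrow> store" where
  "mem N R \<equiv> \<lparr>nvars = N, arrays = R, clock = 0\<rparr>"

text \<open>The point mass \<open>return_spmf s'\<close> makes a triple assert determinism and
  termination along with the time bound. Random instructions are treated outside this logic.\<close>

definition hoare :: "chain_access \<Rightarrow> assn \<Rightarrow> com \<Rightarrow> nat \<Rightarrow> assn \<Rightarrow> bool" where
  "hoare M P c d Q \<longleftrightarrow> (\<forall>s. P (nvars s) (arrays s) \<longrightarrow>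
     (\<exists>s'. exec M c s = return_spmf s' \<and> Q (nvars s') (arrays s') \<and> clock s' \<le> clock s + d))"

lemma store_sel_simps [simp]:
  "nvars (tick k s) = nvars s" "arrays (tick k s) = arrays s" "clock (tick k s) = clock s + k"
  "nvars (set_nvar x a s) = (nvars s)(x := a)" "arrays (set_nvar x a s) = arrays s"
  "clock (set_nvar x a s) = clock s"
  "nvars (set_entry A i j r s) = nvars s"
  "arrays (set_entry A i j r s) = (arrays s)(A := (arrays s A)(i := (arrays s A i)(j := r)))"
  "clock (set_entry A i j r s) = clock s"
  by (simp_all add: tick_def set_nvar_def set_entry_def)

lemma nval_mem: "nval a s = nval a (mem (nvars s) (arrays s))"
  by (rule nval_cong) simp

lemma rval_mem: "rval p s = rval p (mem (nvars s) (arrays s))"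
  by (rule rval_cong) simp_all

lemma bval_mem: "bval b s = bval b (mem (nvars s) (arrays s))"
  by (rule bval_cong) simp_all

lemma hoareD:
  assumes "hoare M P c d Q" "P (nvars s) (arrays s)"
  obtains s' where "exec M c s = return_spmf s'" "Q (nvars s') (arrays s')" "clock s' \<le> clock s + d"
  using assms unfolding hoare_def by blast

lemma hoare_Skip: "hoare M P Skip 1 P"
  by (auto simp: hoare_def)

lemma hoare_NAssign:
  assumes "\<And>N R. P N R \<Longrightarrow> Q (N(x := nval a (mem N R))) R"
  shows "hoare M P (NAssign x a) 1 Q"
  unfolding hoare_def
proof (intro allI impI)
  fix s :: store assume "P (nvars s) (arrays s)"
  from assms[OF this] show "\<exists>s'. exec M (NAssign x a) s = return_spmf s' \<and> Q (nvars s') (arrays s') \<and> clock s' \<le> clock s + 1"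
    by (simp add: nval_mem[symmetric])
qed

lemma hoare_RAssign:
  assumes "\<And>N R. P N R \<Longrightarrow>
     Q N (R(A := (R A)(nval a (mem N R) := (R A (nval a (mem N R)))(nval b (mem N R) := rval p (mem N R)))))"
  shows "hoare M P (RAssign A a b p) 1 Q"
  unfolding hoare_def
proof (intro allI impI)
  fix s :: store assume "P (nvars s) (arrays s)"
  from assms[OF this] show "\<exists>s'. exec M (RAssign A a b p) s = return_spmf s' \<and> Q (nvars s') (arrays s') \<and> clock s' \<le> clock s + 1"
    by (simp add: nval_mem[symmetric] rval_mem[symmetric])
qed

lemma hoare_Seq:
  assumes "hoare M P c d Q" "hoare M Q c' d' Q'"
  shows "hoare M P (Seq c c') (d + d') Q'"
  unfolding hoare_def
proof (intro allI impI)
  fix s :: store assume "P (nvars s) (arrays s)"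
  then obtain s' where s': "exec M c s = return_spmf s'" "Q (nvars s') (arrays s')" "clock s' \<le> clock s + d"
    using hoareD[OF assms(1)] by blast
  then obtain s'' where "exec M c' s' = return_spmf s''" "Q' (nvars s'') (arrays s'')" "clock s'' \<le> clock s' + d'"
    using hoareD[OF assms(2)] by blast
  with s' show "\<exists>s'. exec M (Seq c c') s = return_spmf s' \<and> Q' (nvars s') (arrays s') \<and> clock s' \<le> clock s + (d + d')"
    by (intro exI[of _ s'']) simp
qed

lemma hoare_Cond:
  assumes "hoare M (\<lambda>N R. P N R \<and> bval b (mem N R)) c d Q"
    and "hoare M (\<lambda>N R. P N R \<and> \<not> bval b (mem N R)) c' d Q"
  shows "hoare M P (Cond b c c') (d + 1) Q"
  unfolding hoare_def
proof (intro allI impI)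
  fix s :: store assume P: "P (nvars s) (arrays s)"
  show "\<exists>s'. exec M (Cond b c c') s = return_spmf s' \<and> Q (nvars s') (arrays s') \<and> clock s' \<le> clock s + (d + 1)"
  proof (cases "bval b s")
    case True
    then show ?thesis
      using P hoareD[OF assms(1), of "tick 1 s"] by (auto simp: bval_mem[symmetric])
  next
    case False
    then show ?thesis
      using P hoareD[OF assms(2), of "tick 1 s"] by (auto simp: bval_mem[symmetric])
  qed
qed

lemma hoare_weaken:
  assumes "hoare M P c d Q" "\<And>N R. P' N R \<Longrightarrow> P N R" "\<And>N R. Q N R \<Longrightarrow> Q' N R" "d \<le> d'"
  shows "hoare M P' c d' Q'"
  using assms unfolding hoare_def by (meson add_left_mono le_trans)

definition For :: "vname \<Rightarrow> vname \<Rightarrow> com \<Rightarrow> com" where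
  "For x m c = Seq (NAssign x (NConst 0))
     (While (NLess (NVar x) (NVar m)) (Seq c (NAssign x (NPlus (NVar x) (NConst 1)))))"

text \<open>The body establishes the invariant for the store that the increment is about to produce.
  Guard and increment add 2 to each round; the final 2 pays for the initialisation and the exit of
  the loop.\<close>

lemma hoare_For:
  assumes init: "\<And>N R. P N R \<Longrightarrow> Inv 0 (N(x := 0)) R"
    and inv: "\<And>i N R. Inv i N R \<Longrightarrow> N x = i \<and> N m = n"
    and body: "\<And>i. i < n \<Longrightarrow> hoare M (Inv i) c d (\<lambda>N R. N x = i \<and> Inv (Suc i) (N(x := Suc i)) R)"
    and post: "\<And>N R. Inv n N R \<Longrightarrow> Q N R"
  shows "hoare M P (For x m c) (n * (d + 2) + 2) Q"
proof -
  let ?b = "bval (NLess (NVar x) (NVar m))"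
  let ?c = "\<lambda>s. exec M (Seq c (NAssign x (NPlus (NVar x) (NConst 1)))) (tick 1 s)"
  have loop: "\<exists>s'. loop ?b ?c s = return_spmf s' \<and> Inv n (nvars s') (arrays s') \<and> clock s' \<le> clock s + (n - i) * (d + 2)"
    if "Inv i (nvars s) (arrays s)" "i \<le> n" for i and s :: store
    using that
  proof (induction "n - i" arbitrary: i s)
    case 0
    then have "i = n" by simp
    with 0 inv[of i "nvars s" "arrays s"] show ?case by (subst loop.simps) auto
  next
    case (Suc k)
    then have "i < n" by simp
    obtain s' where s': "exec M c (tick 1 s) = return_spmf s'" "nvars s' x = i"
        "Inv (Suc i) ((nvars s')(x := Suc i)) (arrays s')" "clock s' \<le> clock s + 1 + d"
      using hoareD[OF body[OF \<open>i < n\<close>], of "tick 1 s"] Suc.prems by auto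
    define s2 where "s2 = tick 1 (set_nvar x (Suc i) s')"
    have "\<exists>s'. loop ?b ?c s2 = return_spmf s' \<and> Inv n (nvars s') (arrays s') \<and> clock s' \<le> clock s2 + (n - Suc i) * (d + 2)"
      by (rule Suc.hyps(1)) (use Suc s' in \<open>auto simp: s2_def\<close>)
    then obtain s3 where s3: "loop ?b ?c s2 = return_spmf s3" "Inv n (nvars s3) (arrays s3)"
        "clock s3 \<le> clock s2 + (n - Suc i) * (d + 2)" by blast
    have "clock s2 \<le> clock s + (d + 2)" using s'(4) by (simp add: s2_def)
    moreover have "n - i = Suc (n - Suc i)" using \<open>i < n\<close> by simp
    ultimately have "clock s3 \<le> clock s + (n - i) * (d + 2)" using s3(3) by simp
    moreover have "loop ?b ?c s = loop ?b ?c s2"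
      using inv[OF Suc.prems(1)] \<open>i < n\<close> s' by (subst loop.simps) (simp add: s2_def)
    ultimately show ?case using s3 by auto
  qed
  show ?thesis
    unfolding hoare_def
  proof (intro allI impI)
    fix s :: store assume "P (nvars s) (arrays s)"
    then obtain s' where "loop ?b ?c (tick 1 (set_nvar x 0 s)) = return_spmf s'" "Inv n (nvars s') (arrays s')"
        "clock s' \<le> clock s + 1 + n * (d + 2)"
      using loop[of 0 "tick 1 (set_nvar x 0 s)"] init by auto
    then show "\<exists>s'. exec M (For x m c) s = return_spmf s' \<and> Q (nvars s') (arrays s') \<and> clock s' \<le> clock s + (n * (d + 2) + 2)"
      using post by (intro exI[of _ "tick 1 s'"]) (simp add: For_def)
  qed
qed

section \<open>The program\<close>

abbreviation Scal :: "vname \<Rightarrow> rexp" where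
  "Scal A \<equiv> Entry A (NConst 0) (NConst 0)"

abbreviation SetScal :: "vname \<Rightarrow> rexp \<Rightarrow> com" where
  "SetScal A \<equiv> RAssign A (NConst 0) (NConst 0)"

text \<open>A new row depends on the whole old row, so it is collected in \<open>Y\<close> before
  \<open>X\<close> is overwritten. Different rows do not interact, hence one buffered row
  suffices.\<close>

definition mat_step :: com where
  "mat_step = For ''i'' ''n'' (Seq
     (For ''j'' ''n''
       (Seq (SetScal ''acc'' (RTimes (Scal ''lz'') (Entry ''X'' (NVar ''i'') (NVar ''j''))))
       (Seq (For ''k'' ''n'' (SetScal ''acc'' (RPlus (Scal ''acc'')
               (RTimes (Entry ''X'' (NVar ''i'') (NVar ''k'')) (Entry ''A'' (NVar ''k'') (NVar ''j''))))))
         (RAssign ''Y'' (NVar ''j'') (NConst 0)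
           (RDivide (Scal ''acc'') (RPlus (OfNat (NConst 1)) (Scal ''lz'')))))))
     (For ''j'' ''n'' (RAssign ''X'' (NVar ''i'') (NVar ''j'') (Entry ''Y'' (NVar ''j'') (NConst 0)))))"

definition mat_step_cost :: "nat \<Rightarrow> nat" where
  "mat_step_cost n = n * (n * (n * 3 + 6) + 2 + (n * 3 + 2) + 2) + 2"

lemma hoare_mat_step:
  fixes R0 :: "vname \<Rightarrow> nat \<Rightarrow> nat \<Rightarrow> real"
  assumes n: "N0 ''n'' = n"
  defines "new \<equiv> \<lambda>a b. ((\<Sum>k<n. R0 ''X'' a k * R0 ''A'' k b) + R0 ''lz'' 0 0 * R0 ''X'' a b) / (1 + R0 ''lz'' 0 0)"
  shows "hoare M (\<lambda>N R. N = N0 \<and> R = R0) mat_step (mat_step_cost n)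
    (\<lambda>N R. (\<forall>z. z \<notin> {''i'', ''j'', ''k''} \<longrightarrow> N z = N0 z) \<and> (\<forall>z. z \<notin> {''X'', ''Y'', ''acc''} \<longrightarrow> R z = R0 z) \<and>
       (\<forall>a<n. \<forall>b<n. R ''X'' a b = new a b))"
proof -
  define F where "F = (\<lambda>i (N :: vname \<Rightarrow> nat) (R :: vname \<Rightarrow> nat \<Rightarrow> nat \<Rightarrow> real).
     N ''i'' = i \<and> (\<forall>z. z \<notin> {''i'', ''j'', ''k''} \<longrightarrow> N z = N0 z) \<and> (\<forall>z. z \<notin> {''X'', ''Y'', ''acc''} \<longrightarrow> R z = R0 z))"
  define I1 where "I1 = (\<lambda>i N R. F i N R \<and> (\<forall>a<n. \<forall>b<n. R ''X'' a b = (if a < i then new a b else R0 ''X'' a b)))"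
  define I2 where "I2 = (\<lambda>i j N R. I1 i N R \<and> N ''j'' = j \<and> (\<forall>b<j. R ''Y'' b 0 = new i b))"
  define I3 where "I3 = (\<lambda>i j k N R. I2 i j N R \<and> N ''k'' = k \<and>
      R ''acc'' 0 0 = (\<Sum>k<k. R0 ''X'' i k * R0 ''A'' k j) + R0 ''lz'' 0 0 * R0 ''X'' i j)"
  define I4 where "I4 = (\<lambda>i j N R. F i N R \<and> N ''j'' = j \<and> (\<forall>b<n. R ''Y'' b 0 = new i b) \<and>
      (\<forall>a<n. \<forall>b<n. R ''X'' a b = (if a < i \<or> a = i \<and> b < j then new a b else R0 ''X'' a b)))"
  have k_loop: "hoare M (\<lambda>N R. I2 i j N R \<and> R ''acc'' 0 0 = R0 ''lz'' 0 0 * R0 ''X'' i j)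
      (For ''k'' ''n'' (SetScal ''acc'' (RPlus (Scal ''acc'')
               (RTimes (Entry ''X'' (NVar ''i'') (NVar ''k'')) (Entry ''A'' (NVar ''k'') (NVar ''j''))))))
      (n * (1 + 2) + 2) (I3 i j n)" if "i < n" "j < n" for i j
  proof (rule hoare_For[where Inv="I3 i j"])
    show "I3 i j 0 (N(''k'' := 0)) R" if "I2 i j N R \<and> R ''acc'' 0 0 = R0 ''lz'' 0 0 * R0 ''X'' i j" for N R
      using that by (auto simp: I3_def I2_def I1_def F_def)
    show "N ''k'' = k \<and> N ''n'' = n" if "I3 i j k N R" for k N R
      using that n by (auto simp: I3_def I2_def I1_def F_def)
    show "hoare M (I3 i j k) (SetScal ''acc'' (RPlus (Scal ''acc'')
        (RTimes (Entry ''X'' (NVar ''i'') (NVar ''k'')) (Entry ''A'' (NVar ''k'') (NVar ''j''))))) 1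
       (\<lambda>N R. N ''k'' = k \<and> I3 i j (Suc k) (N(''k'' := Suc k)) R)" if "k < n" for k
      by (rule hoare_RAssign) (use that \<open>i < n\<close> \<open>j < n\<close> in \<open>clarsimp simp: I3_def I2_def I1_def F_def\<close>)
  qed
  have j_body: "hoare M (I2 i j) (Seq (SetScal ''acc'' (RTimes (Scal ''lz'') (Entry ''X'' (NVar ''i'') (NVar ''j''))))
       (Seq (For ''k'' ''n'' (SetScal ''acc'' (RPlus (Scal ''acc'')
               (RTimes (Entry ''X'' (NVar ''i'') (NVar ''k'')) (Entry ''A'' (NVar ''k'') (NVar ''j''))))))
         (RAssign ''Y'' (NVar ''j'') (NConst 0)
           (RDivide (Scal ''acc'') (RPlus (OfNat (NConst 1)) (Scal ''lz''))))))
      (1 + ((n * (1 + 2) + 2) + 1)) (\<lambda>N R. N ''j'' = j \<and> I2 i (Suc j) (N(''j'' := Suc j)) R)"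
    if "i < n" "j < n" for i j
  proof -
    have "hoare M (\<lambda>N R. I2 i j N R \<and> R ''acc'' 0 0 = R0 ''lz'' 0 0 * R0 ''X'' i j)
       (Seq (For ''k'' ''n'' (SetScal ''acc'' (RPlus (Scal ''acc'')
               (RTimes (Entry ''X'' (NVar ''i'') (NVar ''k'')) (Entry ''A'' (NVar ''k'') (NVar ''j''))))))
         (RAssign ''Y'' (NVar ''j'') (NConst 0)
           (RDivide (Scal ''acc'') (RPlus (OfNat (NConst 1)) (Scal ''lz'')))))
      ((n * (1 + 2) + 2) + 1) (\<lambda>N R. N ''j'' = j \<and> I2 i (Suc j) (N(''j'' := Suc j)) R)"
      by (rule hoare_Seq[OF k_loop[OF that]], rule hoare_RAssign)
         (use that n in \<open>auto simp: I3_def I2_def I1_def F_def new_def less_Suc_eq\<close>)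
    then show ?thesis
      by (rule hoare_Seq[rotated], intro hoare_RAssign)
         (use that n in \<open>auto simp: I2_def I1_def F_def\<close>)
  qed
  have j_loop: "hoare M (I1 i) (For ''j'' ''n''
       (Seq (SetScal ''acc'' (RTimes (Scal ''lz'') (Entry ''X'' (NVar ''i'') (NVar ''j''))))
       (Seq (For ''k'' ''n'' (SetScal ''acc'' (RPlus (Scal ''acc'')
               (RTimes (Entry ''X'' (NVar ''i'') (NVar ''k'')) (Entry ''A'' (NVar ''k'') (NVar ''j''))))))
         (RAssign ''Y'' (NVar ''j'') (NConst 0)
           (RDivide (Scal ''acc'') (RPlus (OfNat (NConst 1)) (Scal ''lz'')))))))
      (n * ((1 + ((n * (1 + 2) + 2) + 1)) + 2) + 2) (I2 i n)" if "i < n" for i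
    by (rule hoare_For[where Inv="I2 i", OF _ _ j_body[OF that]])
       (use that n in \<open>auto simp: I2_def I1_def F_def\<close>)
  have copy: "hoare M (I2 i n) (For ''j'' ''n'' (RAssign ''X'' (NVar ''i'') (NVar ''j'') (Entry ''Y'' (NVar ''j'') (NConst 0))))
      (n * (1 + 2) + 2) (\<lambda>N R. N ''i'' = i \<and> I1 (Suc i) (N(''i'' := Suc i)) R)" if "i < n" for i
  proof (rule hoare_For[where Inv="I4 i"])
    show "I4 i 0 (N(''j'' := 0)) R" if "I2 i n N R" for N R
      using that by (auto simp: I4_def I2_def I1_def F_def)
    show "N ''j'' = j \<and> N ''n'' = n" if "I4 i j N R" for j N R
      using that n by (auto simp: I4_def F_def)
    show "N ''i'' = i \<and> I1 (Suc i) (N(''i'' := Suc i)) R" if "I4 i n N R" for N R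
      using that by (auto simp: I4_def I1_def F_def less_Suc_eq)
    show "hoare M (I4 i j) (RAssign ''X'' (NVar ''i'') (NVar ''j'') (Entry ''Y'' (NVar ''j'') (NConst 0))) 1
       (\<lambda>N R. N ''j'' = j \<and> I4 i (Suc j) (N(''j'' := Suc j)) R)" if "j < n" for j
      by (rule hoare_RAssign) (use that in \<open>auto simp: I4_def F_def less_Suc_eq\<close>)
  qed
  have "hoare M (\<lambda>N R. N = N0 \<and> R = R0) mat_step
      (n * (((n * ((1 + ((n * (1 + 2) + 2) + 1)) + 2) + 2) + (n * (1 + 2) + 2)) + 2) + 2) (I1 n)"
    unfolding mat_step_def
    by (rule hoare_For[where Inv=I1, OF _ _ hoare_Seq[OF j_loop copy]])
       (use n in \<open>auto simp: I1_def F_def\<close>)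
  then show ?thesis
    by (rule hoare_weaken) (auto simp: I1_def F_def mat_step_cost_def algebra_simps)
qed

text \<open>Freezing the initial memory lets a postcondition refer to it, as in
  \<open>hoare_mat_step\<close>, where the product is expressed through the old entries.\<close>

lemma hoare_ghost:
  assumes "\<And>N0 R0. P N0 R0 \<Longrightarrow> hoare M (\<lambda>N R. N = N0 \<and> R = R0) c d Q"
  shows "hoare M P c d Q"
  using assms unfolding hoare_def by blast

lemma hoare_LoadMatrix:
  assumes "\<And>N R. P N R \<Longrightarrow> Q N (R(A := (\<lambda>i j. if i < num_states M \<and> j < num_states M
      then pmf (trans_kernel M i) j else R A i j)))"
  shows "hoare M P (LoadMatrix A) (1 + matrix_time M) Q"
  unfolding hoare_def
proof (intro allI impI)
  fix s :: store assume "P (nvars s) (arrays s)"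
  moreover have "arrays (set_matrix A (transition_matrix (num_states M) (trans_kernel M)) s) =
     (arrays s)(A := (\<lambda>i j. if i < num_states M \<and> j < num_states M
      then pmf (trans_kernel M i) j else arrays s A i j))"
    by (auto simp: set_matrix_def transition_matrix_def fun_eq_iff)
  moreover have "nvars (set_matrix A (transition_matrix (num_states M) (trans_kernel M)) s) = nvars s"
     "clock (set_matrix A (transition_matrix (num_states M) (trans_kernel M)) s) = clock s"
    by (simp_all add: set_matrix_def)
  ultimately show "\<exists>s'. exec M (LoadMatrix A) s = return_spmf s' \<and> Q (nvars s') (arrays s') \<and> clock s' \<le> clock s + (1 + matrix_time M)"
    using assms[of "nvars s" "arrays s"] by auto
qed

text \<open>A matrix product round of the search makes no random choice; writing it as a flip of
  bias 0 gives all rounds one shape.\<close>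

lemma bernoulli_pmf_0: "bernoulli_pmf 0 = return_pmf False"
proof (rule pmf_eqI)
  fix c show "pmf (bernoulli_pmf 0) c = pmf (return_pmf False) c"
    by (cases c) simp_all
qed

text \<open>Powers of \<open>(P + lz I) / (1 + lz)\<close>: the chain itself for \<open>lz = 0\<close>, the lazy chain for \<open>lz = 1\<close>.\<close>

primrec lazy_pow :: "(nat \<Rightarrow> nat pmf) \<Rightarrow> nat \<Rightarrow> real \<Rightarrow> nat \<Rightarrow> nat \<Rightarrow> nat \<Rightarrow> real" where
  "lazy_pow K n lz 0 x y = (if x = y then 1 else 0)"
| "lazy_pow K n lz (Suc t) x y =
     ((\<Sum>k<n. lazy_pow K n lz t x k * pmf (K k) y) + lz * lazy_pow K n lz t x y) / (1 + lz)"

text \<open>The start value 1 bounds every entry of a stochastic matrix, so on its columns this is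
  the minimum over the flagged rows. The recursion follows the scan of the program.\<close>

primrec flagged_min :: "(nat \<Rightarrow> bool) \<Rightarrow> (nat \<Rightarrow> real) \<Rightarrow> nat \<Rightarrow> real" where
  "flagged_min F g 0 = 1"
| "flagged_min F g (Suc i) = (if F i \<and> g i < flagged_min F g i then g i else flagged_min F g i)"

definition scan_cell :: com where
  "scan_cell = Seq (SetScal ''m'' (OfNat (NConst 1)))
     (Seq (For ''i'' ''n''
       (Cond (Conj (RLess (OfNat (NConst 0)) (Entry ''V'' (NVar ''i'') (NConst 0)))
                   (RLess (Entry ''X'' (NVar ''i'') (NVar ''y'')) (Scal ''m'')))
          (SetScal ''m'' (Entry ''X'' (NVar ''i'') (NVar ''y''))) Skip))
       (SetScal ''w'' (RMinus (Scal ''m'') (Entry ''b'' (NVar ''y'') (NConst 0)))))"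

definition try_cell :: com where
  "try_cell = Seq (Flip ''f'' (RDivide (Scal ''w'') (Scal ''rem'')))
     (Cond (NLess (NConst 0) (NVar ''f'')) (NAssign ''out'' (NVar ''y''))
       (Seq (SetScal ''rem'' (RMinus (Scal ''rem'') (Scal ''w'')))
       (Seq (RAssign ''b'' (NVar ''y'') (NConst 0) (Scal ''m''))
         (NAssign ''y'' (NPlus (NVar ''y'') (NConst 1))))))"

definition cell :: com where
  "cell = Cond (NLess (NVar ''y'') (NVar ''n'')) (Seq scan_cell try_cell) (Seq mat_step (NAssign ''y'' (NConst 0)))"

definition not_found :: bexp where
  "not_found = Neg (NLess (NConst 0) (NVar ''f''))"

text \<open>Only the diagonal of \<open>X\<close> is written, since its other entries are 0
  beforehand. The sign of \<open>V\<close> encodes the flags: adding \<open>lz\<close> makes every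
  entry positive in lazy mode, and for \<open>lz = 0\<close> the positive entries are those of the
  start row.\<close>

definition residual_init :: com where
  "residual_init = Seq (LoadMatrix ''A'')
     (Seq (For ''i'' ''n'' (RAssign ''X'' (NVar ''i'') (NVar ''i'') (OfNat (NConst 1))))
     (Seq (For ''t'' ''t0'' mat_step)
     (Seq (For ''i'' ''n''
        (Seq (RAssign ''V'' (NVar ''i'') (NConst 0) (RPlus (Entry ''X'' (NVar ''start'') (NVar ''i'')) (Scal ''lz'')))
             (RAssign ''b'' (NVar ''i'') (NConst 0)
                (RTimes (RMinus (OfNat (NConst 1)) (Scal ''eps'')) (Entry ''X'' (NVar ''start'') (NVar ''i''))))))
     (Seq (SetScal ''rem'' (Scal ''eps''))
     (Seq (NAssign ''y'' (NConst 0)) (NAssign ''f'' (NConst 0)))))))"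

definition residual :: com where
  "residual = Seq residual_init (While not_found cell)"

definition simulate :: com where
  "simulate = Seq (NAssign ''out'' (NVar ''start'')) (For ''i'' ''t0'' (Step ''out'' (NVar ''out'')))"

text \<open>
  With \<open>\<mu>\<close> the law after \<open>t0\<close> steps, \<open>simulate\<close> realizes the part \<open>(1 - eps) \<mu>\<close> of the target and
  \<open>residual\<close> the part \<open>\<pi> - (1 - eps) \<mu>\<close> of mass \<open>eps\<close>.
\<close>

definition core :: com where
  "core = Seq (Flip ''f'' (Scal ''eps'')) (Cond (NLess (NConst 0) (NVar ''f'')) residual simulate)"

text \<open>Every round is charged a matrix product although only one in \<open>n + 1\<close>
  performs it. The resulting O(n^4) per level is still what the factor \<open>eps\<close> can
  absorb.\<close>

definition cell_cost :: "nat \<Rightarrow> nat" where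
  "cell_cost n = 4 * n + 12 + mat_step_cost n"

definition init_cost :: "chain_access \<Rightarrow> nat \<Rightarrow> nat \<Rightarrow> nat" where
  "init_cost M n t0 = matrix_time M + t0 * (mat_step_cost n + 2) + 7 * n + 12"

section \<open>The search loop on a fixed chain: levels, rounds and loop invariant\<close>

locale sampler_run =
  fixes M :: chain_access and n start t0 :: nat and lz eps :: real
  assumes n: "n = num_states M"
begin

abbreviation K where "K \<equiv> trans_kernel M"
abbreviation L where "L \<equiv> lazy_pow K n lz"

definition flag :: "nat \<Rightarrow> bool" where
  "flag x \<longleftrightarrow> 0 < L t0 start x + lz"

text \<open>
  The levels increase to the target distribution.  Raising the covered mass from one level to the
  next takes \<open>n + 1\<close> rounds of the search loop: one for each column, and one for the matrix product.
  In the lazy mode \<open>lz > 0\<close> every state is flagged; otherwise the flagged states are the support of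
  \<open>\<pi>\<close>, because rows of transient states need not converge at the rate given by the spectral gap.
\<close>

primrec level :: "nat \<Rightarrow> nat \<Rightarrow> real" where
  "level 0 z = (1 - eps) * L t0 start z"
| "level (Suc j) z = flagged_min flag (\<lambda>x. L (t0 + j) x z) n"

text \<open>This is the array \<open>b\<close> after \<open>k\<close> rounds, possibly in the middle
  of a level. Its increment \<open>weight\<close> and its complement \<open>remaining\<close> play
  the roles of \<open>w\<close> and \<open>rem\<close> in \<open>sequential_sampler\<close>.\<close>

definition covered :: "nat \<Rightarrow> nat \<Rightarrow> real" where
  "covered k z = (if z < k mod (n + 1) then level (Suc (k div (n + 1))) z else level (k div (n + 1)) z)"

definition remaining :: "nat \<Rightarrow> real" where
  "remaining k = 1 - (\<Sum>z<n. covered k z)"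

definition weight :: "nat \<Rightarrow> real" where
  "weight k = (if k mod (n + 1) < n
     then level (Suc (k div (n + 1))) (k mod (n + 1)) - level (k div (n + 1)) (k mod (n + 1)) else 0)"

lemma covered_Suc: "z < n \<Longrightarrow> covered (Suc k) z = covered k z + (if z = k mod (n + 1) then weight k else 0)"
  by (auto simp: covered_def weight_def mod_Suc div_Suc less_Suc_eq)

lemma remaining_Suc: "remaining (Suc k) = remaining k - weight k"
proof -
  have "(\<Sum>z<n. covered (Suc k) z) = (\<Sum>z<n. covered k z) + (\<Sum>z<n. if z = k mod (n + 1) then weight k else 0)"
    by (simp add: covered_Suc sum.distrib)
  also have "(\<Sum>z<n. if z = k mod (n + 1) then weight k else 0) = weight k"
    by (auto simp: sum.delta weight_def)
  finally show ?thesis by (simp add: remaining_def)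
qed

definition St :: "nat \<Rightarrow> assn" where
  "St k N R \<longleftrightarrow> N ''n'' = n \<and> N ''start'' = start \<and> N ''y'' = k mod (n + 1) \<and> N ''f'' = 0 \<and>
     (\<forall>i<n. \<forall>j<n. R ''A'' i j = pmf (K i) j) \<and>
     (\<forall>i<n. \<forall>j<n. R ''X'' i j = L (t0 + k div (n + 1)) i j) \<and>
     (\<forall>x<n. R ''V'' x 0 = L t0 start x + lz) \<and>
     (\<forall>z<n. R ''b'' z 0 = covered k z) \<and>
     R ''rem'' 0 0 = remaining k \<and> R ''lz'' 0 0 = lz"

lemma hoare_scan_cell:
  assumes y: "k mod (n + 1) < n"
  shows "hoare M (St k) scan_cell (4 * n + 4)
    (\<lambda>N R. St k N R \<and> R ''m'' 0 0 = level (Suc (k div (n + 1))) (k mod (n + 1)) \<and> R ''w'' 0 0 = weight k)"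
proof -
  let ?g = "\<lambda>x. L (t0 + k div (n + 1)) x (k mod (n + 1))"
  define I where "I = (\<lambda>i N R. St k N R \<and> N ''i'' = i \<and> R ''m'' 0 0 = flagged_min flag ?g i)"
  have c: "hoare M (I i) (Cond (Conj (RLess (OfNat (NConst 0)) (Entry ''V'' (NVar ''i'') (NConst 0)))
                   (RLess (Entry ''X'' (NVar ''i'') (NVar ''y'')) (Scal ''m'')))
          (SetScal ''m'' (Entry ''X'' (NVar ''i'') (NVar ''y''))) Skip) (1 + 1)
       (\<lambda>N R. N ''i'' = i \<and> I (Suc i) (N(''i'' := Suc i)) R)" if "i < n" for i
  proof (rule hoare_Cond)
    show "hoare M (\<lambda>N R. I i N R \<and> bval (Conj (RLess (OfNat (NConst 0)) (Entry ''V'' (NVar ''i'') (NConst 0)))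
                   (RLess (Entry ''X'' (NVar ''i'') (NVar ''y'')) (Scal ''m''))) (mem N R))
       (SetScal ''m'' (Entry ''X'' (NVar ''i'') (NVar ''y''))) 1 (\<lambda>N R. N ''i'' = i \<and> I (Suc i) (N(''i'' := Suc i)) R)"
      by (rule hoare_RAssign) (use that y in \<open>auto simp: I_def St_def flag_def\<close>)
    show "hoare M (\<lambda>N R. I i N R \<and> \<not> bval (Conj (RLess (OfNat (NConst 0)) (Entry ''V'' (NVar ''i'') (NConst 0)))
                   (RLess (Entry ''X'' (NVar ''i'') (NVar ''y'')) (Scal ''m''))) (mem N R))
       Skip 1 (\<lambda>N R. N ''i'' = i \<and> I (Suc i) (N(''i'' := Suc i)) R)"
      by (rule hoare_weaken[OF hoare_Skip]) (use that y in \<open>auto simp: I_def St_def flag_def\<close>)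
  qed
  have loop: "hoare M (\<lambda>N R. St k N R \<and> R ''m'' 0 0 = 1) (For ''i'' ''n''
       (Cond (Conj (RLess (OfNat (NConst 0)) (Entry ''V'' (NVar ''i'') (NConst 0)))
                   (RLess (Entry ''X'' (NVar ''i'') (NVar ''y'')) (Scal ''m'')))
          (SetScal ''m'' (Entry ''X'' (NVar ''i'') (NVar ''y''))) Skip)) (n * (1 + 1 + 2) + 2)
      (\<lambda>N R. St k N R \<and> R ''m'' 0 0 = level (Suc (k div (n + 1))) (k mod (n + 1)))"
    by (rule hoare_For[where Inv=I, OF _ _ c]) (auto simp: I_def St_def)
  have rest: "hoare M (\<lambda>N R. St k N R \<and> R ''m'' 0 0 = 1) (Seq (For ''i'' ''n''
       (Cond (Conj (RLess (OfNat (NConst 0)) (Entry ''V'' (NVar ''i'') (NConst 0)))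
                   (RLess (Entry ''X'' (NVar ''i'') (NVar ''y'')) (Scal ''m'')))
          (SetScal ''m'' (Entry ''X'' (NVar ''i'') (NVar ''y''))) Skip))
       (SetScal ''w'' (RMinus (Scal ''m'') (Entry ''b'' (NVar ''y'') (NConst 0))))) (n * (1 + 1 + 2) + 2 + 1)
      (\<lambda>N R. St k N R \<and> R ''m'' 0 0 = level (Suc (k div (n + 1))) (k mod (n + 1)) \<and> R ''w'' 0 0 = weight k)"
    by (rule hoare_Seq[OF loop], rule hoare_RAssign) (use y in \<open>auto simp: St_def weight_def covered_def\<close>)
  have "hoare M (St k) scan_cell (1 + (n * (1 + 1 + 2) + 2 + 1))
    (\<lambda>N R. St k N R \<and> R ''m'' 0 0 = level (Suc (k div (n + 1))) (k mod (n + 1)) \<and> R ''w'' 0 0 = weight k)"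
    unfolding scan_cell_def
    by (rule hoare_Seq[OF _ rest], rule hoare_RAssign) (auto simp: St_def)
  then show ?thesis by (rule hoare_weaken) auto
qed

text \<open>A product round assigns no mass: a fully raised level is merely reread as the base of
  the next one, so \<open>b\<close> and \<open>rem\<close> keep their contents.\<close>

lemma hoare_wrap:
  assumes y: "k mod (n + 1) = n"
  shows "hoare M (St k) (Seq mat_step (NAssign ''y'' (NConst 0))) (mat_step_cost n + 1) (St (Suc k))"
proof (rule hoare_ghost)
  fix N0 :: "vname \<Rightarrow> nat" and R0 :: "vname \<Rightarrow> nat \<Rightarrow> nat \<Rightarrow> real"
  assume St: "St k N0 R0"
  have k: "Suc k mod (n + 1) = 0" "Suc k div (n + 1) = Suc (k div (n + 1))"
    using y by (simp_all add: mod_Suc div_Suc)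
  have w: "weight k = 0" using y by (simp add: weight_def)
  have X: "((\<Sum>k<n. R0 ''X'' a k * R0 ''A'' k b) + R0 ''lz'' 0 0 * R0 ''X'' a b) / (1 + R0 ''lz'' 0 0)
      = L (t0 + Suc (k div (n + 1))) a b" if "a < n" "b < n" for a b
    using St that by (simp add: St_def)
  have N0: "N0 ''n'' = n" using St by (simp add: St_def)
  show "hoare M (\<lambda>N R. N = N0 \<and> R = R0) (Seq mat_step (NAssign ''y'' (NConst 0))) (mat_step_cost n + 1) (St (Suc k))"
  proof (rule hoare_Seq[OF hoare_mat_step[where n=n and ?N0.0=N0, OF N0]], rule hoare_NAssign)
    fix N R
    assume *: "(\<forall>z. z \<notin> {''i'', ''j'', ''k''} \<longrightarrow> N z = N0 z) \<and> (\<forall>z. z \<notin> {''X'', ''Y'', ''acc''} \<longrightarrow> R z = R0 z) \<and>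
       (\<forall>a<n. \<forall>b<n. R ''X'' a b = ((\<Sum>k<n. R0 ''X'' a k * R0 ''A'' k b) + R0 ''lz'' 0 0 * R0 ''X'' a b) / (1 + R0 ''lz'' 0 0))"
    from *[THEN conjunct2, THEN conjunct2, rule_format]
    have "R ''X'' a b = L (t0 + Suc (k div (n + 1))) a b" if "a < n" "b < n" for a b
      using X[OF that] that by (simp only:)
    with * St show "St (Suc k) (N(''y'' := nval (NConst 0) (mem N R))) R"
      unfolding St_def k remaining_Suc w by (simp add: covered_Suc w)
  qed
qed

lemma cell_exec:
  assumes St: "St k (nvars s) (arrays s)"
  shows "\<exists>s1 s2. exec M cell (tick 1 s) =
       map_spmf (\<lambda>c. if c then s1 else s2) (spmf_of_pmf (bernoulli_pmf (weight k / remaining k))) \<and>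
     nvars s1 ''f'' = 1 \<and> (weight k \<noteq> 0 \<longrightarrow> nvars s1 ''out'' = k mod (n + 1)) \<and> clock s1 \<le> clock s + cell_cost n \<and>
     St (Suc k) (nvars s2) (arrays s2) \<and> clock s2 \<le> clock s + cell_cost n"
proof (cases "k mod (n + 1) < n")
  case True
  have "St k (nvars (tick 1 (tick 1 s))) (arrays (tick 1 (tick 1 s)))" using St by simp
  from hoareD[OF hoare_scan_cell[OF True] this] obtain s' where
    s': "exec M scan_cell (tick 1 (tick 1 s)) = return_spmf s'" "St k (nvars s') (arrays s')"
      "arrays s' ''m'' 0 0 = level (Suc (k div (n + 1))) (k mod (n + 1))" "arrays s' ''w'' 0 0 = weight k"
      "clock s' \<le> clock s + 2 + (4 * n + 4)" by auto
  define s1 where "s1 = tick 1 (set_nvar ''out'' (k mod (n + 1)) (tick 1 (tick 1 (set_nvar ''f'' 1 s'))))"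
  define s2 where "s2 = tick 1 (set_nvar ''y'' (Suc (k mod (n + 1))) (tick 1
     (set_entry ''b'' (k mod (n + 1)) 0 (level (Suc (k div (n + 1))) (k mod (n + 1))) (tick 1
     (set_entry ''rem'' 0 0 (remaining k - weight k) (tick 1 (tick 1 (set_nvar ''f'' 0 s'))))))))"
  have y: "nvars s' ''y'' = k mod (n + 1)" "arrays s' ''rem'' 0 0 = remaining k" "nvars s ''y'' = k mod (n + 1)" "nvars s ''n'' = n"
    using s'(2) St by (auto simp: St_def)
  have "exec M cell (tick 1 s) = exec M try_cell s'"
    using True s'(1) y by (simp add: cell_def)
  also have "\<dots> = map_spmf (\<lambda>c. if c then s1 else s2) (spmf_of_pmf (bernoulli_pmf (weight k / remaining k)))"
    unfolding try_cell_def s1_def s2_def map_spmf_conv_bind_spmf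
    by (auto simp: s'(3,4) y map_spmf_conv_bind_spmf simp del: map_spmf_of_pmf bind_spmf_of_pmf intro!: bind_spmf_cong)
  finally have "exec M cell (tick 1 s) = map_spmf (\<lambda>c. if c then s1 else s2) (spmf_of_pmf (bernoulli_pmf (weight k / remaining k)))" .
  moreover have "St (Suc k) (nvars s2) (arrays s2)"
  proof -
    have "Suc k mod (n + 1) = Suc (k mod (n + 1))" "Suc k div (n + 1) = k div (n + 1)"
      using True by (auto simp: mod_Suc div_Suc)
    moreover have "covered k (k mod (n + 1)) + weight k = level (Suc (k div (n + 1))) (k mod (n + 1))"
      using True by (simp add: covered_def weight_def)
    ultimately show ?thesis
      using s'(2) by (auto simp: St_def s2_def remaining_Suc covered_Suc)
  qed
  ultimately show ?thesis
    using s'(5) by (intro exI[of _ s1] exI[of _ s2]) (auto simp: s1_def s2_def cell_cost_def)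
next
  case False
  then have y: "k mod (n + 1) = n" by (metis Suc_eq_plus1 less_Suc_eq mod_less_divisor zero_less_Suc)
  have "St k (nvars (tick 1 (tick 1 s))) (arrays (tick 1 (tick 1 s)))" using St by simp
  from hoareD[OF hoare_wrap[OF y] this] obtain s2 where
    s2: "exec M (Seq mat_step (NAssign ''y'' (NConst 0))) (tick 1 (tick 1 s)) = return_spmf s2"
      "St (Suc k) (nvars s2) (arrays s2)" "clock s2 \<le> clock s + 2 + (mat_step_cost n + 1)" by auto
  have w: "weight k = 0" using False by (simp add: weight_def)
  have "exec M cell (tick 1 s) = return_spmf s2"
    using St y s2(1) by (simp add: cell_def St_def)
  \<comment> \<open>The first witness is the outcome of probability 0; any store with
    \<open>f = 1\<close> and a small clock serves.\<close>
  then show ?thesis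
    using s2 by (intro exI[of _ "set_nvar ''f'' 1 s"] exI[of _ s2]) (auto simp: w bernoulli_pmf_0 cell_cost_def)
qed

lemma hoare_residual_init:
  assumes start: "start < n" and eps: "remaining 0 = eps"
  shows "hoare M (\<lambda>N R. N ''n'' = n \<and> N ''start'' = start \<and> N ''t0'' = t0 \<and> R ''lz'' 0 0 = lz \<and> R ''eps'' 0 0 = eps \<and>
      (\<forall>i j. R ''X'' i j = 0)) residual_init (init_cost M n t0) (St 0)"
proof -
  define P where "P = (\<lambda>(N :: vname \<Rightarrow> nat) (R :: vname \<Rightarrow> nat \<Rightarrow> nat \<Rightarrow> real).
     N ''n'' = n \<and> N ''start'' = start \<and> N ''t0'' = t0 \<and> R ''lz'' 0 0 = lz \<and> R ''eps'' 0 0 = eps)"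
  define PA where "PA = (\<lambda>N R. P N R \<and> (\<forall>i<n. \<forall>j<n. R ''A'' i j = pmf (K i) j))"
  define Q where "Q = (\<lambda>N R. PA N R \<and> (\<forall>i<n. \<forall>j<n. R ''X'' i j = L t0 i j))"
  define I1 where "I1 = (\<lambda>i N R. PA N R \<and> N ''i'' = i \<and> (\<forall>a b. R ''X'' a b = (if a = b \<and> a < i then 1 else 0)))"
  define I2 where "I2 = (\<lambda>t N R. PA N R \<and> N ''t'' = t \<and> (\<forall>a<n. \<forall>b<n. R ''X'' a b = L t a b))"
  define I3 where "I3 = (\<lambda>i N R. Q N R \<and> N ''i'' = i \<and> (\<forall>x<i. R ''V'' x 0 = L t0 start x + lz) \<and>
     (\<forall>x<i. R ''b'' x 0 = (1 - eps) * L t0 start x))"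
  have 1: "hoare M (\<lambda>N R. P N R \<and> (\<forall>i j. R ''X'' i j = 0)) (LoadMatrix ''A'') (1 + matrix_time M)
     (\<lambda>N R. PA N R \<and> (\<forall>i j. R ''X'' i j = 0))"
    by (rule hoare_LoadMatrix) (auto simp: PA_def P_def n)
  have 2: "hoare M (\<lambda>N R. PA N R \<and> (\<forall>i j. R ''X'' i j = 0)) (For ''i'' ''n'' (RAssign ''X'' (NVar ''i'') (NVar ''i'') (OfNat (NConst 1))))
     (n * (1 + 2) + 2) (\<lambda>N R. PA N R \<and> (\<forall>a<n. \<forall>b<n. R ''X'' a b = L 0 a b))"
  proof (rule hoare_For[where Inv=I1])
    show "hoare M (I1 i) (RAssign ''X'' (NVar ''i'') (NVar ''i'') (OfNat (NConst 1))) 1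
       (\<lambda>N R. N ''i'' = i \<and> I1 (Suc i) (N(''i'' := Suc i)) R)" if "i < n" for i
      by (rule hoare_RAssign) (auto simp: I1_def PA_def P_def less_Suc_eq)
  qed (auto simp: I1_def PA_def P_def)
  have step: "hoare M (I2 t) mat_step (mat_step_cost n) (\<lambda>N R. N ''t'' = t \<and> I2 (Suc t) (N(''t'' := Suc t)) R)" for t
  proof (rule hoare_ghost)
    fix N0 :: "vname \<Rightarrow> nat" and R0 :: "vname \<Rightarrow> nat \<Rightarrow> nat \<Rightarrow> real"
    assume I2: "I2 t N0 R0"
    have X: "((\<Sum>k<n. R0 ''X'' a k * R0 ''A'' k b) + R0 ''lz'' 0 0 * R0 ''X'' a b) / (1 + R0 ''lz'' 0 0)
        = L (Suc t) a b" if "a < n" "b < n" for a b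
      using I2 that by (simp add: I2_def PA_def P_def)
    have N0: "N0 ''n'' = n" using I2 by (simp add: I2_def PA_def P_def)
    show "hoare M (\<lambda>N R. N = N0 \<and> R = R0) mat_step (mat_step_cost n) (\<lambda>N R. N ''t'' = t \<and> I2 (Suc t) (N(''t'' := Suc t)) R)"
    proof (rule hoare_weaken[OF hoare_mat_step[where n=n and ?N0.0=N0, OF N0]])
      fix N R
      assume *: "(\<forall>z. z \<notin> {''i'', ''j'', ''k''} \<longrightarrow> N z = N0 z) \<and> (\<forall>z. z \<notin> {''X'', ''Y'', ''acc''} \<longrightarrow> R z = R0 z) \<and>
         (\<forall>a<n. \<forall>b<n. R ''X'' a b = ((\<Sum>k<n. R0 ''X'' a k * R0 ''A'' k b) + R0 ''lz'' 0 0 * R0 ''X'' a b) / (1 + R0 ''lz'' 0 0))"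
      from *[THEN conjunct2, THEN conjunct2, rule_format]
      have "R ''X'' a b = L (Suc t) a b" if "a < n" "b < n" for a b
        using X[OF that] that by (simp only:)
      with * I2 show "N ''t'' = t \<and> I2 (Suc t) (N(''t'' := Suc t)) R"
        unfolding I2_def PA_def P_def by simp
    qed auto
  qed
  have 3: "hoare M (\<lambda>N R. PA N R \<and> (\<forall>a<n. \<forall>b<n. R ''X'' a b = L 0 a b)) (For ''t'' ''t0'' mat_step)
      (t0 * (mat_step_cost n + 2) + 2) Q"
    by (rule hoare_For[where Inv=I2, OF _ _ step]) (auto simp: I2_def Q_def PA_def P_def)
  have body: "hoare M (I3 i)
        (Seq (RAssign ''V'' (NVar ''i'') (NConst 0) (RPlus (Entry ''X'' (NVar ''start'') (NVar ''i'')) (Scal ''lz'')))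
             (RAssign ''b'' (NVar ''i'') (NConst 0)
                (RTimes (RMinus (OfNat (NConst 1)) (Scal ''eps'')) (Entry ''X'' (NVar ''start'') (NVar ''i'')))))
       (1 + 1) (\<lambda>N R. N ''i'' = i \<and> I3 (Suc i) (N(''i'' := Suc i)) R)" if "i < n" for i
    by (rule hoare_Seq[where Q="\<lambda>N R. I3 i N R \<and> R ''V'' i 0 = L t0 start i + lz"]; rule hoare_RAssign)
       (use that start in \<open>auto simp: I3_def Q_def PA_def P_def less_Suc_eq\<close>)
  have 4: "hoare M Q (For ''i'' ''n''
        (Seq (RAssign ''V'' (NVar ''i'') (NConst 0) (RPlus (Entry ''X'' (NVar ''start'') (NVar ''i'')) (Scal ''lz'')))
             (RAssign ''b'' (NVar ''i'') (NConst 0)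
                (RTimes (RMinus (OfNat (NConst 1)) (Scal ''eps'')) (Entry ''X'' (NVar ''start'') (NVar ''i''))))))
       (n * (1 + 1 + 2) + 2) (I3 n)"
    by (rule hoare_For[where Inv=I3, OF _ _ body]) (auto simp: I3_def Q_def PA_def P_def)
  have 5: "hoare M (I3 n) (SetScal ''rem'' (Scal ''eps'')) 1 (\<lambda>N R. I3 n N R \<and> R ''rem'' 0 0 = eps)"
    by (rule hoare_RAssign) (auto simp: I3_def Q_def PA_def P_def)
  have 6: "hoare M (\<lambda>N R. I3 n N R \<and> R ''rem'' 0 0 = eps) (NAssign ''y'' (NConst 0)) 1
      (\<lambda>N R. I3 n N R \<and> R ''rem'' 0 0 = eps \<and> N ''y'' = 0)"
    by (rule hoare_NAssign) (auto simp: I3_def Q_def PA_def P_def)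
  have 7: "hoare M (\<lambda>N R. I3 n N R \<and> R ''rem'' 0 0 = eps \<and> N ''y'' = 0) (NAssign ''f'' (NConst 0)) 1 (St 0)"
    by (rule hoare_NAssign) (auto simp: I3_def Q_def PA_def P_def St_def eps covered_def)
  show ?thesis
    unfolding residual_init_def
    by (rule hoare_weaken[OF hoare_Seq[OF 1 hoare_Seq[OF 2 hoare_Seq[OF 3 hoare_Seq[OF 4 hoare_Seq[OF 5 hoare_Seq[OF 6 7]]]]]]])
       (auto simp: P_def init_cost_def)
qed

end

section \<open>Law and running time of the simulation\<close>

lemma step_dist_Suc_front: "step_dist K (Suc t) x = bind_pmf (K x) (step_dist K t)"
proof (induction t)
  case 0
  then show ?case by (simp add: bind_return_pmf bind_return_pmf')
next
  case (Suc t)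
  have "step_dist K (Suc (Suc t)) x = bind_pmf (step_dist K (Suc t) x) K" by simp
  also have "\<dots> = bind_pmf (K x) (\<lambda>y. bind_pmf (step_dist K t y) K)"
    unfolding Suc by (rule bind_assoc_pmf)
  finally show ?case by simp
qed

text \<open>The time is deterministic although the result is not, so the final store is an explicit
  function of the sampled state. An iteration costs \<open>step_time M + 3\<close>: guard,
  instruction and increment. Unrolling peels the first step off, whereas \<open>step_dist\<close>
  appends the last one, hence \<open>step_dist_Suc_front\<close>.\<close>

lemma exec_simulate_loop:
  fixes s :: store
  assumes "nvars s ''i'' + m = nvars s ''t0''"
  shows "loop (bval (NLess (NVar ''i'') (NVar ''t0'')))
      (\<lambda>s. exec M (Seq (Step ''out'' (NVar ''out'')) (NAssign ''i'' (NPlus (NVar ''i'') (NConst 1)))) (tick 1 s)) s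
    = map_spmf (\<lambda>z. tick (m * (step_time M + 3)) (set_nvar ''i'' (nvars s ''t0'') (set_nvar ''out'' z s)))
       (spmf_of_pmf (step_dist (trans_kernel M) m (nvars s ''out'')))"
  using assms
proof (induction m arbitrary: s)
  case 0
  then have "tick 0 (set_nvar ''i'' (nvars s ''t0'') (set_nvar ''out'' (nvars s ''out'') s)) = s"
    by (simp add: tick_def set_nvar_def fun_upd_idem)
  with 0 show ?case by (subst loop.simps) simp
next
  case (Suc m)
  let ?s = "\<lambda>y. tick 1 (set_nvar ''i'' (Suc (nvars s ''i'')) (tick (1 + step_time M) (set_nvar ''out'' y (tick 1 s))))"
  have eq: "tick (m * (step_time M + 3)) (set_nvar ''i'' (nvars (?s y) ''t0'') (set_nvar ''out'' z (?s y)))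
     = tick (Suc m * (step_time M + 3)) (set_nvar ''i'' (nvars s ''t0'') (set_nvar ''out'' z s))" for y z
    by (simp add: tick_def set_nvar_def fun_eq_iff)
  have "loop (bval (NLess (NVar ''i'') (NVar ''t0'')))
      (\<lambda>s. exec M (Seq (Step ''out'' (NVar ''out'')) (NAssign ''i'' (NPlus (NVar ''i'') (NConst 1)))) (tick 1 s)) s
    = bind_spmf (spmf_of_pmf (trans_kernel M (nvars s ''out''))) (\<lambda>y. loop (bval (NLess (NVar ''i'') (NVar ''t0'')))
      (\<lambda>s. exec M (Seq (Step ''out'' (NVar ''out'')) (NAssign ''i'' (NPlus (NVar ''i'') (NConst 1)))) (tick 1 s)) (?s y))"
    using Suc.prems by (subst loop.simps) (simp add: map_spmf_conv_bind_spmf del: map_spmf_of_pmf bind_spmf_of_pmf)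
  also have "\<dots> = bind_spmf (spmf_of_pmf (trans_kernel M (nvars s ''out'')))
     (\<lambda>y. map_spmf (\<lambda>z. tick (Suc m * (step_time M + 3)) (set_nvar ''i'' (nvars s ''t0'') (set_nvar ''out'' z s)))
       (spmf_of_pmf (step_dist (trans_kernel M) m y)))"
  proof (intro bind_spmf_cong refl)
    fix y
    have prem: "nvars (?s y) ''i'' + m = nvars (?s y) ''t0''" using Suc.prems by simp
    have out: "nvars (?s y) ''out'' = y" by simp
    show "loop (bval (NLess (NVar ''i'') (NVar ''t0'')))
      (\<lambda>s. exec M (Seq (Step ''out'' (NVar ''out'')) (NAssign ''i'' (NPlus (NVar ''i'') (NConst 1)))) (tick 1 s)) (?s y)
      = map_spmf (\<lambda>z. tick (Suc m * (step_time M + 3)) (set_nvar ''i'' (nvars s ''t0'') (set_nvar ''out'' z s)))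
       (spmf_of_pmf (step_dist (trans_kernel M) m y))"
      using Suc.IH[OF prem, unfolded eq] unfolding out .
  qed
  also have "\<dots> = map_spmf (\<lambda>z. tick (Suc m * (step_time M + 3)) (set_nvar ''i'' (nvars s ''t0'') (set_nvar ''out'' z s)))
       (spmf_of_pmf (step_dist (trans_kernel M) (Suc m) (nvars s ''out'')))"
    by (simp only: step_dist_Suc_front map_spmf_of_pmf bind_spmf_of_pmf map_bind_pmf flip: spmf_of_pmf_bind)
  finally show ?case .
qed

lemma exec_simulate:
  "exec M simulate s = map_spmf (\<lambda>z. tick (nvars s ''t0'' * (step_time M + 3) + 3)
        (set_nvar ''i'' (nvars s ''t0'') (set_nvar ''out'' z s)))
     (spmf_of_pmf (step_dist (trans_kernel M) (nvars s ''t0'') (nvars s ''start'')))"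
proof -
  let ?s = "tick 1 (set_nvar ''i'' 0 (tick 1 (set_nvar ''out'' (nvars s ''start'') s)))"
  have tick: "tick 1 (tick (nvars s ''t0'' * (step_time M + 3)) (set_nvar ''i'' (nvars s ''t0'') (set_nvar ''out'' z ?s)))
    = tick (nvars s ''t0'' * (step_time M + 3) + 3) (set_nvar ''i'' (nvars s ''t0'') (set_nvar ''out'' z s))" for z
    by (simp add: tick_def set_nvar_def fun_eq_iff)
  have vars: "nvars ?s ''i'' + nvars s ''t0'' = nvars ?s ''t0''" "nvars ?s ''t0'' = nvars s ''t0''" "nvars ?s ''out'' = nvars s ''start''"
    by simp_all
  have "exec M simulate s = map_spmf (tick 1) (loop (bval (NLess (NVar ''i'') (NVar ''t0'')))
      (\<lambda>s. exec M (Seq (Step ''out'' (NVar ''out'')) (NAssign ''i'' (NPlus (NVar ''i'') (NConst 1)))) (tick 1 s)) ?s)"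
    by (simp add: simulate_def For_def)
  then show ?thesis
    unfolding exec_simulate_loop[OF vars(1)] vars(2,3) spmf.map_comp o_def tick .
qed

section \<open>Correctness and running time of the core program\<close>

lemma flagged_min_le: "flagged_min F g m \<le> 1" "x < m \<Longrightarrow> F x \<Longrightarrow> flagged_min F g m \<le> g x"
proof -
  show "flagged_min F g m \<le> 1" by (induction m) auto
  show "x < m \<Longrightarrow> F x \<Longrightarrow> flagged_min F g m \<le> g x"
    by (induction m) (auto simp: less_Suc_eq)
qed

lemma flagged_min_ge:
  assumes "c \<le> 1" "\<And>x. x < m \<Longrightarrow> F x \<Longrightarrow> c \<le> g x"
  shows "c \<le> flagged_min F g m"
  using assms by (induction m) auto

section \<open>Powers of the lazy transition matrix\<close>

locale chain_kernel =
  fixes n :: nat and K :: "nat \<Rightarrow> nat pmf" and lz :: real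
  assumes closed: "\<And>x. x < n \<Longrightarrow> set_pmf (K x) \<subseteq> {..<n}" and lz: "0 \<le> lz"
begin

abbreviation L where "L \<equiv> lazy_pow K n lz"

lemma sum_row: "x < n \<Longrightarrow> (\<Sum>y<n. pmf (K x) y) = 1"
  using closed by (intro sum_pmf_eq_1) auto

lemma L_nonneg: "0 \<le> L t x y"
  using lz by (induction t arbitrary: y) (auto intro!: divide_nonneg_nonneg add_nonneg_nonneg sum_nonneg)

lemma L_sum: "x < n \<Longrightarrow> (\<Sum>y<n. L t x y) = 1"
proof (induction t)
  case 0
  then show ?case by simp
next
  case (Suc t)
  have "(\<Sum>y<n. \<Sum>k<n. L t x k * pmf (K k) y) = (\<Sum>k<n. L t x k * (\<Sum>y<n. pmf (K k) y))"
    by (subst sum.swap) (simp add: sum_distrib_left)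
  also have "\<dots> = 1" using Suc by (simp add: sum_row)
  finally show ?case
    using Suc lz by (simp add: sum.distrib flip: sum_divide_distrib sum_distrib_left)
qed

text \<open>The recursion of \<open>lazy_pow\<close> multiplies by the kernel on the right, like the
  program. Monotonicity of the column minima needs the left product, where an entry is an average
  over the previous column; the two agree because powers of one matrix commute with it.\<close>

lemma L_front: "x < n \<Longrightarrow> y < n \<Longrightarrow> L (Suc t) x y = ((\<Sum>k<n. pmf (K x) k * L t k y) + lz * L t x y) / (1 + lz)"
proof (induction t arbitrary: y)
  case 0
  have "(\<Sum>k<n. (if x = k then 1 else 0) * pmf (K k) y) = pmf (K x) y"
    using 0 by (simp add: if_distrib[of "\<lambda>c. c * _"] sum.delta cong: if_cong)
  moreover have "(\<Sum>k<n. pmf (K x) k * (if k = y then 1 else 0)) = pmf (K x) y"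
    using 0 by (simp add: if_distrib[of "\<lambda>c. _ * c"] sum.delta' cong: if_cong)
  ultimately show ?case by simp
next
  case (Suc t)
  let ?A = "\<Sum>k<n. \<Sum>j<n. pmf (K x) j * L t j k * pmf (K k) y"
  let ?B = "\<Sum>k<n. L t x k * pmf (K k) y"
  let ?C = "\<Sum>j<n. pmf (K x) j * L t j y"
  have A': "(\<Sum>j<n. pmf (K x) j * (\<Sum>k<n. L t j k * pmf (K k) y)) = ?A"
    by (subst sum.swap) (simp add: sum_distrib_left mult.assoc)
  have "(\<Sum>k<n. L (Suc t) x k * pmf (K k) y) =
     (\<Sum>k<n. ((\<Sum>j<n. pmf (K x) j * L t j k) + lz * L t x k) / (1 + lz) * pmf (K k) y)"
    using Suc.IH[OF Suc.prems(1)] by (intro sum.cong refl) (simp only: lessThan_iff)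
  also have "\<dots> = (?A + lz * ?B) / (1 + lz)"
    by (simp add: sum_divide_distrib sum_distrib_left sum_distrib_right sum.distrib add_divide_distrib distrib_right mult.assoc)
  finally have l: "(\<Sum>k<n. L (Suc t) x k * pmf (K k) y) = (?A + lz * ?B) / (1 + lz)" .
  have "(\<Sum>k<n. pmf (K x) k * L (Suc t) k y) = (\<Sum>k<n. pmf (K x) k * (((\<Sum>j<n. L t k j * pmf (K j) y) + lz * L t k y) / (1 + lz)))"
    by simp
  also have "\<dots> = ((\<Sum>k<n. pmf (K x) k * (\<Sum>j<n. L t k j * pmf (K j) y)) + lz * ?C) / (1 + lz)"
    by (simp add: sum_divide_distrib sum_distrib_left sum.distrib add_divide_distrib distrib_left mult.left_commute)
  finally have r: "(\<Sum>k<n. pmf (K x) k * L (Suc t) k y) = (?A + lz * ?C) / (1 + lz)"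
    unfolding A' .
  have "L (Suc (Suc t)) x y = ((?A + lz * ?B) / (1 + lz) + lz * L (Suc t) x y) / (1 + lz)"
    using l by simp
  also have "L (Suc t) x y = (?C + lz * L t x y) / (1 + lz)" using Suc by blast
  finally have 1: "L (Suc (Suc t)) x y = ((?A + lz * ?B) / (1 + lz) + lz * ((?C + lz * L t x y) / (1 + lz))) / (1 + lz)" .
  have "((\<Sum>k<n. pmf (K x) k * L (Suc t) k y) + lz * L (Suc t) x y) / (1 + lz)
     = ((?A + lz * ?C) / (1 + lz) + lz * ((?B + lz * L t x y) / (1 + lz))) / (1 + lz)"
    unfolding r by simp
  with 1 show ?case by (simp add: add_divide_distrib[symmetric] algebra_simps)
qed

lemma set_step_dist: "x < n \<Longrightarrow> set_pmf (step_dist K t x) \<subseteq> {..<n}"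
  using closed by (induction t) (auto simp: set_bind_pmf)

lemma L_eq_step_dist: "lz = 0 \<Longrightarrow> x < n \<Longrightarrow> L t x y = pmf (step_dist K t x) y"
proof (induction t arbitrary: y)
  case 0
  then show ?case by (simp add: pmf_return)
next
  case (Suc t)
  have "pmf (step_dist K (Suc t) x) y = (\<Sum>k<n. pmf (step_dist K t x) k * pmf (K k) y)"
    using set_step_dist[OF Suc.prems(2), of t]
    by (simp add: pmf_bind, subst integral_measure_pmf[where A="{..<n}"]) (auto simp: set_pmf_iff)
  then show ?case using Suc by simp
qed

end

text \<open>\<open>mono\<close> and \<open>sum_le\<close> make all weights and remaining masses
  nonnegative, and \<open>mono\<close> at \<open>j = 0\<close> is the domination of
  \<open>(1 - eps) \<mu>\<close>. For \<open>eps = 1\<close> the simulation has probability 0, so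
  \<open>sim\<close> constrains its law only for \<open>eps \<noteq> 1\<close>.\<close>

locale good_sampler_run = sampler_run +
  assumes start: "start < n" and eps: "0 < eps" "eps \<le> 1"
    and sum_start: "(\<Sum>z<n. L t0 start z) = 1"
    and mono: "\<And>j z. z < n \<Longrightarrow> level j z \<le> level (Suc j) z"
    and sum_le: "\<And>j. (\<Sum>z<n. level j z) \<le> 1"
    and sim: "\<And>z. z < n \<Longrightarrow> eps \<noteq> 1 \<Longrightarrow> L t0 start z = pmf (step_dist K t0 start) z"
begin

lemma covered_0: "covered 0 z = (1 - eps) * L t0 start z"
  by (simp add: covered_def)

lemma remaining_0: "remaining 0 = eps"
  by (simp add: remaining_def covered_0 sum_start flip: sum_distrib_left)

lemma covered_bounds: "z < n \<Longrightarrow> level (k div (n + 1)) z \<le> covered k z" "z < n \<Longrightarrow> covered k z \<le> level (Suc (k div (n + 1))) z"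
  using mono[of z "k div (n + 1)"] by (auto simp: covered_def)

lemma remaining_nonneg: "0 \<le> remaining k"
proof -
  have "(\<Sum>z<n. covered k z) \<le> (\<Sum>z<n. level (Suc (k div (n + 1))) z)"
    by (intro sum_mono covered_bounds) auto
  also have "\<dots> \<le> 1" by (rule sum_le)
  finally show ?thesis by (simp add: remaining_def)
qed

lemma remaining_le: "remaining k \<le> 1 - (\<Sum>z<n. level (k div (n + 1)) z)"
  unfolding remaining_def by (intro diff_left_mono sum_mono covered_bounds) auto

lemma weight_nonneg: "0 \<le> weight k"
  using mono[of "k mod (n + 1)" "k div (n + 1)"] by (auto simp: weight_def)

text \<open>In a product round the label is \<open>n\<close>, which is no state; its weight is 0, so
  the label carries no output mass.\<close>

sublocale sequential_sampler "bval not_found" "\<lambda>s. exec M cell (tick 1 s)" "\<lambda>k s. St k (nvars s) (arrays s)"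
  weight remaining "\<lambda>s. nvars s ''out''" clock "\<lambda>k. k mod (n + 1)" "cell_cost n"
proof
  fix k and s :: store
  assume St: "St k (nvars s) (arrays s)"
  then have "bval not_found s" by (simp add: not_found_def St_def)
  moreover have "\<not> bval not_found s1" if "nvars s1 ''f'' = 1" for s1
    using that by (simp add: not_found_def)
  ultimately show "bval not_found s \<and> (\<exists>s1 s2. exec M cell (tick 1 s) =
      map_spmf (\<lambda>c. if c then s1 else s2) (spmf_of_pmf (bernoulli_pmf (weight k / remaining k))) \<and>
      \<not> bval not_found s1 \<and> (weight k \<noteq> 0 \<longrightarrow> nvars s1 ''out'' = k mod (n + 1)) \<and> clock s1 \<le> clock s + cell_cost n \<and>
      St (Suc k) (nvars s2) (arrays s2) \<and> clock s2 \<le> clock s + cell_cost n)"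
    using cell_exec[OF St] by blast
qed (simp_all add: weight_nonneg remaining_nonneg remaining_Suc cell_cost_def)

lemma sum_lab: "y < n \<Longrightarrow> (\<Sum>i<m. if i mod (n + 1) = y then weight i else 0) = covered m y - covered 0 y"
  by (induction m) (auto simp: covered_Suc)

definition ready :: "store \<Rightarrow> bool" where
  "ready s \<longleftrightarrow> nvars s ''n'' = n \<and> nvars s ''start'' = start \<and> nvars s ''t0'' = t0 \<and> arrays s ''lz'' 0 0 = lz \<and>
     arrays s ''eps'' 0 0 = eps \<and> (\<forall>i j. arrays s ''X'' i j = 0)"

lemma exec_residual:
  assumes "ready s"
  obtains s' where "St 0 (nvars s') (arrays s')" "clock s' \<le> clock s + init_cost M n t0"
    "exec M residual s = map_spmf (tick 1) (loop (bval not_found) (\<lambda>s. exec M cell (tick 1 s)) s')"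
proof -
  obtain s' where "exec M residual_init s = return_spmf s'" "St 0 (nvars s') (arrays s')" "clock s' \<le> clock s + init_cost M n t0"
    using hoareD[OF hoare_residual_init[OF start remaining_0], of s] assms by (auto simp: ready_def)
  then show ?thesis using that by (simp add: residual_def)
qed

lemma residual_ge:
  assumes "ready s" "y < n"
  shows "ennreal ((level J y - level 0 y) / eps) \<le> (\<integral>\<^sup>+ x. indicator {y} (nvars x ''out'') \<partial>measure_spmf (exec M residual s))"
proof -
  obtain s' where s': "St 0 (nvars s') (arrays s')"
    "exec M residual s = map_spmf (tick 1) (loop (bval not_found) (\<lambda>s. exec M cell (tick 1 s)) s')"
    using exec_residual[OF assms(1)] by blast
  \<comment> \<open>After \<open>J * (n + 1)\<close> rounds exactly \<open>J\<close> levels are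
    complete, and the weights given to column \<open>y\<close> telescope to the difference of
    levels.\<close>
  have "J * (n + 1) mod (n + 1) = 0" "J * (n + 1) div (n + 1) = J"
    by (rule mod_mult_self2_is_0) (rule nonzero_mult_div_cancel_right, simp)
  then have "covered (J * (n + 1)) y = level J y" by (simp only: covered_def not_less0 if_False)
  then have "level J y - level 0 y = (\<Sum>i<J * (n + 1). if i mod (n + 1) = y then weight i else 0)"
    by (simp only: sum_lab[OF assms(2)] covered_0 level.simps)
  then show ?thesis
    using loop_ge[of 0 s' y "J * (n + 1)"] s' by (simp add: remaining_0 o_def cong: if_cong)
qed

lemma residual_time:
  assumes "ready s"
  shows "(\<integral>\<^sup>+ x. of_nat (clock x) \<partial>measure_spmf (exec M residual s)) \<le>
    of_nat (clock s + init_cost M n t0 + 1) + of_nat (cell_cost n) * (\<Sum>k. ennreal (remaining k)) / ennreal eps"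
proof -
  obtain s' where s': "St 0 (nvars s') (arrays s')" "clock s' \<le> clock s + init_cost M n t0"
    "exec M residual s = map_spmf (tick 1) (loop (bval not_found) (\<lambda>s. exec M cell (tick 1 s)) s')"
    using exec_residual[OF assms] by blast
  let ?l = "loop (bval not_found) (\<lambda>s. exec M cell (tick 1 s)) s'"
  have "(\<integral>\<^sup>+ x. of_nat (clock x) \<partial>measure_spmf (exec M residual s))
     = (\<integral>\<^sup>+ x. of_nat (clock x) + 1 \<partial>measure_spmf ?l)"
    by (simp add: s'(3) o_def add.commute)
  also have "\<dots> = (\<integral>\<^sup>+ x. of_nat (clock x) \<partial>measure_spmf ?l) + (\<integral>\<^sup>+ x. 1 \<partial>measure_spmf ?l)"
    by (rule nn_integral_add) auto
  also have "(\<integral>\<^sup>+ x. 1 \<partial>measure_spmf ?l) \<le> 1"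
    by (simp add: measure_spmf.emeasure_space_le_1)
  also have "(\<integral>\<^sup>+ x. of_nat (clock x) \<partial>measure_spmf ?l) \<le> of_nat (clock s') +
      of_nat (cell_cost n) * (\<Sum>k. ennreal (remaining k)) / ennreal eps"
    using loop_clock_le[OF s'(1)] eps by (simp add: remaining_0)
  also have "of_nat (clock s') \<le> (of_nat (clock s + init_cost M n t0) :: ennreal)"
    using s'(2) by (simp only: of_nat_le_iff)
  finally show ?thesis by (simp add: add_ac)
qed

lemma nn_integral_core:
  fixes F :: "store \<Rightarrow> ennreal"
  assumes "ready s"
  shows "(\<integral>\<^sup>+ x. F x \<partial>measure_spmf (exec M core s)) =
    (\<integral>\<^sup>+ x. F x \<partial>measure_spmf (exec M residual (tick 2 (set_nvar ''f'' 1 s)))) * ennreal eps +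
    (\<integral>\<^sup>+ x. F x \<partial>measure_spmf (exec M simulate (tick 2 (set_nvar ''f'' 0 s)))) * ennreal (1 - eps)"
proof -
  have t: "tick 1 (tick 1 x) = tick 2 x" for x by (simp add: tick_def)
  have "exec M core s = bind_spmf (spmf_of_pmf (bernoulli_pmf eps)) (\<lambda>c. if c
      then exec M residual (tick 2 (set_nvar ''f'' 1 s)) else exec M simulate (tick 2 (set_nvar ''f'' 0 s)))"
    using assms unfolding core_def
    by (auto simp: ready_def map_spmf_conv_bind_spmf t[unfolded One_nat_def] simp del: map_spmf_of_pmf bind_spmf_of_pmf intro!: bind_spmf_cong)
  then show ?thesis
    using eps by (simp only: nn_integral_bind_spmf) simp
qed

lemma ready_upd: "ready s \<Longrightarrow> ready (tick k (set_nvar ''f'' c s))"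
  by (simp add: ready_def)

text \<open>After weighting by the branch probabilities, the residual contributes at least
  \<open>level J y - level 0 y\<close> and the simulation exactly \<open>level 0 y\<close>.\<close>

lemma core_ge:
  assumes "ready s" "y < n"
  shows "ennreal (level J y) \<le> (\<integral>\<^sup>+ x. indicator {y} (nvars x ''out'') \<partial>measure_spmf (exec M core s))"
proof -
  have lev: "level 0 y \<le> level J y"
    using assms(2) mono by (induction J) (auto intro: order_trans simp del: level.simps)
  have L_eq: "level 0 y = (1 - eps) * pmf (step_dist K t0 start) y"
    unfolding level.simps using sim[OF assms(2)] by (cases "eps = 1") auto
  have "ennreal (pmf (step_dist K t0 start) y) =
     (\<integral>\<^sup>+ x. indicator {y} (nvars x ''out'') \<partial>measure_spmf (exec M simulate (tick 2 (set_nvar ''f'' 0 s))))"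
    using assms(1) by (simp add: exec_simulate ready_def o_def emeasure_pmf_single indicator_def[symmetric] del: map_spmf_of_pmf)
  moreover have "ennreal ((level J y - level 0 y) / eps) \<le>
      (\<integral>\<^sup>+ x. indicator {y} (nvars x ''out'') \<partial>measure_spmf (exec M residual (tick 2 (set_nvar ''f'' 1 s))))"
    using assms by (intro residual_ge ready_upd)
  moreover have "ennreal (level J y) = ennreal ((level J y - level 0 y) / eps) * ennreal eps
      + ennreal (pmf (step_dist K t0 start) y) * ennreal (1 - eps)"
    using lev eps by (simp add: ennreal_mult[symmetric] ennreal_plus[symmetric] L_eq del: ennreal_plus level.simps)
  ultimately show ?thesis
    unfolding nn_integral_core[OF assms(1)] by (simp only:) (intro add_mono mult_right_mono, auto)
qed

text \<open>During the \<open>n + 1\<close> rounds of a level the remaining mass never exceeds the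
  deficit at its beginning.\<close>

lemma suminf_remaining:
  assumes B: "\<And>J. (\<Sum>j<J. 1 - (\<Sum>z<n. level j z)) \<le> B"
  shows "(\<Sum>k. ennreal (remaining k)) \<le> ennreal (real (n + 1) * B)"
proof -
  have "(\<Sum>k<N. ennreal (remaining k)) \<le> ennreal (real (n + 1) * B)" for N
  proof -
    \<comment> \<open>The range is enlarged to whole levels so that the rounds can be
      grouped.\<close>
    have "(\<Sum>k<N. remaining k) \<le> (\<Sum>k<N * (n + 1). remaining k)"
      by (intro sum_mono2) (auto simp: remaining_nonneg)
    also have "\<dots> = (\<Sum>j<N. sum remaining {j * (n + 1)..<j * (n + 1) + (n + 1)})"
      by (rule sum.nat_group[symmetric])
    also have "\<dots> \<le> (\<Sum>j<N. real (n + 1) * (1 - (\<Sum>z<n. level j z)))"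
    proof (intro sum_mono)
      fix j
      have "remaining k \<le> 1 - (\<Sum>z<n. level j z)" if "k \<in> {j * (n + 1)..<j * (n + 1) + (n + 1)}" for k
      proof -
        have "k div (n + 1) = j" using that by (intro div_nat_eqI) (auto simp: algebra_simps)
        then show ?thesis using remaining_le[of k] by simp
      qed
      then have "sum remaining {j * (n + 1)..<j * (n + 1) + (n + 1)}
          \<le> real (card {j * (n + 1)..<j * (n + 1) + (n + 1)}) * (1 - (\<Sum>z<n. level j z))"
        by (rule sum_bounded_above)
      then show "sum remaining {j * (n + 1)..<j * (n + 1) + (n + 1)} \<le> real (n + 1) * (1 - (\<Sum>z<n. level j z))"
        by (simp only: card_atLeastLessThan add_diff_cancel_left')
    qed
    also have "\<dots> \<le> real (n + 1) * B"
      using B[of N] by (simp only: sum_distrib_left[symmetric]) (intro mult_left_mono, auto)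
    finally show ?thesis
      by (simp add: sum_ennreal remaining_nonneg ennreal_leI)
  qed
  then show ?thesis by (simp add: suminf_eq_SUP SUP_least)
qed

text \<open>The search costs a multiple of \<open>1 / eps\<close> once entered and is entered with
  probability \<open>eps\<close>, so \<open>eps\<close> cancels there, while the initialisation
  keeps the factor \<open>eps\<close>.\<close>

lemma core_time:
  assumes "ready s" and B: "\<And>J. (\<Sum>j<J. 1 - (\<Sum>z<n. level j z)) \<le> B"
  shows "(\<integral>\<^sup>+ x. of_nat (clock x) \<partial>measure_spmf (exec M core s)) \<le>
    ennreal (real (clock s) + 6 + real t0 * (real (step_time M) + 3) + eps * real (init_cost M n t0)
       + real (cell_cost n) * (real (n + 1) * B))"
proof -
  have B0: "0 \<le> B" using B[of 0] by simp
  let ?D = "real (cell_cost n) * (real (n + 1) * B)"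
  have "(\<integral>\<^sup>+ x. of_nat (clock x) \<partial>measure_spmf (exec M residual (tick 2 (set_nvar ''f'' 1 s))))
     \<le> of_nat (clock (tick 2 (set_nvar ''f'' 1 s)) + init_cost M n t0 + 1) + of_nat (cell_cost n) * (\<Sum>k. ennreal (remaining k)) / ennreal eps"
    using assms(1) by (intro residual_time ready_upd)
  also have "\<dots> \<le> of_nat (clock (tick 2 (set_nvar ''f'' 1 s)) + init_cost M n t0 + 1) + of_nat (cell_cost n) * ennreal (real (n + 1) * B) / ennreal eps"
    by (intro add_left_mono divide_right_mono_ennreal mult_left_mono suminf_remaining B) auto
  also have "\<dots> = ennreal (real (clock s + 2 + init_cost M n t0 + 1) + ?D / eps)"
    using eps B0 by (simp add: ennreal_of_nat_eq_real_of_nat ennreal_mult[symmetric] divide_ennreal ennreal_plus[symmetric] del: ennreal_plus)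
  finally have 1: "(\<integral>\<^sup>+ x. of_nat (clock x) \<partial>measure_spmf (exec M residual (tick 2 (set_nvar ''f'' 1 s))))
     \<le> ennreal (real (clock s + 2 + init_cost M n t0 + 1) + ?D / eps)" .
  have 2: "(\<integral>\<^sup>+ x. of_nat (clock x) \<partial>measure_spmf (exec M simulate (tick 2 (set_nvar ''f'' 0 s))))
     = ennreal (real (clock s + 2 + (t0 * (step_time M + 3) + 3)))"
    using assms(1) by (simp add: exec_simulate ready_def o_def ennreal_of_nat_eq_real_of_nat measure_pmf.emeasure_space_1 del: map_spmf_of_pmf)
  have "(\<integral>\<^sup>+ x. of_nat (clock x) \<partial>measure_spmf (exec M core s)) \<le>
     ennreal (real (clock s + 2 + init_cost M n t0 + 1) + ?D / eps) * ennreal eps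
     + ennreal (real (clock s + 2 + (t0 * (step_time M + 3) + 3))) * ennreal (1 - eps)"
    unfolding nn_integral_core[OF assms(1)] 2 by (intro add_mono mult_right_mono 1) auto
  also have "\<dots> = ennreal ((real (clock s + 2 + init_cost M n t0 + 1) + ?D / eps) * eps
     + real (clock s + 2 + (t0 * (step_time M + 3) + 3)) * (1 - eps))"
    using eps B0 by (simp add: ennreal_mult[symmetric] ennreal_plus[symmetric] del: ennreal_plus)
  also have "\<dots> \<le> ennreal (real (clock s) + 6 + real t0 * (real (step_time M) + 3) + eps * real (init_cost M n t0) + ?D)"
  proof (rule ennreal_leI)
    have "(real (clock s + 2 + init_cost M n t0 + 1) + ?D / eps) * eps
       = (real (clock s) + 3) * eps + eps * real (init_cost M n t0) + ?D"
      using eps by (simp add: field_simps)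
    moreover have "real (clock s + 2 + (t0 * (step_time M + 3) + 3)) * (1 - eps)
       \<le> (real (clock s) + 5) * (1 - eps) + real t0 * (real (step_time M) + 3)"
    proof -
      have "real t0 * (real (step_time M) + 3) * (1 - eps) \<le> real t0 * (real (step_time M) + 3) * 1"
        using eps by (intro mult_left_mono) auto
      then show ?thesis by (simp add: algebra_simps)
    qed
    moreover have "(real (clock s) + 3) * eps + (real (clock s) + 5) * (1 - eps) \<le> real (clock s) + 6"
      using eps by (simp add: algebra_simps)
    ultimately show "(real (clock s + 2 + init_cost M n t0 + 1) + ?D / eps) * eps
     + real (clock s + 2 + (t0 * (step_time M + 3) + 3)) * (1 - eps)
     \<le> real (clock s) + 6 + real t0 * (real (step_time M) + 3) + eps * real (init_cost M n t0) + ?D" by linarith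
  qed
  finally show ?thesis .
qed

end

section \<open>Sampling with a known convergence rate\<close>

abbreviation n4 :: rexp where
  "n4 \<equiv> RTimes (OfNat (NVar ''n'')) (RTimes (OfNat (NVar ''n'')) (RTimes (OfNat (NVar ''n'')) (OfNat (NVar ''n''))))"

text \<open>Expressions have neither logarithms nor products of naturals, so the exponent is found
  by repeated multiplication of \<open>u\<close> and the product with \<open>T\<close> by repeated
  addition.\<close>

definition grow_loop :: com where
  "grow_loop = While (RLess (Scal ''pi_min'') (RTimes (OfNat (NConst 4)) (RTimes n4 (Scal ''u''))))
     (Seq (SetScal ''u'' (RTimes (Scal ''u'') (Scal ''rho'')))
          (NAssign ''t0'' (NPlus (NVar ''t0'') (NVar ''T''))))"

definition setup_rate :: com where
  "setup_rate = Seq (SetScal ''u'' (OfNat (NConst 1)))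
     (Seq grow_loop (SetScal ''eps'' (RDivide (OfNat (NConst 1)) n4)))"

lemma grow_loop_guard:
  "bval (RLess (Scal ''pi_min'') (RTimes (OfNat (NConst 4)) (RTimes n4 (Scal ''u'')))) s
   \<longleftrightarrow> arrays s ''pi_min'' 0 0 < 4 * real (nvars s ''n'') ^ 4 * arrays s ''u'' 0 0"
  by (simp add: eval_nat_numeral mult.assoc)

lemma exec_grow_loop:
  fixes s :: store
  assumes "\<And>j. j < k \<Longrightarrow> p < 4 * real n ^ 4 * \<rho> ^ j" "4 * real n ^ 4 * \<rho> ^ k \<le> p" "i \<le> k"
    and "nvars s ''n'' = n" "nvars s ''T'' = T" "nvars s ''t0'' = i * T"
    and "arrays s ''pi_min'' 0 0 = p" "arrays s ''rho'' 0 0 = \<rho>" "arrays s ''u'' 0 0 = \<rho> ^ i"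
  shows "\<exists>s'. loop (bval (RLess (Scal ''pi_min'') (RTimes (OfNat (NConst 4)) (RTimes n4 (Scal ''u'')))))
      (\<lambda>s. exec M (Seq (SetScal ''u'' (RTimes (Scal ''u'') (Scal ''rho'')))
          (NAssign ''t0'' (NPlus (NVar ''t0'') (NVar ''T'')))) (tick 1 s)) s = return_spmf s' \<and>
      nvars s' ''t0'' = k * T \<and> (\<forall>z. z \<noteq> ''t0'' \<longrightarrow> nvars s' z = nvars s z) \<and>
      (\<forall>z. z \<noteq> ''u'' \<longrightarrow> arrays s' z = arrays s z) \<and> clock s' \<le> clock s + 3 * (k - i)"
  using assms(3-)
proof (induction "k - i" arbitrary: i s)
  case 0
  then have "i = k" by simp
  with 0 assms(2) show ?case
    by (subst loop.simps) (simp only: grow_loop_guard, auto)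
next
  case (Suc m)
  then have "i < k" by simp
  define s2 where "s2 = tick 1 (set_nvar ''t0'' (Suc i * T) (tick 1 (set_entry ''u'' 0 0 (\<rho> ^ Suc i) (tick 1 s))))"
  have "\<exists>s'. loop (bval (RLess (Scal ''pi_min'') (RTimes (OfNat (NConst 4)) (RTimes n4 (Scal ''u'')))))
      (\<lambda>s. exec M (Seq (SetScal ''u'' (RTimes (Scal ''u'') (Scal ''rho'')))
          (NAssign ''t0'' (NPlus (NVar ''t0'') (NVar ''T'')))) (tick 1 s)) s2 = return_spmf s' \<and>
      nvars s' ''t0'' = k * T \<and> (\<forall>z. z \<noteq> ''t0'' \<longrightarrow> nvars s' z = nvars s2 z) \<and>
      (\<forall>z. z \<noteq> ''u'' \<longrightarrow> arrays s' z = arrays s2 z) \<and> clock s' \<le> clock s2 + 3 * (k - Suc i)"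
    by (rule Suc.hyps(1)) (use Suc \<open>i < k\<close> in \<open>auto simp: s2_def\<close>)
  then obtain s' where s': "loop (bval (RLess (Scal ''pi_min'') (RTimes (OfNat (NConst 4)) (RTimes n4 (Scal ''u'')))))
      (\<lambda>s. exec M (Seq (SetScal ''u'' (RTimes (Scal ''u'') (Scal ''rho'')))
          (NAssign ''t0'' (NPlus (NVar ''t0'') (NVar ''T'')))) (tick 1 s)) s2 = return_spmf s'"
      "nvars s' ''t0'' = k * T" "\<forall>z. z \<noteq> ''t0'' \<longrightarrow> nvars s' z = nvars s2 z"
      "\<forall>z. z \<noteq> ''u'' \<longrightarrow> arrays s' z = arrays s2 z" "clock s' \<le> clock s2 + 3 * (k - Suc i)" by blast
  have body: "exec M (Seq (SetScal ''u'' (RTimes (Scal ''u'') (Scal ''rho'')))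
          (NAssign ''t0'' (NPlus (NVar ''t0'') (NVar ''T'')))) (tick 1 s) = return_spmf s2"
    using Suc.prems by (simp add: s2_def mult.commute add.commute)
  have guard: "bval (RLess (Scal ''pi_min'') (RTimes (OfNat (NConst 4)) (RTimes n4 (Scal ''u'')))) s"
    unfolding grow_loop_guard using Suc.prems assms(1)[OF \<open>i < k\<close>] by simp
  have "clock s' \<le> clock s + 3 * (k - i)"
    using s'(5) \<open>i < k\<close> by (simp add: s2_def)
  then show ?case
    using s' guard
    by (subst loop.simps) (simp only: if_True body return_bind_spmf, auto simp: s2_def)
qed

lemma exec_setup_rate:
  fixes s :: store
  assumes "\<And>j. j < k \<Longrightarrow> p < 4 * real n ^ 4 * \<rho> ^ j" "4 * real n ^ 4 * \<rho> ^ k \<le> p"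
    and "nvars s ''n'' = n" "nvars s ''T'' = T" "nvars s ''t0'' = 0"
    and "arrays s ''pi_min'' 0 0 = p" "arrays s ''rho'' 0 0 = \<rho>"
  shows "\<exists>s'. exec M setup_rate s = return_spmf s' \<and> nvars s' ''t0'' = k * T \<and> arrays s' ''eps'' 0 0 = 1 / real n ^ 4 \<and>
     (\<forall>z. z \<noteq> ''t0'' \<longrightarrow> nvars s' z = nvars s z) \<and> (\<forall>z. z \<notin> {''u'', ''eps''} \<longrightarrow> arrays s' z = arrays s z) \<and>
     clock s' \<le> clock s + 3 * k + 3"
proof -
  let ?s = "tick 1 (set_entry ''u'' 0 0 1 s)"
  obtain s' where s': "loop (bval (RLess (Scal ''pi_min'') (RTimes (OfNat (NConst 4)) (RTimes n4 (Scal ''u'')))))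
      (\<lambda>s. exec M (Seq (SetScal ''u'' (RTimes (Scal ''u'') (Scal ''rho'')))
          (NAssign ''t0'' (NPlus (NVar ''t0'') (NVar ''T'')))) (tick 1 s)) ?s = return_spmf s'"
      "nvars s' ''t0'' = k * T" "\<forall>z. z \<noteq> ''t0'' \<longrightarrow> nvars s' z = nvars ?s z"
      "\<forall>z. z \<noteq> ''u'' \<longrightarrow> arrays s' z = arrays ?s z" "clock s' \<le> clock ?s + 3 * (k - 0)"
    using exec_grow_loop[where i=0 and s="?s" and M=M, OF assms(1,2)] assms(3-) by auto
  have "exec M grow_loop ?s = return_spmf (tick 1 s')"
    unfolding grow_loop_def exec.simps(9) s'(1) by simp
  then have "exec M setup_rate s = return_spmf (tick 1 (set_entry ''eps'' 0 0 (1 / real n ^ 4) (tick 1 s')))"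
    using s'(3) assms(3) unfolding setup_rate_def by (simp add: eval_nat_numeral mult.assoc)
  then show ?thesis
    using s' by (intro exI[of _ "tick 1 (set_entry ''eps'' 0 0 (1 / real n ^ 4) (tick 1 s'))"]) auto
qed

section \<open>The support of a stationary law and its least atom\<close>

locale stationary_chain = chain_kernel n K 0 for n :: nat and K :: "nat \<Rightarrow> nat pmf" +
  fixes \<pi> :: "nat pmf"
  assumes stat: "stationary n K \<pi>"
begin

lemma supp_subset: "set_pmf \<pi> \<subseteq> {..<n}"
  using stat by (simp add: stationary_def)

lemma finite_supp: "finite (set_pmf \<pi>)"
  using supp_subset finite_subset by blast

lemma sum_supp: "(\<Sum>y\<in>set_pmf \<pi>. pmf \<pi> y) = 1"
  by (intro sum_pmf_eq_1 finite_supp) auto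

lemma supp_closed: "x \<in> set_pmf \<pi> \<Longrightarrow> set_pmf (K x) \<subseteq> set_pmf \<pi>"
proof -
  assume "x \<in> set_pmf \<pi>"
  have "set_pmf (bind_pmf \<pi> K) = set_pmf \<pi>" using stat by (simp add: stationary_def)
  then show ?thesis using \<open>x \<in> set_pmf \<pi>\<close> by (auto simp: set_bind_pmf)
qed

lemma pi_min_le: "y \<in> set_pmf \<pi> \<Longrightarrow> pi_min \<pi> \<le> pmf \<pi> y"
  unfolding pi_min_def using finite_supp by auto

lemma pi_min_pos: "0 < pi_min \<pi>"
  unfolding pi_min_def using finite_supp by (subst Min_gr_iff) (auto simp: set_pmf_not_empty set_pmf_iff pmf_pos)

lemma pi_min_le_1: "pi_min \<pi> \<le> 1"
proof -
  obtain y where "y \<in> set_pmf \<pi>" using set_pmf_not_empty[of \<pi>] by blast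
  from pi_min_le[OF this] show ?thesis using pmf_le_1[of \<pi> y] by linarith
qed

lemma step_closed: "x \<in> set_pmf \<pi> \<Longrightarrow> set_pmf (step_dist K t x) \<subseteq> set_pmf \<pi>"
  using supp_closed by (induction t) (auto simp: set_bind_pmf)

end

text \<open>A flagged row at time \<open>t + 1\<close> is a convex combination of flagged rows at
  time \<open>t\<close>, because flags are closed under a step and the lazy part keeps the row
  itself. Averaging cannot lower a minimum.\<close>

lemma flagged_min_mono_step:
  assumes "chain_kernel n K lz" and F: "\<And>x y. x < n \<Longrightarrow> F x \<Longrightarrow> y \<in> set_pmf (K x) \<Longrightarrow> F y" and z: "z < n"
  shows "flagged_min F (\<lambda>x. lazy_pow K n lz t x z) n \<le> flagged_min F (\<lambda>x. lazy_pow K n lz (Suc t) x z) n"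
proof (rule flagged_min_ge)
  interpret chain_kernel n K lz by fact
  let ?m = "flagged_min F (\<lambda>x. L t x z) n"
  fix x assume x: "x < n" "F x"
  have "?m = (\<Sum>k<n. pmf (K x) k * ?m)" using x by (simp add: sum_row flip: sum_distrib_right)
  also have "\<dots> \<le> (\<Sum>k<n. pmf (K x) k * L t k z)"
  proof (rule sum_mono)
    fix k assume k: "k \<in> {..<n}"
    show "pmf (K x) k * ?m \<le> pmf (K x) k * L t k z"
    proof (cases "k \<in> set_pmf (K x)")
      case True
      then have "F k" using F x by blast
      then show ?thesis using k by (intro mult_left_mono flagged_min_le(2)) auto
    qed (simp add: set_pmf_iff)
  qed
  finally have a: "?m \<le> (\<Sum>k<n. pmf (K x) k * L t k z)" .
  have "?m \<le> L t x z" using x by (rule flagged_min_le)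
  then have "lz * ?m \<le> lz * L t x z" using lz by (rule mult_left_mono)
  with a have "?m * (1 + lz) \<le> (\<Sum>k<n. pmf (K x) k * L t k z) + lz * L t x z" by (simp add: algebra_simps)
  then have "?m \<le> ((\<Sum>k<n. pmf (K x) k * L t k z) + lz * L t x z) / (1 + lz)" using lz by (simp add: pos_le_divide_eq)
  then show "?m \<le> L (Suc t) x z" unfolding L_front[OF x(1) z] .
qed (rule flagged_min_le)

text \<open>Common ground of the two samplers: mixing supplies \<open>\<rho> = 1/2\<close> with
  blocks of \<open>T\<close> steps, a gap supplies \<open>1 - \<gamma>\<close> with blocks of length
  1. The error is relative to \<open>pmf \<pi> y\<close>, as pointwise domination demands.\<close>

locale rate_chain = stationary_chain "num_states M" "trans_kernel M" \<pi>
  for M :: chain_access and \<pi> :: "nat pmf" +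
  fixes x0 T :: nat and \<rho> :: real
  assumes n2: "2 \<le> num_states M" and x0: "x0 \<in> set_pmf \<pi>" and T: "1 \<le> T" and \<rho>: "0 \<le> \<rho>" "\<rho> < 1"
    and rate: "\<And>x y k t. x \<in> set_pmf \<pi> \<Longrightarrow> y \<in> set_pmf \<pi> \<Longrightarrow> k * T \<le> t \<Longrightarrow>
      \<bar>pmf (step_dist (trans_kernel M) t x) y - pmf \<pi> y\<bar> \<le> 2 * \<rho> ^ k / pi_min \<pi> * pmf \<pi> y"
begin

abbreviation n where "n \<equiv> num_states M"
abbreviation p where "p \<equiv> pi_min \<pi>"

definition k0 :: nat where "k0 = (LEAST k. 4 * real n ^ 4 * \<rho> ^ k \<le> p)"

lemma k0: "4 * real n ^ 4 * \<rho> ^ k0 \<le> p" "j < k0 \<Longrightarrow> p < 4 * real n ^ 4 * \<rho> ^ j"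
proof -
  have n: "0 < 4 * real n ^ 4" using n2 by simp
  then have "0 < p / (4 * real n ^ 4)" using pi_min_pos by simp
  from real_arch_pow_inv[OF this \<rho>(2)] obtain k where "\<rho> ^ k < p / (4 * real n ^ 4)" by blast
  with n have "4 * real n ^ 4 * \<rho> ^ k \<le> p" by (simp add: field_simps)
  then show "4 * real n ^ 4 * \<rho> ^ k0 \<le> p" unfolding k0_def by (rule LeastI)
  show "p < 4 * real n ^ 4 * \<rho> ^ j" if "j < k0"
    using not_less_Least[OF that[unfolded k0_def]] by simp
qed

text \<open>This fixes the factor 4 in the threshold of \<open>grow_loop\<close>: twice the relative
  error must fit into \<open>eps\<close>.\<close>

lemma rel_err: "2 * \<rho> ^ k0 / p \<le> 1 / (2 * real n ^ 4)"
  using k0(1) pi_min_pos n2 by (simp add: field_simps)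

lemma rel_err_le:
  assumes "x \<in> set_pmf \<pi>" "y \<in> set_pmf \<pi>"
  shows "\<bar>L (k0 * T + j) x y - pmf \<pi> y\<bar> \<le> 2 * \<rho> ^ (k0 + j div T) / p * pmf \<pi> y"
proof -
  have "(k0 + j div T) * T \<le> k0 * T + j" by (simp add: distrib_right)
  from rate[OF assms this] show ?thesis
    using assms supp_subset by (subst L_eq_step_dist) auto
qed

lemma n4: "1 \<le> real n ^ 4" "1 / real n ^ 4 \<le> 1 / 2"
proof -
  have "(2::real) ^ 4 \<le> real n ^ 4" using n2 by (intro power_mono) auto
  then have n: "16 \<le> real n ^ 4" by simp
  then show "1 \<le> real n ^ 4" by linarith
  have "1 / real n ^ 4 \<le> 1 / 16" using n by (intro frac_le) auto
  then show "1 / real n ^ 4 \<le> 1 / 2" by linarith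
qed

lemma L_outside: "x \<in> set_pmf \<pi> \<Longrightarrow> z \<notin> set_pmf \<pi> \<Longrightarrow> L t x z = 0"
  using step_closed[of x t] supp_subset by (subst L_eq_step_dist) (auto simp: set_pmf_iff)

text \<open>This interpretation has no analytic hypotheses; it provides \<open>run.flag\<close> and
  \<open>run.level\<close>, in terms of which the assumptions of \<open>good_sampler_run\<close> are
  then proved.\<close>

sublocale run: sampler_run M n x0 "k0 * T" 0 "1 / real n ^ 4"
  by unfold_locales simp

text \<open>A relative error of at most 1/2 keeps the start row positive on the support, and
  closedness of the support makes it vanish elsewhere. The program thus detects the support without
  knowing \<pi>.\<close>

lemma flag_iff: "x < n \<Longrightarrow> run.flag x \<longleftrightarrow> x \<in> set_pmf \<pi>"
proof
  assume "run.flag x"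
  then show "x \<in> set_pmf \<pi>" using L_outside[OF x0, of x "k0 * T"] by (auto simp: run.flag_def)
next
  assume x: "x \<in> set_pmf \<pi>"
  have "\<bar>L (k0 * T + 0) x0 x - pmf \<pi> x\<bar> \<le> 2 * \<rho> ^ (k0 + 0 div T) / p * pmf \<pi> x"
    by (rule rel_err_le[OF x0 x])
  also have "\<dots> \<le> 1 / 2 * pmf \<pi> x"
    using rel_err n4 by (intro mult_right_mono) (auto simp: field_simps)
  finally have "1 / 2 * pmf \<pi> x \<le> L (k0 * T) x0 x" unfolding add_0_right by linarith
  moreover have "0 < pmf \<pi> x" using x by (simp add: pmf_positive)
  ultimately show "run.flag x" by (simp add: run.flag_def)
qed

lemma level_Suc_ge:
  assumes "z \<in> set_pmf \<pi>"
  shows "(1 - 2 * \<rho> ^ (k0 + j div T) / p) * pmf \<pi> z \<le> run.level (Suc j) z"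
  unfolding run.level.simps
proof (rule flagged_min_ge)
  have "0 \<le> 2 * \<rho> ^ (k0 + j div T) / p" using \<rho> pi_min_pos by simp
  then have "(1 - 2 * \<rho> ^ (k0 + j div T) / p) * pmf \<pi> z \<le> 1 * pmf \<pi> z"
    by (intro mult_right_mono) auto
  then show "(1 - 2 * \<rho> ^ (k0 + j div T) / p) * pmf \<pi> z \<le> 1" using pmf_le_1[of \<pi> z] by linarith
  fix x assume "x < n" "run.flag x"
  then have "x \<in> set_pmf \<pi>" using flag_iff by blast
  from rel_err_le[OF this assms, of j]
  show "(1 - 2 * \<rho> ^ (k0 + j div T) / p) * pmf \<pi> z \<le> L (k0 * T + j) x z"
    by (simp add: abs_le_iff algebra_simps)
qed

sublocale run: good_sampler_run M n x0 "k0 * T" 0 "1 / real n ^ 4"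
proof unfold_locales
  show x0n: "x0 < n" using x0 supp_subset by auto
  show "0 < 1 / real n ^ 4" using n2 by simp
  show "1 / real n ^ 4 \<le> 1" using n4 by simp
  show "(\<Sum>z<n. L (k0 * T) x0 z) = 1" using x0n by (rule L_sum)
  show "L (k0 * T) x0 z = pmf (step_dist (trans_kernel M) (k0 * T) x0) z" for z
    using x0n by (simp add: L_eq_step_dist)
  have flag_x0: "run.flag x0" using x0 x0n flag_iff by blast
  have flag_step: "run.flag y" if "x < n" "run.flag x" "y \<in> set_pmf (trans_kernel M x)" for x y
    using that flag_iff supp_closed closed by (metis lessThan_iff subsetD)
  fix j z
  show "(\<Sum>z<n. run.level j z) \<le> 1"
  proof (cases j)
    case 0
    have "(\<Sum>z<n. run.level 0 z) = 1 - 1 / real n ^ 4"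
      using x0n by (simp add: L_sum flip: sum_distrib_left)
    also have "\<dots> \<le> 1" by simp
    finally show ?thesis using 0 by simp
  next
    case (Suc i)
    \<comment> \<open>The start state is itself flagged, so the minima lie below its row, which has
      sum 1.\<close>
    have "(\<Sum>z<n. run.level (Suc i) z) \<le> (\<Sum>z<n. L (k0 * T + i) x0 z)"
      unfolding run.level.simps using x0n flag_x0 by (intro sum_mono flagged_min_le)
    then show ?thesis using Suc L_sum[OF x0n] by simp
  qed
  assume z: "z < n"
  show "run.level j z \<le> run.level (Suc j) z"
  proof (cases j)
    case (Suc i)
    then show ?thesis
      using flagged_min_mono_step[OF chain_kernel_axioms flag_step z, where t="k0 * T + i"] by simp
  next
    case 0
    show ?thesis
    proof (cases "z \<in> set_pmf \<pi>")
      case False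
      then have "run.level 0 z = 0" using L_outside[OF x0] by simp
      also have "0 \<le> run.level 1 z"
        unfolding One_nat_def run.level.simps by (rule flagged_min_ge) (auto simp: L_nonneg)
      finally show ?thesis using 0 by simp
    next
      case True
      \<comment> \<open>The choice of \<open>eps\<close> enters here: from
        \<open>2 * \<eta> \<le> eps\<close> follows (1 - eps) (1 + \<eta>) \<le> (1 - 2 \<eta>) (1 +
        \<eta>) \<le> 1 - \<eta>, so the overestimate of the start row stays below the underestimate
        of every flagged row.\<close>
      define \<eta> where "\<eta> = 2 * \<rho> ^ k0 / p"
      have \<eta>: "0 \<le> \<eta>" "2 * \<eta> \<le> 1 / real n ^ 4" using rel_err \<rho> pi_min_pos unfolding \<eta>_def by auto
      have "L (k0 * T) x0 z \<le> (1 + \<eta>) * pmf \<pi> z"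
        using rel_err_le[OF x0 True, of 0] by (simp add: \<eta>_def abs_le_iff algebra_simps)
      then have "run.level 0 z \<le> (1 - 1 / real n ^ 4) * ((1 + \<eta>) * pmf \<pi> z)"
        unfolding run.level.simps using n4 by (intro mult_left_mono) auto
      also have "\<dots> \<le> (1 - 2 * \<eta>) * ((1 + \<eta>) * pmf \<pi> z)"
        using \<eta> by (intro mult_right_mono) auto
      also have "\<dots> = ((1 - 2 * \<eta>) * (1 + \<eta>)) * pmf \<pi> z" by simp
      also have "\<dots> \<le> (1 - \<eta>) * pmf \<pi> z"
        using \<eta> by (intro mult_right_mono) (auto simp: algebra_simps)
      also have "\<dots> \<le> run.level 1 z" using level_Suc_ge[OF True, of 0] by (simp add: \<eta>_def)
      finally show ?thesis using 0 by simp
    qed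
  qed
qed

text \<open>A bound valid for all levels passes to their limit. Looking only at multiples of
  \<open>T\<close> makes the exponent of \<rho> exactly \<open>k0 + i\<close>.\<close>

lemma pmf_le_of_level_le:
  assumes "z \<in> set_pmf \<pi>" "\<And>J. run.level J z \<le> c"
  shows "pmf \<pi> z \<le> c"
proof (rule LIMSEQ_le_const2)
  have "(\<lambda>i. (1 - 2 * (\<rho> ^ k0 * \<rho> ^ i) / p) * pmf \<pi> z) \<longlonglongrightarrow> (1 - 2 * (\<rho> ^ k0 * 0) / p) * pmf \<pi> z"
    using \<rho> pi_min_pos by (intro tendsto_intros LIMSEQ_power_zero) auto
  then show "(\<lambda>i. (1 - 2 * \<rho> ^ (k0 + i) / p) * pmf \<pi> z) \<longlonglongrightarrow> pmf \<pi> z" by (simp add: power_add)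
  show "\<exists>N. \<forall>i\<ge>N. (1 - 2 * \<rho> ^ (k0 + i) / p) * pmf \<pi> z \<le> c"
  proof (intro exI[of _ 0] allI impI)
    fix i
    have "i * T div T = i" using T by simp
    then have "(1 - 2 * \<rho> ^ (k0 + i) / p) * pmf \<pi> z \<le> run.level (Suc (i * T)) z"
      using level_Suc_ge[OF assms(1), of "i * T"] by (simp only:)
    also have "\<dots> \<le> c" by (rule assms(2))
    finally show "(1 - 2 * \<rho> ^ (k0 + i) / p) * pmf \<pi> z \<le> c" .
  qed
qed

text \<open>The deficits of the later levels form a geometric series in blocks of length
  \<open>T\<close>, starting at 1 / (2 n^4) by \<open>rel_err\<close>. The initial deficit 1 / n^4
  is absorbed because T / (1 - \<rho>) is at least 1.\<close>

lemma sum_levels_le: "(\<Sum>j<J. 1 - (\<Sum>z<n. run.level j z)) \<le> 2 * real T / (real n ^ 4 * (1 - \<rho>))"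
proof -
  have r0: "1 - (\<Sum>z<n. run.level 0 z) = 1 / real n ^ 4"
    using run.sum_start by (simp flip: sum_distrib_left)
  have rS: "1 - (\<Sum>z<n. run.level (Suc j) z) \<le> 2 * \<rho> ^ k0 / p * \<rho> ^ (j div T)" for j
  proof -
    have "1 - 2 * \<rho> ^ (k0 + j div T) / p = (\<Sum>z\<in>set_pmf \<pi>. (1 - 2 * \<rho> ^ (k0 + j div T) / p) * pmf \<pi> z)"
      by (simp add: sum_supp flip: sum_distrib_left)
    also have "\<dots> \<le> (\<Sum>z\<in>set_pmf \<pi>. run.level (Suc j) z)"
      by (intro sum_mono level_Suc_ge)
    also have "\<dots> \<le> (\<Sum>z<n. run.level (Suc j) z)"
      using supp_subset by (intro sum_mono2) (auto intro!: flagged_min_ge L_nonneg)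
    finally show ?thesis by (simp add: power_add)
  qed
  have geo: "(\<Sum>j<J. \<rho> ^ (j div T)) \<le> T / (1 - \<rho>)" for J
  proof -
    have "(\<Sum>j<J. \<rho> ^ (j div T)) \<le> (\<Sum>j<J * T. \<rho> ^ (j div T))"
      using \<rho> T by (intro sum_mono2) auto
    also have "\<dots> = (\<Sum>i<J. \<Sum>j\<in>{i * T..<i * T + T}. \<rho> ^ (j div T))"
      by (rule sum.nat_group[symmetric])
    also have "\<dots> = (\<Sum>i<J. \<Sum>j\<in>{i * T..<i * T + T}. \<rho> ^ i)"
    proof (intro sum.cong refl)
      fix i j assume "j \<in> {i * T..<i * T + T}"
      then have "j div T = i" by (intro div_nat_eqI) (auto simp: algebra_simps)
      then show "\<rho> ^ (j div T) = \<rho> ^ i" by simp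
    qed
    also have "\<dots> = T * (\<Sum>i<J. \<rho> ^ i)" by (simp add: sum_distrib_left)
    also have "(\<Sum>i<J. \<rho> ^ i) = (1 - \<rho> ^ J) / (1 - \<rho>)"
      using \<rho> by (simp add: sum_gp_strict)
    also have "\<dots> \<le> 1 / (1 - \<rho>)" using \<rho> by (intro divide_right_mono) auto
    finally show ?thesis by (simp add: mult_left_mono)
  qed
  show ?thesis
  proof (cases J)
    case 0
    then show ?thesis using \<rho> by simp
  next
    case (Suc J')
    have "(\<Sum>j<J. 1 - (\<Sum>z<n. run.level j z)) = 1 / real n ^ 4 + (\<Sum>j<J'. 1 - (\<Sum>z<n. run.level (Suc j) z))"
      unfolding Suc sum.lessThan_Suc_shift r0 ..
    also have "(\<Sum>j<J'. 1 - (\<Sum>z<n. run.level (Suc j) z)) \<le> (\<Sum>j<J'. 2 * \<rho> ^ k0 / p * \<rho> ^ (j div T))"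
      by (intro sum_mono rS)
    also have "\<dots> = 2 * \<rho> ^ k0 / p * (\<Sum>j<J'. \<rho> ^ (j div T))" by (simp add: sum_distrib_left)
    also have "\<dots> \<le> 1 / (2 * real n ^ 4) * (T / (1 - \<rho>))"
      using rel_err geo \<rho> by (intro mult_mono) (auto intro!: sum_nonneg)
    also have "1 / real n ^ 4 + 1 / (2 * real n ^ 4) * (T / (1 - \<rho>)) \<le> 2 * real T / (real n ^ 4 * (1 - \<rho>))"
    proof -
      have "1 \<le> T / (1 - \<rho>)" using T \<rho> by (simp add: field_simps)
      then have "1 + 1 / 2 * (T / (1 - \<rho>)) \<le> 2 * (T / (1 - \<rho>))" by linarith
      then have "(1 + 1 / 2 * (T / (1 - \<rho>))) * (1 / real n ^ 4) \<le> 2 * (T / (1 - \<rho>)) * (1 / real n ^ 4)"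
        by (rule mult_right_mono) simp
      moreover have "(1 + 1 / 2 * W) * (1 / N) = 1 / N + 1 / (2 * N) * W" for W N :: real
        by (simp add: add_divide_distrib)
      moreover have "2 * (T / (1 - \<rho>)) * (1 / real n ^ 4) = 2 * real T / (real n ^ 4 * (1 - \<rho>))"
        by (simp add: mult.commute)
      ultimately show ?thesis by (simp only:)
    qed
    finally show ?thesis by simp
  qed
qed

text \<open>Minimality of \<open>k0\<close> makes the threshold fail at \<open>k0 - 1\<close>, and
  taking logarithms bounds that exponent. The second claim lets terms without a logarithm be
  absorbed into the final bound.\<close>

lemma k0_le: "real k0 \<le> 1 + 6 * ln (real n / p) / (1 - \<rho>)" and ln_ge: "1 / 2 \<le> ln (real n / p)"
proof -
  have pp: "0 < p" "p \<le> 1" by (rule pi_min_pos, rule pi_min_le_1)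
  have np: "2 \<le> real n / p" using pp n2 by (simp add: field_simps)
  have "1 / 2 \<le> ln (2::real)" using ln2_ge_two_thirds by simp
  also have "\<dots> \<le> ln (real n / p)" using np by (subst ln_le_cancel_iff) auto
  finally show "1 / 2 \<le> ln (real n / p)" .
  then have l0: "0 \<le> ln (real n / p)" by simp
  show "real k0 \<le> 1 + 6 * ln (real n / p) / (1 - \<rho>)"
  proof (cases k0)
    case 0
    then show ?thesis using l0 \<rho> by simp
  next
    case (Suc j)
    have "p < 4 * real n ^ 4 * \<rho> ^ j" by (rule k0(2)) (simp add: Suc)
    \<comment> \<open>The estimate 1 + x \<le> exp x at x = - (1 - \<rho>) replaces ln \<rho> and
      thereby covers \<rho> = 0 as well.\<close>
    also have "\<dots> \<le> 4 * real n ^ 4 * exp (- (1 - \<rho>)) ^ j"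
      using \<rho> exp_ge_add_one_self[of "- (1 - \<rho>)"] by (intro mult_left_mono power_mono) auto
    also have "exp (- (1 - \<rho>)) ^ j = exp (- (real j * (1 - \<rho>)))"
      by (simp add: exp_of_nat_mult[symmetric] algebra_simps)
    finally have "p * exp (real j * (1 - \<rho>)) < 4 * real n ^ 4 * exp (- (real j * (1 - \<rho>))) * exp (real j * (1 - \<rho>))"
      by (rule mult_strict_right_mono) simp
    also have "\<dots> = 4 * real n ^ 4" by (simp add: exp_minus)
    finally have "p * exp (real j * (1 - \<rho>)) < 4 * real n ^ 4" .
    then have "exp (real j * (1 - \<rho>)) < 4 * real n ^ 4 / p" using pp by (simp add: field_simps)
    \<comment> \<open>Two further powers of \<open>n\<close> absorb the factor 4, and
      \<open>p ^ 6 \<le> p\<close> because \<open>p \<le> 1\<close>; this is the origin of the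
      constant 6.\<close>
    also have "\<dots> \<le> (real n / p) ^ 6"
    proof -
      have "(4::real) \<le> real n ^ 2" using power_mono[of 2 "real n" 2] n2 by simp
      then have "4 * real n ^ 4 \<le> real n ^ 2 * real n ^ 4" by (rule mult_right_mono) simp
      then have "4 * real n ^ 4 \<le> real n ^ 6" by (simp flip: power_add)
      moreover have "p ^ 6 \<le> p" using power_decreasing[of 1 6 p] pp by simp
      ultimately show ?thesis unfolding power_divide using pp by (intro frac_le) auto
    qed
    finally have "ln (exp (real j * (1 - \<rho>))) < ln ((real n / p) ^ 6)"
      using np n2 by (subst ln_less_cancel_iff) auto
    then have "real j * (1 - \<rho>) < ln ((real n / p) ^ 6)" by simp
    also have "\<dots> = 6 * ln (real n / p)" using np by (subst ln_realpow) auto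
    finally have "real j \<le> 6 * ln (real n / p) / (1 - \<rho>)" using \<rho> by (simp add: field_simps)
    then show ?thesis using Suc by simp
  qed
qed

context
  fixes s :: store
  assumes s: "nvars s ''n'' = n" "nvars s ''start'' = x0" "nvars s ''T'' = T" "nvars s ''t0'' = 0"
      "arrays s ''rho'' 0 0 = \<rho>" "arrays s ''pi_min'' 0 0 = p" "arrays s ''lz'' 0 0 = 0" "\<forall>i j. arrays s ''X'' i j = 0"
begin

lemma exec_setup:
  obtains s' where "exec M setup_rate s = return_spmf s'" "run.ready s'" "clock s' \<le> clock s + 3 * k0 + 3"
proof -
  obtain s' where "exec M setup_rate s = return_spmf s'" "nvars s' ''t0'' = k0 * T" "arrays s' ''eps'' 0 0 = 1 / real n ^ 4"
     "\<forall>z. z \<noteq> ''t0'' \<longrightarrow> nvars s' z = nvars s z" "\<forall>z. z \<notin> {''u'', ''eps''} \<longrightarrow> arrays s' z = arrays s z"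
     "clock s' \<le> clock s + 3 * k0 + 3"
    using exec_setup_rate[OF k0(2) k0(1) s(1,3,4,6,5), of M] by blast
  then show ?thesis using s by (intro that[of s']) (auto simp: run.ready_def)
qed

lemma rate_core_ge:
  assumes "y < n"
  shows "ennreal (pmf \<pi> y) \<le> (\<integral>\<^sup>+ x. indicator {y} (nvars x ''out'') \<partial>measure_spmf (exec M (Seq setup_rate core) s))"
    (is "_ \<le> ?I")
proof (cases "y \<in> set_pmf \<pi>")
  case True
  obtain s' where s': "exec M setup_rate s = return_spmf s'" "run.ready s'" using exec_setup by blast
  have lev: "ennreal (run.level J y) \<le> ?I" for J
    using run.core_ge[OF s'(2) assms, of J] s'(1) by (simp del: run.level.simps)
  show ?thesis
  proof (cases ?I)
    case (real r)
    have "pmf \<pi> y \<le> r"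
      using lev real by (intro pmf_le_of_level_le[OF True]) (simp add: ennreal_le_iff del: run.level.simps)
    then show ?thesis using real by (simp add: ennreal_leI)
  qed simp
qed (simp add: set_pmf_iff)

lemma rate_core_time:
  assumes "step_time M \<le> cs" "matrix_time M \<le> cm * n ^ 4" "clock s \<le> 5"
  shows "(\<integral>\<^sup>+ x. of_nat (clock x) \<partial>measure_spmf (exec M (Seq setup_rate core) s))
    \<le> ennreal ((600 + 2 * real cm + 8 * real cs) * (real T / (1 - \<rho>) * ln (real n / p)))"
proof -
  obtain s' where s': "exec M setup_rate s = return_spmf s'" "run.ready s'" "clock s' \<le> clock s + 3 * k0 + 3"
    using exec_setup by blast
  let ?B = "2 * real T / (real n ^ 4 * (1 - \<rho>))"
  define W where "W = real T / (1 - \<rho>)"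
  define l where "l = ln (real n / p)"
  have W: "1 \<le> W" "real T \<le> W" unfolding W_def using T \<rho> by (auto simp: field_simps)
  have l: "1 / 2 \<le> l" unfolding l_def by (rule ln_ge)
  have Wl: "W \<le> 2 * (W * l)" using mult_left_mono[OF l, of W] W by simp
  have pw: "real n ^ i \<le> real n ^ j" if "i \<le> j" for i j using that n2 by (intro power_increasing) auto
  have mc: "real (mat_step_cost n) \<le> 20 * real n ^ 3"
  proof -
    have "real (mat_step_cost n) = 3 * real n ^ 3 + 9 * real n ^ 2 + 6 * real n ^ 1 + 2 * real n ^ 0"
      by (simp add: mat_step_cost_def algebra_simps eval_nat_numeral)
    then show ?thesis using pw[of 2 3] pw[of 1 3] pw[of 0 3] by linarith
  qed
  have t0: "real (k0 * T) \<le> 8 * (W * l)"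
  proof -
    have "real (k0 * T) \<le> (1 + 6 * l / (1 - \<rho>)) * real T"
      using k0_le unfolding l_def by (simp add: mult_right_mono)
    also have "\<dots> = real T + 6 * (W * l)" by (simp add: W_def algebra_simps)
    finally show ?thesis using W Wl by linarith
  qed
  have "k0 * 1 \<le> k0 * T" using T by (rule mult_le_mono2)
  then have k0t: "real k0 \<le> real (k0 * T)" by (simp only: of_nat_le_iff mult_1_right)
  have n4pos: "0 < real n ^ 4" using n2 by simp
  \<comment> \<open>The factor n^-4 reduces the matrix load to \<open>cm\<close> and each product,
    of cost O(n^3), to a constant.\<close>
  have init: "1 / real n ^ 4 * real (init_cost M n (k0 * T)) \<le> real cm + 22 * real (k0 * T) + 19"
  proof -
    have m: "real (mat_step_cost n) + 2 \<le> 22 * real n ^ 4"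
      using mc pw[of 3 4] pw[of 0 4] by simp
    have init: "real (init_cost M n (k0 * T)) = real (matrix_time M) + real (k0 * T) * (real (mat_step_cost n) + 2) + 7 * real n + 12"
      by (simp add: init_cost_def algebra_simps)
    have "real (matrix_time M) \<le> real (cm * n ^ 4)" using assms(2) by (simp only: of_nat_le_iff)
    then have "real (matrix_time M) \<le> real cm * real n ^ 4" by simp
    moreover have "real (k0 * T) * (real (mat_step_cost n) + 2) \<le> real (k0 * T) * (22 * real n ^ 4)"
      using m by (rule mult_left_mono) simp
    ultimately have "real (init_cost M n (k0 * T)) \<le> real cm * real n ^ 4 + real (k0 * T) * (22 * real n ^ 4) + 19 * real n ^ 4"
      using pw[of 1 4] pw[of 0 4] unfolding init power_one_right power_0 by linarith
    also have "\<dots> = (real cm + 22 * real (k0 * T) + 19) * real n ^ 4" by (simp add: algebra_simps)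
    finally show ?thesis using n4pos by (simp add: field_simps)
  qed
  \<comment> \<open>At most 36 n^3 per round and 2 n rounds per level give 72 n^4, which cancels
    against n^4 in \<open>?B\<close>.\<close>
  have cells: "real (cell_cost n) * (real (n + 1) * ?B) \<le> 144 * W"
  proof -
    have "real (cell_cost n) = 4 * real n + 12 + real (mat_step_cost n)"
      by (simp add: cell_cost_def)
    then have "real (cell_cost n) \<le> 36 * real n ^ 3"
      using mc pw[of 1 3, unfolded power_one_right] pw[of 0 3, unfolded power_0] by linarith
    moreover have "real (n + 1) \<le> 2 * real n" using n2 by simp
    ultimately have "real (cell_cost n) * real (n + 1) \<le> 36 * real n ^ 3 * (2 * real n)"
      by (intro mult_mono) auto
    also have "\<dots> = 72 * real n ^ 4" by (simp add: eval_nat_numeral)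
    finally have "real (cell_cost n) * real (n + 1) * ?B \<le> 72 * real n ^ 4 * ?B"
      using \<rho> by (intro mult_right_mono) auto
    also have "\<dots> = 144 * W" using n4pos \<rho> by (simp add: W_def field_simps)
    finally show ?thesis by (simp add: mult.assoc)
  qed
  have sim: "real (k0 * T) * (real (step_time M) + 3) \<le> real (k0 * T) * (real cs + 3)"
    using assms(1) by (intro mult_left_mono) auto
  \<comment> \<open>Here 33 = 5 + 3 + 6 + 19 collects initial clock, setup and overheads, and 28 = 3
    + 22 + 3, the last 3 covering the \<open>3 * k0\<close> of the setup loop.\<close>
  have "real (clock s') + 6 + real (k0 * T) * (real (step_time M) + 3) + 1 / real n ^ 4 * real (init_cost M n (k0 * T))
       + real (cell_cost n) * (real (n + 1) * ?B) \<le>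
      33 + real cm + real (k0 * T) * (real cs + 28) + 144 * W"
    using s'(3) assms(3) init cells sim k0t by (simp add: algebra_simps)
  also have "\<dots> \<le> (33 + real cm) * (2 * (W * l)) + 8 * (W * l) * (real cs + 28) + 144 * (2 * (W * l))"
  proof -
    have "1 \<le> 2 * (W * l)" using W Wl by linarith
    then have a: "(33 + real cm) * 1 \<le> (33 + real cm) * (2 * (W * l))" by (intro mult_left_mono) auto
    have b: "real (k0 * T) * (real cs + 28) \<le> 8 * (W * l) * (real cs + 28)"
      using t0 by (intro mult_right_mono) auto
    have c: "144 * W \<le> 144 * (2 * (W * l))" using Wl by simp
    from add_mono[OF add_mono[OF a b] c] show ?thesis by (simp only: mult_1_right)
  qed
  \<comment> \<open>The constants add up to 66 + 224 + 288 = 578, rounded up to 600.\<close>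
  also have "\<dots> \<le> (600 + 2 * real cm + 8 * real cs) * (W * l)"
  proof -
    have "0 \<le> W * l" using W Wl by linarith
    then show ?thesis by (simp add: algebra_simps)
  qed
  finally have *: "real (clock s') + 6 + real (k0 * T) * (real (step_time M) + 3) + 1 / real n ^ 4 * real (init_cost M n (k0 * T))
       + real (cell_cost n) * (real (n + 1) * ?B) \<le> (600 + 2 * real cm + 8 * real cs) * (W * l)" .
  have "(\<integral>\<^sup>+ x. of_nat (clock x) \<partial>measure_spmf (exec M (Seq setup_rate core) s)) =
     (\<integral>\<^sup>+ x. of_nat (clock x) \<partial>measure_spmf (exec M core s'))" using s'(1) by simp
  also have "\<dots> \<le> ennreal (real (clock s') + 6 + real (k0 * T) * (real (step_time M) + 3) + 1 / real n ^ 4 * real (init_cost M n (k0 * T))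
       + real (cell_cost n) * (real (n + 1) * ?B))"
    by (rule run.core_time[OF s'(2) sum_levels_le])
  also have "\<dots> \<le> ennreal ((600 + 2 * real cm + 8 * real cs) * (W * l))"
    by (rule ennreal_leI[OF *])
  finally show ?thesis unfolding W_def l_def .
qed

end

end

section \<open>Convergence from the spectral gap\<close>

text \<open>Log-convexity makes successive ratios nondecreasing. A single ratio above
  \<open>q\<close> would persist and force growth faster than \<open>C * q ^ k\<close>.\<close>

lemma log_convex_le:
  fixes a :: "nat \<Rightarrow> real"
  assumes nonneg: "\<And>k. 0 \<le> a k" and convex: "\<And>k. a (Suc k) ^ 2 \<le> a k * a (Suc (Suc k))"
    and bound: "\<And>k. a k \<le> C * q ^ k" and q: "0 < q"
  shows "a (Suc k) \<le> q * a k"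
proof (rule ccontr)
  assume "\<not> a (Suc k) \<le> q * a k"
  then have gt: "q * a k < a (Suc k)" by simp
  have ak: "0 < a k"
  proof (rule ccontr)
    assume "\<not> 0 < a k"
    then have "a k = 0" using nonneg[of k] by simp
    then have "a (Suc k) ^ 2 \<le> 0" using convex[of k] by simp
    then show False using gt \<open>a k = 0\<close> by simp
  qed
  define r where "r = a (Suc k) / a k"
  have r: "q < r" using gt ak by (simp add: r_def field_simps)
  have step: "0 < a (k + j) \<and> r * a (k + j) \<le> a (Suc (k + j))" for j
  proof (induction j)
    case 0
    then show ?case using ak by (simp add: r_def)
  next
    case (Suc j)
    have pos: "0 < a (Suc (k + j))" using Suc r q by (meson less_le_trans mult_pos_pos order_less_trans)
    have "r * a (Suc (k + j)) * a (k + j) \<le> a (Suc (k + j)) ^ 2"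
      using Suc pos by (simp add: power2_eq_square mult.commute mult.left_commute)
    also have "\<dots> \<le> a (k + j) * a (Suc (Suc (k + j)))" by (rule convex)
    finally have "r * a (Suc (k + j)) \<le> a (Suc (Suc (k + j)))"
      using Suc by (simp add: mult.commute)
    then show ?case using pos by simp
  qed
  have ge: "r ^ j * a k \<le> a (k + j)" for j
  proof (induction j)
    case (Suc j)
    have "r ^ Suc j * a k \<le> r * a (k + j)" using Suc r q by (simp add: mult.assoc)
    also have "\<dots> \<le> a (k + Suc j)" using step[of j] by simp
    finally show ?case .
  qed simp
  obtain j where j: "C * q ^ k / a k < (r / q) ^ j"
    using real_arch_pow[of "r / q"] r q by auto
  have "r ^ j * a k \<le> C * q ^ (k + j)" using ge[of j] bound[of "k + j"] by linarith
  then have "(r / q) ^ j \<le> C * q ^ k / a k"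
    using q ak by (simp add: power_divide power_add field_simps)
  then show False using j by simp
qed

section \<open>Eigenvalues through row and column vectors, and bounded powers\<close>

lemma eigenvalue_iff_right:
  fixes A :: "complex mat"
  assumes A: "A \<in> carrier_mat n n"
  shows "eigenvalue A l \<longleftrightarrow>
    (\<exists>v. (\<exists>x<n. v x \<noteq> 0) \<and> (\<forall>x<n. (\<Sum>y<n. A $$ (x, y) * v y) = l * v x))"
proof
  assume "eigenvalue A l"
  then obtain v where v: "v \<in> carrier_vec n" "v \<noteq> 0\<^sub>v n" "A *\<^sub>v v = l \<cdot>\<^sub>v v"
    using A unfolding eigenvalue_def eigenvector_def by auto
  have "\<exists>x<n. v $ x \<noteq> 0"
  proof (rule ccontr)
    assume "\<not> (\<exists>x<n. v $ x \<noteq> 0)"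
    then have "v = 0\<^sub>v n" using v(1) by (intro eq_vecI) auto
    then show False using v(2) by simp
  qed
  moreover have "(\<Sum>y<n. A $$ (x, y) * v $ y) = l * v $ x" if "x < n" for x
  proof -
    have "(A *\<^sub>v v) $ x = (l \<cdot>\<^sub>v v) $ x" using v(3) by simp
    then show ?thesis using A v(1) that by (simp add: scalar_prod_def atLeast0LessThan)
  qed
  ultimately show "\<exists>v. (\<exists>x<n. v x \<noteq> 0) \<and> (\<forall>x<n. (\<Sum>y<n. A $$ (x, y) * v y) = l * v x)" by blast
next
  assume "\<exists>v. (\<exists>x<n. v x \<noteq> 0) \<and> (\<forall>x<n. (\<Sum>y<n. A $$ (x, y) * v y) = l * v x)"
  then obtain v where v: "\<exists>x<n. v x \<noteq> 0" "\<forall>x<n. (\<Sum>y<n. A $$ (x, y) * v y) = l * v x" by blast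
  have "vec n v \<noteq> 0\<^sub>v n" using v(1) by (auto simp: vec_eq_iff)
  moreover have "A *\<^sub>v vec n v = l \<cdot>\<^sub>v vec n v"
    using A v(2) by (intro eq_vecI) (auto simp: scalar_prod_def atLeast0LessThan)
  ultimately have "eigenvector A (vec n v) l" using A unfolding eigenvector_def by auto
  then show "eigenvalue A l" unfolding eigenvalue_def by blast
qed

text \<open>Row vectors are the complex measures on which the chain acts, so conservation of mass
  and uniqueness of \<pi> apply to left eigenvectors. Transposition preserves the characteristic
  polynomial.\<close>

lemma eigenvalue_iff_left:
  fixes A :: "complex mat"
  assumes A: "A \<in> carrier_mat n n"
  shows "eigenvalue A l \<longleftrightarrow>
    (\<exists>v. (\<exists>x<n. v x \<noteq> 0) \<and> (\<forall>y<n. (\<Sum>x<n. v x * A $$ (x, y)) = l * v y))"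
proof -
  have T: "transpose_mat A \<in> carrier_mat n n" using A by simp
  have "eigenvalue A l \<longleftrightarrow> eigenvalue (transpose_mat A) l"
    using eigenvalue_root_char_poly[OF A] eigenvalue_root_char_poly[OF T] char_poly_transpose_mat[OF A] by simp
  also have "\<dots> \<longleftrightarrow> (\<exists>v. (\<exists>x<n. v x \<noteq> 0) \<and> (\<forall>y<n. (\<Sum>x<n. v x * A $$ (x, y)) = l * v y))"
    unfolding eigenvalue_iff_right[OF T] using A by (simp add: mult.commute)
  finally show ?thesis .
qed

text \<open>Boundedness is enough: any geometric rate \<open>r\<close> follows by dividing the
  matrix by \<open>r\<close> first.\<close>

lemma pow_bounded_of_eigenvalues:
  fixes A :: "complex mat"
  assumes A: "A \<in> carrier_mat n n" and n: "0 < n" and ev: "\<And>l. eigenvalue A l \<Longrightarrow> cmod l < 1"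
  shows "\<exists>c. \<forall>k. \<forall>x<n. \<forall>y<n. cmod ((A ^\<^sub>m k) $$ (x, y)) \<le> c"
proof -
  have "spectral_radius A < 1"
    using spectral_radius_mem_max(1)[OF A n] ev by (auto simp: spectrum_def)
  from spectral_radius_jnf_norm_bound_less_1_upper_triangular[OF A this]
  obtain c where c: "\<And>k. norm_bound (A ^\<^sub>m k) c" by blast
  have "A ^\<^sub>m k \<in> carrier_mat n n" for k using A by simp
  then have "cmod ((A ^\<^sub>m k) $$ (x, y)) \<le> c" if "x < n" "y < n" for k x y
    using c[of k] that unfolding norm_bound_def by (metis carrier_matD)
  then show ?thesis by blast
qed

section \<open>The deflated matrix and uniqueness of the stationary law\<close>

locale lazy_stationary = chain_kernel +
  fixes \<pi> :: "nat pmf"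
  assumes stat: "stationary n K \<pi>"
begin

text \<open>For \<open>t \<ge> 1\<close> this is the t-th power of the deflated matrix
  \<open>G 1\<close>, but \<open>G 0\<close> is the projection I - 1 \<pi>^T rather than the
  identity; hence the statements about \<open>Suc t\<close> below.\<close>

definition G :: "nat \<Rightarrow> nat \<Rightarrow> nat \<Rightarrow> real" where
  "G t x y = L t x y - pmf \<pi> y"

lemma sum_pi: "(\<Sum>y<n. pmf \<pi> y) = 1"
  using stat by (intro sum_pmf_eq_1) (auto simp: stationary_def)

lemma pi_K: "(\<Sum>x<n. pmf \<pi> x * pmf (K x) y) = pmf \<pi> y"
proof -
  have "pmf \<pi> y = pmf (bind_pmf \<pi> K) y" using stat by (simp add: stationary_def)
  also have "\<dots> = (\<Sum>x<n. pmf \<pi> x * pmf (K x) y)"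
    unfolding pmf_bind using stat
    by (subst integral_measure_pmf[where A="{..<n}"]) (auto simp: stationary_def set_pmf_iff)
  finally show ?thesis ..
qed

lemma L_1: "x < n \<Longrightarrow> L 1 x y = (pmf (K x) y + lz * (if x = y then 1 else 0)) / (1 + lz)"
  by (simp add: if_distrib[of "\<lambda>c. c * _"] sum.delta cong: if_cong)

lemma L_0_mult: "x < n \<Longrightarrow> (\<Sum>k<n. (if x = k then 1 else 0) * f k) = (f x :: real)"
  "y < n \<Longrightarrow> (\<Sum>k<n. f k * (if k = y then 1 else 0)) = (f y :: real)"
  by (simp_all add: if_distrib[of "\<lambda>c. c * _"] if_distrib[of "\<lambda>c. _ * c"] sum.delta sum.delta' cong: if_cong)

lemma L_add: "x < n \<Longrightarrow> y < n \<Longrightarrow> L (s + t) x y = (\<Sum>k<n. L s x k * L t k y)"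
proof (induction t arbitrary: y)
  case 0
  then show ?case by (simp add: L_0_mult)
next
  case (Suc t)
  have "(\<Sum>k<n. L s x k * L (Suc t) k y) =
     ((\<Sum>k<n. \<Sum>j<n. L s x k * L t k j * pmf (K j) y) + lz * (\<Sum>k<n. L s x k * L t k y)) / (1 + lz)"
    by (simp add: sum_divide_distrib sum_distrib_left sum.distrib add_divide_distrib distrib_left mult.assoc mult.left_commute)
  also have "(\<Sum>k<n. \<Sum>j<n. L s x k * L t k j * pmf (K j) y) = (\<Sum>j<n. L (s + t) x j * pmf (K j) y)"
    using Suc by (subst sum.swap) (simp flip: sum_distrib_right)
  also have "(\<Sum>k<n. L s x k * L t k y) = L (s + t) x y" using Suc by simp
  finally show ?case by simp
qed

lemma pi_L: "(\<Sum>x<n. pmf \<pi> x * L t x y) = pmf \<pi> y" if "y < n"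
  using that
proof (induction t arbitrary: y)
  case 0
  then show ?case by (simp add: L_0_mult)
next
  case (Suc t)
  have "(\<Sum>x<n. pmf \<pi> x * L (Suc t) x y) =
     ((\<Sum>x<n. \<Sum>j<n. pmf \<pi> x * L t x j * pmf (K j) y) + lz * (\<Sum>x<n. pmf \<pi> x * L t x y)) / (1 + lz)"
    by (simp add: sum_divide_distrib sum_distrib_left sum.distrib add_divide_distrib distrib_left mult.assoc mult.left_commute)
  also have "(\<Sum>x<n. \<Sum>j<n. pmf \<pi> x * L t x j * pmf (K j) y) = pmf \<pi> y"
    using Suc by (subst sum.swap) (simp add: pi_K flip: sum_distrib_right)
  also have "(\<Sum>x<n. pmf \<pi> x * L t x y) = pmf \<pi> y" using Suc by simp
  also have "(pmf \<pi> y + lz * pmf \<pi> y) / (1 + lz) = pmf \<pi> y" using lz by (simp add: field_simps)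
  finally show ?case .
qed

lemma G_add: "x < n \<Longrightarrow> y < n \<Longrightarrow> (\<Sum>k<n. G s x k * G t k y) = G (s + t) x y"
proof -
  assume xy: "x < n" "y < n"
  have "(\<Sum>k<n. G s x k * G t k y) = (\<Sum>k<n. L s x k * L t k y) - (\<Sum>k<n. L s x k) * pmf \<pi> y
      - (\<Sum>k<n. pmf \<pi> k * L t k y) + (\<Sum>k<n. pmf \<pi> k) * pmf \<pi> y"
    by (simp add: G_def algebra_simps sum.distrib sum_subtractf sum_distrib_left sum_distrib_right)
  also have "\<dots> = G (s + t) x y"
    using xy by (simp add: G_def L_sum pi_L sum_pi L_add)
  finally show ?thesis .
qed

definition P :: "complex mat" where
  "P = map_mat complex_of_real (transition_matrix n K)"

lemma P_carrier: "P \<in> carrier_mat n n" and P_index: "x < n \<Longrightarrow> y < n \<Longrightarrow> P $$ (x, y) = complex_of_real (pmf (K x) y)"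
  by (auto simp: P_def transition_matrix_def)

text \<open>Multiplying a row vector by a stochastic matrix does not increase its L1 norm.\<close>

lemma eigenvalue_P_le_1: "eigenvalue P l \<Longrightarrow> cmod l \<le> 1"
proof -
  assume "eigenvalue P l"
  then obtain v where v: "\<exists>x<n. v x \<noteq> 0" "\<forall>y<n. (\<Sum>x<n. v x * P $$ (x, y)) = l * v y"
    unfolding eigenvalue_iff_left[OF P_carrier] by blast
  let ?S = "\<Sum>x<n. cmod (v x)"
  have pos: "0 < ?S" using v(1) by (auto intro!: sum_pos2)
  have "cmod l * ?S = (\<Sum>y<n. cmod (\<Sum>x<n. v x * P $$ (x, y)))"
    using v(2) by (simp add: sum_distrib_left norm_mult)
  also have "\<dots> \<le> (\<Sum>y<n. \<Sum>x<n. cmod (v x) * pmf (K x) y)"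
    by (intro sum_mono order_trans[OF norm_sum]) (simp add: norm_mult P_index)
  also have "\<dots> = ?S" by (subst sum.swap) (simp add: sum_row flip: sum_distrib_left)
  finally show ?thesis using pos by simp
qed

text \<open>Uniqueness speaks about pmfs; this brings it to bear on nonnegative invariant
  vectors.\<close>

lemma stationary_of_fun:
  assumes f: "\<And>y. y < n \<Longrightarrow> 0 \<le> f y" "(\<Sum>y<n. f y) = 1" "\<And>y. y < n \<Longrightarrow> (\<Sum>x<n. f x * pmf (K x) y) = f y"
  obtains \<rho> where "stationary n K \<rho>" "\<And>y. y < n \<Longrightarrow> pmf \<rho> y = f y"
proof -
  define g where "g = (\<lambda>y. if y < n then f y else 0)"
  have g0: "0 \<le> g y" for y by (simp add: g_def f)
  have "(\<integral>\<^sup>+ y. ennreal (g y) \<partial>count_space UNIV) = (\<integral>\<^sup>+ y. ennreal (g y) \<partial>count_space {..<n})"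
    by (intro nn_integral_count_space_eq) (auto simp: g_def)
  also have "\<dots> = ennreal (\<Sum>y<n. g y)" by (simp add: nn_integral_count_space_finite sum_ennreal g0)
  also have "(\<Sum>y<n. g y) = 1" using f(2) by (simp add: g_def)
  finally have g1: "(\<integral>\<^sup>+ y. ennreal (g y) \<partial>count_space UNIV) = 1" by simp
  have pmf: "pmf (embed_pmf g) y = g y" for y by (rule pmf_embed_pmf[OF g0 g1])
  have gf: "g y = f y" if "y < n" for y using that by (simp add: g_def)
  have supp: "set_pmf (embed_pmf g) \<subseteq> {..<n}" 
  proof
    fix y assume "y \<in> set_pmf (embed_pmf g)"
    then have "g y \<noteq> 0" by (simp add: set_pmf_iff pmf)
    then show "y \<in> {..<n}" by (auto simp: g_def split: if_splits)
  qed
  have "bind_pmf (embed_pmf g) K = embed_pmf g"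
  proof (rule pmf_eqI)
    fix y
    have "pmf (bind_pmf (embed_pmf g) K) y = (\<Sum>x<n. f x * pmf (K x) y)"
      unfolding pmf_bind using supp
      by (subst integral_measure_pmf[where A="{..<n}"]) (auto simp: set_pmf_iff pmf gf)
    also have "\<dots> = g y"
    proof (cases "y < n")
      case False
      have "(\<Sum>x<n. f x * pmf (K x) y) = 0"
      proof (intro sum.neutral ballI)
        fix x assume "x \<in> {..<n}"
        then have "y \<notin> set_pmf (K x)" using closed[of x] False by auto
        then show "f x * pmf (K x) y = 0" by (simp add: set_pmf_iff)
      qed
      then show ?thesis using False by (simp add: g_def)
    qed (simp add: g_def f)
    finally show "pmf (bind_pmf (embed_pmf g) K) y = pmf (embed_pmf g) y" by (simp add: pmf)
  qed
  then show ?thesis using supp by (intro that[of "embed_pmf g"]) (auto simp: stationary_def pmf gf)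
qed

text \<open>The positive part of an invariant signed measure is subinvariant, and total mass is preserved.\<close>

lemma positive_part_invariant:
  assumes inv: "\<And>y. y < n \<Longrightarrow> (\<Sum>x<n. u x * pmf (K x) y) = (u y :: real)" and y: "y < n"
  shows "(\<Sum>x<n. max (u x) 0 * pmf (K x) y) = max (u y) 0"
proof -
  let ?f = "\<lambda>y. (\<Sum>x<n. max (u x) 0 * pmf (K x) y)"
  have ge: "max (u y) 0 \<le> ?f y" if "y < n" for y
  proof -
    have "u y \<le> ?f y" unfolding inv[OF that, symmetric] by (intro sum_mono mult_right_mono) auto
    moreover have "0 \<le> ?f y" by (intro sum_nonneg) auto
    ultimately show ?thesis by simp
  qed
  have "(\<Sum>y<n. ?f y) = (\<Sum>x<n. max (u x) 0)"
    by (subst sum.swap) (simp add: sum_row flip: sum_distrib_left)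
  then have "(\<Sum>y<n. ?f y - max (u y) 0) = 0" by (simp add: sum_subtractf)
  then have "\<forall>y\<in>{..<n}. ?f y - max (u y) 0 = 0"
    using ge by (subst (asm) sum_nonneg_eq_0_iff) auto
  then show ?thesis using y by simp
qed

text \<open>Positive and negative part have equal mass \<open>s\<close>. If \<open>s\<close> were
  positive, both would normalise to \<pi>, yet at each state one of them vanishes.\<close>

lemma invariant_sum_0:
  assumes uniq: "\<And>\<rho>. stationary n K \<rho> \<Longrightarrow> \<rho> = \<pi>"
    and inv: "\<And>y. y < n \<Longrightarrow> (\<Sum>x<n. u x * pmf (K x) y) = (u y :: real)" and sum0: "(\<Sum>x<n. u x) = 0"
    and "x < n"
  shows "u x = 0"
proof (rule ccontr)
  assume "u x \<noteq> 0"
  define s where "s = (\<Sum>x<n. max (u x) 0)"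
  have s': "(\<Sum>x<n. max (- u x) 0) = s"
  proof -
    have "s - (\<Sum>x<n. max (- u x) 0) = (\<Sum>x<n. u x)"
      unfolding s_def sum_subtractf[symmetric] by (intro sum.cong) auto
    then show ?thesis using sum0 by simp
  qed
  have "0 < (\<Sum>x<n. max (u x) 0) + (\<Sum>x<n. max (- u x) 0)"
    unfolding sum.distrib[symmetric] using \<open>x < n\<close> \<open>u x \<noteq> 0\<close> by (intro sum_pos2[of _ x]) auto
  then have s: "0 < s" using s' s_def by simp
  have part: "max (v y) 0 / s = pmf \<pi> y"
    if v: "\<And>y. y < n \<Longrightarrow> (\<Sum>x<n. v x * pmf (K x) y) = (v y :: real)" "(\<Sum>x<n. max (v x) 0) = s" and y: "y < n" for v y
  proof -
    obtain \<rho> where \<rho>: "stationary n K \<rho>" "\<And>y. y < n \<Longrightarrow> pmf \<rho> y = max (v y) 0 / s"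
    proof (rule stationary_of_fun[of "\<lambda>y. max (v y) 0 / s"])
      show "(\<Sum>x<n. max (v x) 0 / s * pmf (K x) y) = max (v y) 0 / s" if "y < n" for y
        using positive_part_invariant[OF v(1) that] by (simp flip: sum_divide_distrib)
      show "(\<Sum>x<n. max (v x) 0 / s) = 1" using v(2) s by (simp flip: sum_divide_distrib)
    qed (use s in auto)
    then show ?thesis using uniq y by metis
  qed
  have "pmf \<pi> y = 0" if "y < n" for y
  proof -
    have "max (u y) 0 / s = pmf \<pi> y" by (rule part) (use inv s_def that in auto)
    moreover have "max (- u y) 0 / s = pmf \<pi> y"
      by (rule part[of "\<lambda>y. - u y"]) (use inv s' that in \<open>auto simp: sum_negf\<close>)
    ultimately show ?thesis using s by (auto simp: max_def divide_eq_eq split: if_splits)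
  qed
  then show False using sum_pi by simp
qed

text \<open>For eigenvalue 1 the real and imaginary parts would be real invariant vectors of sum 0,
  hence zero. So 1 is a simple eigenvalue without any assumption of irreducibility.\<close>

lemma left_eigenvector_ne_1:
  assumes uniq: "\<And>\<rho>. stationary n K \<rho> \<Longrightarrow> \<rho> = \<pi>"
    and v: "\<exists>x<n. v x \<noteq> 0" "(\<Sum>x<n. v x) = 0"
      "\<forall>y<n. (\<Sum>x<n. v x * complex_of_real (pmf (K x) y)) = l * v y"
  shows "l \<noteq> 1"
proof
  assume l: "l = 1"
  have "Re (v x) = 0" if "x < n" for x
  proof (rule invariant_sum_0[OF uniq, of "\<lambda>x. Re (v x)"])
    show "(\<Sum>x<n. Re (v x) * pmf (K x) y) = Re (v y)" if "y < n" for y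
      using arg_cong[OF v(3)[rule_format, OF that], of Re] l by simp
    show "(\<Sum>x<n. Re (v x)) = 0" using arg_cong[OF v(2), of Re] by simp
  qed (use that in auto)
  moreover have "Im (v x) = 0" if "x < n" for x
  proof (rule invariant_sum_0[OF uniq, of "\<lambda>x. Im (v x)"])
    show "(\<Sum>x<n. Im (v x) * pmf (K x) y) = Im (v y)" if "y < n" for y
      using arg_cong[OF v(3)[rule_format, OF that], of Im] l by simp
    show "(\<Sum>x<n. Im (v x)) = 0" using arg_cong[OF v(2), of Im] by simp
  qed (use that in auto)
  ultimately show False using v(1) by (auto simp: complex_eq_iff)
qed

text \<open>Dividing \<open>G 1\<close> by \<open>r\<close> turns the rate into boundedness of
  powers. A nonzero eigenvalue of the deflated matrix comes from an eigenvalue of \<open>P\<close>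
  other than 1, recovered by undoing the lazy averaging as in hypothesis \<open>ev\<close>.\<close>

lemma G_decay:
  assumes uniq: "\<And>\<rho>. stationary n K \<rho> \<Longrightarrow> \<rho> = \<pi>" and n: "0 < n" and r: "0 < r"
    and ev: "\<And>l. eigenvalue P ((1 + complex_of_real lz) * l - complex_of_real lz) \<Longrightarrow>
        (1 + complex_of_real lz) * l - complex_of_real lz \<noteq> 1 \<Longrightarrow> cmod l < r"
  shows "\<exists>c. \<forall>t. \<forall>x<n. \<forall>y<n. \<bar>G (Suc t) x y\<bar> \<le> c * r ^ Suc t"
proof -
  define B where "B = mat n n (\<lambda>(x, y). complex_of_real (G 1 x y / r))"
  have B: "B \<in> carrier_mat n n" by (simp add: B_def)
  have pow: "(B ^\<^sub>m Suc t) $$ (x, y) = complex_of_real (G (Suc t) x y / r ^ Suc t)" if "x < n" "y < n" for t x y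
    using that
  proof (induction t arbitrary: y)
    case 0
    then show ?case using B by (simp add: B_def del: lazy_pow.simps)
  next
    case (Suc t)
    have "(B ^\<^sub>m Suc (Suc t)) $$ (x, y) = (B ^\<^sub>m Suc t * B) $$ (x, y)" by simp
    also have "\<dots> = (\<Sum>k<n. (B ^\<^sub>m Suc t) $$ (x, k) * B $$ (k, y))"
      using Suc.prems B pow_carrier_mat[OF B, of "Suc t"]
      by (simp add: scalar_prod_def atLeast0LessThan del: pow_mat.simps)
    also have "\<dots> = (\<Sum>k<n. complex_of_real (G (Suc t) x k / r ^ Suc t) * complex_of_real (G 1 k y / r))"
      by (intro sum.cong refl) (use Suc in \<open>simp add: B_def del: pow_mat.simps\<close>)
    also have "\<dots> = complex_of_real ((\<Sum>k<n. G (Suc t) x k * G 1 k y) / r ^ Suc (Suc t))"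
      by (simp add: sum_divide_distrib mult.commute)
    also have "\<dots> = complex_of_real (G (Suc (Suc t)) x y / r ^ Suc (Suc t))"
      using Suc.prems by (simp only: G_add) simp
    finally show ?case .
  qed
  have "cmod l < 1" if ev_B: "eigenvalue B l" for l
  proof (cases "l = 0")
    case False
    obtain v where v: "\<exists>x<n. v x \<noteq> 0" "\<forall>y<n. (\<Sum>x<n. v x * B $$ (x, y)) = l * v y"
      using ev_B unfolding eigenvalue_iff_left[OF B] by blast
    have G: "(\<Sum>x<n. v x * complex_of_real (G 1 x y)) = complex_of_real r * l * v y" if "y < n" for y
    proof -
      have "(\<Sum>x<n. v x * complex_of_real (G 1 x y)) = complex_of_real r * (\<Sum>x<n. v x * B $$ (x, y))"
        unfolding sum_distrib_left by (intro sum.cong refl) (use that r in \<open>simp add: B_def\<close>)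
      then show ?thesis using v(2) that by simp
    qed
    \<comment> \<open>The rows of \<open>G 1\<close> sum to 0, so every vector in the image has sum
      0, and so has an eigenvector for \<open>l \<noteq> 0\<close>.\<close>
    have "complex_of_real r * l * (\<Sum>y<n. v y) = (\<Sum>y<n. \<Sum>x<n. v x * complex_of_real (G 1 x y))"
      by (simp only: sum_distrib_left, intro sum.cong refl, rule G[symmetric], simp)
    also have "\<dots> = (\<Sum>x<n. v x * complex_of_real (\<Sum>y<n. G 1 x y))"
      by (subst sum.swap) (simp add: sum_distrib_left)
    also have "\<dots> = 0"
      by (simp add: G_def sum_subtractf sum_pi L_sum[of _ 1, unfolded One_nat_def] del: lazy_pow.simps)
    finally have sum0: "(\<Sum>y<n. v y) = 0" using False r by simp
    \<comment> \<open>This inverts the passage from an eigenvalue of \<open>P\<close> to that of the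
      lazy matrix; the rank-one correction disappears because \<open>v\<close> has sum 0.\<close>
    define l' where "l' = (1 + complex_of_real lz) * (complex_of_real r * l) - complex_of_real lz"
    have K: "(\<Sum>x<n. v x * complex_of_real (pmf (K x) y)) = l' * v y" if y: "y < n" for y
    proof -
      have "pmf (K x) y = (1 + lz) * (G 1 x y + pmf \<pi> y) - lz * (if x = y then 1 else 0)" if "x < n" for x
        using L_1[OF that, of y] lz by (simp add: G_def field_simps del: lazy_pow.simps)
      then have "(\<Sum>x<n. v x * complex_of_real (pmf (K x) y)) =
         (\<Sum>x<n. v x * complex_of_real ((1 + lz) * (G 1 x y + pmf \<pi> y) - lz * (if x = y then 1 else 0)))"
        by (intro sum.cong) auto
      also have "\<dots> = (\<Sum>x<n. (1 + complex_of_real lz) * (v x * complex_of_real (G 1 x y))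
           + (1 + complex_of_real lz) * complex_of_real (pmf \<pi> y) * v x - complex_of_real lz * (if x = y then v x else 0))"
        by (intro sum.cong refl) (simp add: algebra_simps)
      also have "\<dots> = (1 + complex_of_real lz) * (\<Sum>x<n. v x * complex_of_real (G 1 x y))
          + (1 + complex_of_real lz) * complex_of_real (pmf \<pi> y) * (\<Sum>x<n. v x) - complex_of_real lz * (\<Sum>x<n. if x = y then v x else 0)"
        by (simp only: sum.distrib sum_subtractf sum_distrib_left)
      also have "(\<Sum>x<n. if x = y then v x else 0) = v y" using y by (simp add: sum.delta)
      finally show ?thesis unfolding G[OF y] sum0 l'_def by (simp add: algebra_simps)
    qed
    have "eigenvalue P l'"
      unfolding eigenvalue_iff_left[OF P_carrier] using v(1) K by (intro exI[of _ v]) (auto simp: P_index)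
    moreover have "l' \<noteq> 1" using left_eigenvector_ne_1[OF uniq v(1) sum0, of l'] K by blast
    ultimately have "cmod (complex_of_real r * l) < r" unfolding l'_def by (rule ev)
    then show ?thesis using r by (simp add: norm_mult)
  qed simp
  from pow_bounded_of_eigenvalues[OF B n this]
  obtain c where c: "\<And>k x y. x < n \<Longrightarrow> y < n \<Longrightarrow> cmod ((B ^\<^sub>m k) $$ (x, y)) \<le> c" by blast
  have "\<bar>G (Suc t) x y\<bar> \<le> c * r ^ Suc t" if "x < n" "y < n" for t x y
  proof -
    have "\<bar>G (Suc t) x y / r ^ Suc t\<bar> \<le> c" using c[OF that, of "Suc t"] unfolding pow[OF that] norm_of_real .
    then show ?thesis using r by (simp add: abs_div pos_divide_le_eq)
  qed
  then show ?thesis by blast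
qed

end

context lazy_stationary
begin

text \<open>\<open>R\<close> is the action of \<open>P\<close> on row vectors of sum 0 in the basis \<open>e\<^sub>i - e\<^sub>0\<close>.\<close>

lemma ex_eigenvalue_ne_1:
  assumes uniq: "\<And>\<rho>. stationary n K \<rho> \<Longrightarrow> \<rho> = \<pi>" and n: "2 \<le> n"
  shows "\<exists>l. eigenvalue P l \<and> l \<noteq> 1"
proof -
  obtain m where m: "n = Suc m" "0 < m" using n by (cases n) auto
  define R where "R = mat m m (\<lambda>(i, j). complex_of_real (pmf (K (Suc i)) (Suc j) - pmf (K 0) (Suc j)))"
  have R: "R \<in> carrier_mat m m" by (simp add: R_def)
  from spectrum_non_empty[OF R] m(2) obtain l where "eigenvalue R l" by (auto simp: spectrum_def)
  then obtain v where v: "\<exists>i<m. v i \<noteq> 0" "\<forall>j<m. (\<Sum>i<m. v i * R $$ (i, j)) = l * v j"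
    unfolding eigenvalue_iff_left[OF R] by blast
  define w where "w = (\<lambda>x. case x of 0 \<Rightarrow> - (\<Sum>i<m. v i) | Suc i \<Rightarrow> v i)"
  have sum_w: "(\<Sum>x<n. w x) = 0" unfolding m sum.lessThan_Suc_shift by (simp add: w_def)
  have wS: "(\<Sum>x<n. w x * complex_of_real (pmf (K x) (Suc j))) = l * w (Suc j)" if "j < m" for j
  proof -
    have "(\<Sum>x<n. w x * complex_of_real (pmf (K x) (Suc j))) =
        (\<Sum>i<m. v i * complex_of_real (pmf (K (Suc i)) (Suc j))) - (\<Sum>i<m. v i) * complex_of_real (pmf (K 0) (Suc j))"
      unfolding m sum.lessThan_Suc_shift by (simp add: w_def)
    also have "\<dots> = (\<Sum>i<m. v i * R $$ (i, j))"
      using that by (simp add: R_def right_diff_distrib sum_subtractf sum_distrib_right)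
    finally show ?thesis using v(2) that by (simp add: w_def)
  qed
  have row: "(\<Sum>y<n. complex_of_real (pmf (K x) y)) = 1" if "x < n" for x
    using sum_row[OF that] by (metis of_real_1 of_real_sum)
  \<comment> \<open>Column 0 is not among the equations of \<open>R\<close>. It follows from the
    others because both \<open>w P\<close> and \<open>l w\<close> have coordinate sum 0.\<close>
  define h where "h = (\<lambda>y. \<Sum>x<n. w x * complex_of_real (pmf (K x) y))"
  have "(\<Sum>y<n. h y) = (\<Sum>x<n. w x)"
    unfolding h_def by (subst sum.swap) (simp add: row flip: sum_distrib_left)
  then have "h 0 + (\<Sum>j<m. h (Suc j)) = 0"
    unfolding sum_w unfolding m(1) sum.lessThan_Suc_shift .
  also have "(\<Sum>j<m. h (Suc j)) = (\<Sum>j<m. l * v j)"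
    using wS by (simp add: h_def w_def)
  finally have w0: "(\<Sum>x<n. w x * complex_of_real (pmf (K x) 0)) = l * w 0"
    by (simp add: h_def w_def sum_distrib_left eq_neg_iff_add_eq_0)
  have w: "\<forall>y<n. (\<Sum>x<n. w x * complex_of_real (pmf (K x) y)) = l * w y"
  proof (intro allI impI)
    fix y assume "y < n"
    then show "(\<Sum>x<n. w x * complex_of_real (pmf (K x) y)) = l * w y"
      using w0 wS[of "y - 1"] m(1) by (cases y) auto
  qed
  have nz: "\<exists>x<n. w x \<noteq> 0"
  proof -
    obtain i where "i < m" "v i \<noteq> 0" using v(1) by blast
    then show ?thesis by (intro exI[of _ "Suc i"]) (simp add: m w_def)
  qed
  have "eigenvalue P l"
    unfolding eigenvalue_iff_left[OF P_carrier] using nz w by (intro exI[of _ w]) (auto simp: P_index)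
  moreover have "l \<noteq> 1" by (rule left_eigenvector_ne_1[OF uniq nz sum_w w])
  ultimately show ?thesis by blast
qed

text \<open>For \<open>n \<ge> 2\<close> the minimum ranges over a nonempty finite set. Nonemptiness
  gives a gap of at most 1, so that 1 - \<gamma> is a nonnegative rate.\<close>

lemma abs_spectral_gap_le:
  assumes uniq: "\<And>\<rho>. stationary n K \<rho> \<Longrightarrow> \<rho> = \<pi>" and n: "2 \<le> n"
  shows "eigenvalue P l \<Longrightarrow> l \<noteq> 1 \<Longrightarrow> cmod l \<le> 1 - abs_spectral_gap n K" "abs_spectral_gap n K \<le> 1"
proof -
  let ?S = "{1 - cmod l | l. eigenvalue P l \<and> l \<noteq> 1}"
  have fin: "finite ?S"
  proof (rule finite_subset)
    show "?S \<subseteq> (\<lambda>l. 1 - cmod l) ` spectrum P" by (auto simp: spectrum_def)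
    show "finite ((\<lambda>l. 1 - cmod l) ` spectrum P)" using card_finite_spectrum[OF P_carrier] by auto
  qed
  have le: "abs_spectral_gap n K \<le> z" if "z \<in> ?S" for z
    unfolding abs_spectral_gap_def P_def[symmetric] using fin that by (rule Min_le)
  show "cmod l \<le> 1 - abs_spectral_gap n K" if "eigenvalue P l" "l \<noteq> 1" for l
  proof -
    have "1 - cmod l \<in> ?S" using that by blast
    from le[OF this] show ?thesis by simp
  qed
  obtain l where "eigenvalue P l" "l \<noteq> 1" using ex_eigenvalue_ne_1[OF uniq n] by blast
  then have "abs_spectral_gap n K \<le> 1 - cmod l" by (intro le) auto
  then show "abs_spectral_gap n K \<le> 1" by (smt (verit) norm_ge_zero)
qed

section \<open>Reversible chains: from the spectrum to a relative pointwise rate\<close>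

lemma reversible_G:
  assumes rev: "reversible n K \<pi>" and x: "x < n" and z: "z < n"
  shows "pmf \<pi> x * G 1 x z = pmf \<pi> z * G 1 z x"
proof -
  have "pmf \<pi> x * pmf (K x) z = pmf \<pi> z * pmf (K z) x" using rev x z by (simp add: reversible_def)
  then show ?thesis
    unfolding G_def L_1[OF x] L_1[OF z] by (simp add: right_diff_distrib distrib_left mult.commute)
qed

text \<open>
  By reversibility \<open>G 1\<close> is self-adjoint for the inner product weighted by \<open>\<pi>\<close>, so the squared norms
  \<open>a t\<close> of the columns of its powers are log-convex: the spectral radius, which a priori governs only
  their asymptotic growth, bounds every single step.
\<close>

lemma reversible_G_sq_le:
  assumes rev: "reversible n K \<pi>" and \<rho>: "0 \<le> \<rho>"
    and decay: "\<And>r. \<rho> < r \<Longrightarrow> \<exists>c. \<forall>t. \<forall>x<n. \<forall>y<n. \<bar>G (Suc t) x y\<bar> \<le> c * r ^ Suc t"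
    and y: "y < n"
  shows "(\<Sum>x<n. pmf \<pi> x * G (Suc t) x y ^ 2) \<le> \<rho> ^ (2 * Suc t) * pmf \<pi> y"
proof -
  \<comment> \<open>At 0 the squared norm of column \<open>y\<close> of the identity is used, not of
    \<open>G 0\<close>; its weighted value is \<open>pmf \<pi> y\<close>.\<close>
  define a where "a = (\<lambda>t. if t = 0 then pmf \<pi> y else \<Sum>x<n. pmf \<pi> x * G t x y ^ 2)"
  have shift: "(\<Sum>x<n. pmf \<pi> x * G (Suc s) x y * G t x y) = (\<Sum>x<n. pmf \<pi> x * G s x y * G (Suc t) x y)" for s t
  proof -
    have "(\<Sum>x<n. pmf \<pi> x * G (Suc s) x y * G t x y) = (\<Sum>x<n. \<Sum>z<n. pmf \<pi> x * G 1 x z * G s z y * G t x y)"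
      using y by (intro sum.cong refl) (simp add: sum_distrib_left sum_distrib_right mult.assoc
          G_add[of _ y 1 s, symmetric, unfolded plus_1_eq_Suc] del: One_nat_def)
    also have "\<dots> = (\<Sum>z<n. \<Sum>x<n. pmf \<pi> z * G s z y * (G 1 z x * G t x y))"
    proof (subst sum.swap, intro sum.cong refl)
      fix z x assume "z \<in> {..<n}" "x \<in> {..<n}"
      then have "pmf \<pi> x * G 1 x z = pmf \<pi> z * G 1 z x" by (intro reversible_G[OF rev]) auto
      then show "pmf \<pi> x * G 1 x z * G s z y * G t x y = pmf \<pi> z * G s z y * (G 1 z x * G t x y)"
        by (simp add: mult_ac)
    qed
    also have "\<dots> = (\<Sum>z<n. pmf \<pi> z * G s z y * G (Suc t) z y)"
      using y by (intro sum.cong refl) (simp add: G_add[of _ y 1 t, symmetric, unfolded plus_1_eq_Suc]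
          flip: sum_distrib_left del: One_nat_def)
    finally show ?thesis .
  qed
  have nonneg: "0 \<le> a k" for k by (auto simp: a_def intro!: sum_nonneg)
  have convex: "a (Suc k) ^ 2 \<le> a k * a (Suc (Suc k))" for k
  proof (cases k)
    case 0
    \<comment> \<open>The value \<open>a 0\<close> does not come from \<open>G\<close>, so this case
      is separate: reversibility turns \<open>a 1\<close> into a diagonal entry of
      \<open>G 2\<close>, and a single term of \<open>a 2\<close> suffices.\<close>
    have "a 1 = (\<Sum>x<n. pmf \<pi> y * G 1 y x * G 1 x y)"
      unfolding a_def using y reversible_G[OF rev _ y] by (auto simp: power2_eq_square mult.assoc[symmetric] intro!: sum.cong)
    also have "\<dots> = pmf \<pi> y * G 2 y y"
      using G_add[OF y y, of 1 1] by (simp add: mult.assoc numeral_2_eq_2 flip: sum_distrib_left)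
    finally have "a 1 ^ 2 = pmf \<pi> y * (pmf \<pi> y * G 2 y y ^ 2)" by (simp add: power2_eq_square)
    also have "pmf \<pi> y * G 2 y y ^ 2 \<le> a 2"
      unfolding a_def using y by (simp, intro member_le_sum[of y "{..<n}" "\<lambda>x. pmf \<pi> x * G 2 x y ^ 2"]) auto
    finally show ?thesis using 0 by (simp add: a_def numeral_2_eq_2 mult_left_mono)
  next
    case (Suc j)
    have "a (Suc k) = (\<Sum>x<n. pmf \<pi> x * G (Suc k) x y * G (Suc k) x y)"
      by (simp add: a_def power2_eq_square mult.assoc)
    also have "\<dots> = (\<Sum>x<n. pmf \<pi> x * G k x y * G (Suc (Suc k)) x y)" by (rule shift)
    \<comment> \<open>Now \<open>a (Suc k)\<close> is an inner product of the columns at times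
      \<open>k\<close> and \<open>k + 2\<close>; splitting the weight into square roots prepares
      Cauchy-Schwarz.\<close>
    also have "\<dots> = (\<Sum>x<n. (sqrt (pmf \<pi> x) * G k x y) * (sqrt (pmf \<pi> x) * G (Suc (Suc k)) x y))"
    proof (intro sum.cong refl)
      fix x
      have "(r * a) * (r * b) = (r * r) * a * b" for r a b :: real by (simp only: mult_ac)
      then show "pmf \<pi> x * G k x y * G (Suc (Suc k)) x y
         = (sqrt (pmf \<pi> x) * G k x y) * (sqrt (pmf \<pi> x) * G (Suc (Suc k)) x y)" by simp
    qed
    finally have eq: "a (Suc k) = (\<Sum>x<n. (sqrt (pmf \<pi> x) * G k x y) * (sqrt (pmf \<pi> x) * G (Suc (Suc k)) x y))" .
    have "a (Suc k) ^ 2 \<le> (\<Sum>x<n. (sqrt (pmf \<pi> x) * G k x y) ^ 2) * (\<Sum>x<n. (sqrt (pmf \<pi> x) * G (Suc (Suc k)) x y) ^ 2)"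
      unfolding eq by (rule Cauchy_Schwarz_ineq_sum)
    also have "\<dots> = a k * a (Suc (Suc k))"
    proof -
      have "(\<Sum>x<n. (sqrt (pmf \<pi> x) * G i x y) ^ 2) = a i" if "i \<noteq> 0" for i
        unfolding a_def power_mult_distrib using that by (simp only: if_False real_sqrt_pow2 pmf_nonneg)
      then show ?thesis using Suc by (simp only: nat.distinct not_False_eq_True)
    qed
    finally show ?thesis .
  qed
  \<comment> \<open>Decay is known only for rates above \<rho>, so each \<open>q\<close> above
    \<rho>^2 is treated first and then the limit is taken. This also covers \<rho> = 0, where
    \<open>log_convex_le\<close> does not apply directly.\<close>
  have step: "a (Suc k) \<le> \<rho> ^ 2 * a k" for k
  proof (rule LIMSEQ_le_const)
    have "(\<lambda>i. (\<rho> ^ 2 + inverse (real (Suc i))) * a k) \<longlonglongrightarrow> (\<rho> ^ 2 + 0) * a k"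
      by (intro tendsto_intros LIMSEQ_inverse_real_of_nat)
    then show "(\<lambda>i. (\<rho> ^ 2 + inverse (real (Suc i))) * a k) \<longlonglongrightarrow> \<rho> ^ 2 * a k" by simp
    have "a (Suc k) \<le> q * a k" if q: "\<rho> ^ 2 < q" for q
    proof -
      have q0: "0 < q" using q by (meson le_less_trans zero_le_power2)
      have "\<rho> < sqrt q" using q by (simp add: real_less_rsqrt)
      then obtain c where c: "\<And>t x. x < n \<Longrightarrow> \<bar>G (Suc t) x y\<bar> \<le> c * sqrt q ^ Suc t" using decay y by blast
      have "a k \<le> max 1 (c ^ 2) * q ^ k" for k
      proof (cases k)
        case 0
        then show ?thesis using pmf_le_1[of \<pi> y] by (simp add: a_def max_def)
      next
        case (Suc t)
        have "a k = (\<Sum>x<n. pmf \<pi> x * G (Suc t) x y ^ 2)" by (simp add: a_def Suc)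
        also have "\<dots> \<le> (\<Sum>x<n. pmf \<pi> x * (c ^ 2 * q ^ k))"
        proof (intro sum_mono mult_left_mono)
          fix x assume "x \<in> {..<n}"
          then have "\<bar>G (Suc t) x y\<bar> ^ 2 \<le> (c * sqrt q ^ Suc t) ^ 2" by (intro power_mono c) auto
          also have "\<dots> = c ^ 2 * (sqrt q ^ 2) ^ Suc t" by (simp only: power_mult_distrib power_mult[symmetric] mult.commute)
          finally show "G (Suc t) x y ^ 2 \<le> c ^ 2 * q ^ k" using q0 Suc by simp
        qed auto
        also have "\<dots> = c ^ 2 * q ^ k" by (simp add: sum_pi flip: sum_distrib_right)
        also have "\<dots> \<le> max 1 (c ^ 2) * q ^ k" using q0 by (intro mult_right_mono) auto
        finally show ?thesis .
      qed
      from log_convex_le[OF nonneg convex this q0] show ?thesis .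
    qed
    then show "\<exists>N. \<forall>i\<ge>N. a (Suc k) \<le> (\<rho> ^ 2 + inverse (real (Suc i))) * a k" by simp
  qed
  have "a k \<le> (\<rho> ^ 2) ^ k * a 0" for k
  proof (induction k)
    case (Suc k)
    have "a (Suc k) \<le> \<rho> ^ 2 * a k" by (rule step)
    also have "\<dots> \<le> \<rho> ^ 2 * ((\<rho> ^ 2) ^ k * a 0)" using Suc by (intro mult_left_mono) auto
    finally show ?case by (simp add: mult.assoc)
  qed simp
  from this[of "Suc t"] show ?thesis unfolding a_def power_mult by simp
qed

text \<open>One term of the weighted norm yields |G t x y| \<le> \<rho>^t \<pi>(y) / sqrt (\<pi>(x)
  \<pi>(y)), and both atoms are at least \<open>p\<close>. Time 0 is checked directly.\<close>

lemma reversible_rate: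
  assumes rev: "reversible n K \<pi>" and \<rho>: "0 \<le> \<rho>" "\<rho> \<le> 1"
    and decay: "\<And>r. \<rho> < r \<Longrightarrow> \<exists>c. \<forall>t. \<forall>x<n. \<forall>y<n. \<bar>G (Suc t) x y\<bar> \<le> c * r ^ Suc t"
    and xy: "x < n" "y < n" and p: "0 < p" "p \<le> pmf \<pi> x" "p \<le> pmf \<pi> y"
  shows "\<bar>G t x y\<bar> \<le> \<rho> ^ t / p * pmf \<pi> y"
proof (cases t)
  case 0
  have "\<bar>G 0 x y\<bar> \<le> 1" using pmf_le_1[of \<pi> y] pmf_nonneg[of \<pi> y] by (simp add: G_def)
  also have "1 \<le> pmf \<pi> y / p" using p by simp
  finally show ?thesis using 0 by simp
next
  case (Suc s)
  have "pmf \<pi> x * G t x y ^ 2 \<le> (\<Sum>x<n. pmf \<pi> x * G t x y ^ 2)"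
    using xy by (intro member_le_sum[of x "{..<n}" "\<lambda>x. pmf \<pi> x * G t x y ^ 2"]) auto
  also have "\<dots> \<le> \<rho> ^ (2 * t) * pmf \<pi> y"
    unfolding Suc by (rule reversible_G_sq_le[OF rev \<rho>(1) decay xy(2)])
  finally have le: "pmf \<pi> x * G t x y ^ 2 \<le> \<rho> ^ (2 * t) * pmf \<pi> y" .
  have "p * (p * G t x y ^ 2) \<le> p * (pmf \<pi> x * G t x y ^ 2)"
    using p by (intro mult_left_mono mult_right_mono) auto
  also have "\<dots> \<le> pmf \<pi> y * (\<rho> ^ (2 * t) * pmf \<pi> y)"
    by (rule mult_mono[OF p(3) le]) (use p in auto)
  finally have "(p * \<bar>G t x y\<bar>) ^ 2 \<le> (\<rho> ^ t * pmf \<pi> y) ^ 2"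
    unfolding mult_2 power_add by (simp add: power2_eq_square mult_ac)
  then have "p * \<bar>G t x y\<bar> \<le> \<rho> ^ t * pmf \<pi> y"
    using \<rho> by (intro power2_le_imp_le[of "p * \<bar>G t x y\<bar>"]) auto
  then show ?thesis using p by (simp add: field_simps)
qed

section \<open>Halving of the L1 distance in blocks of the mixing time\<close>

lemma L1_contraction:
  assumes T: "\<And>x. x < n \<Longrightarrow> (\<Sum>y<n. \<bar>G T x y\<bar>) \<le> c" and x: "x < n"
  shows "(\<Sum>y<n. \<bar>G (t + T) x y\<bar>) \<le> (\<Sum>y<n. \<bar>G t x y\<bar>) * c"
proof -
  have "(\<Sum>y<n. \<bar>G (t + T) x y\<bar>) \<le> (\<Sum>y<n. \<Sum>k<n. \<bar>G t x k\<bar> * \<bar>G T k y\<bar>)"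
  proof (rule sum_mono)
    fix y assume "y \<in> {..<n}"
    then have "\<bar>G (t + T) x y\<bar> = \<bar>\<Sum>k<n. G t x k * G T k y\<bar>" using x by (simp add: G_add)
    also have "\<dots> \<le> (\<Sum>k<n. \<bar>G t x k * G T k y\<bar>)" by (rule sum_abs)
    finally show "\<bar>G (t + T) x y\<bar> \<le> (\<Sum>k<n. \<bar>G t x k\<bar> * \<bar>G T k y\<bar>)" by (simp add: abs_mult)
  qed
  also have "\<dots> = (\<Sum>k<n. \<bar>G t x k\<bar> * (\<Sum>y<n. \<bar>G T k y\<bar>))"
    by (subst sum.swap) (simp add: sum_distrib_left)
  also have "\<dots> \<le> (\<Sum>k<n. \<bar>G t x k\<bar> * c)" by (intro sum_mono mult_left_mono T) auto
  finally show ?thesis by (simp add: sum_distrib_right)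
qed

lemma L1_dist_le_2: "x < n \<Longrightarrow> (\<Sum>y<n. \<bar>G t x y\<bar>) \<le> 2"
proof -
  assume x: "x < n"
  have "(\<Sum>y<n. \<bar>G t x y\<bar>) \<le> (\<Sum>y<n. L t x y + pmf \<pi> y)"
    using L_nonneg[of t x] pmf_nonneg[of \<pi>] unfolding G_def by (intro sum_mono) (smt (verit))
  then show ?thesis using x by (simp add: sum.distrib L_sum sum_pi)
qed

text \<open>The L1 distance is twice total variation, so distance 1/4 gives contraction by 1/2 per
  block. The contraction averages over all rows of \<open>G T\<close>, which is why every start
  state must be controlled.\<close>

lemma L1_dist_halving:
  assumes T: "\<And>x. x < n \<Longrightarrow> (\<Sum>y<n. \<bar>G T x y\<bar>) \<le> 1 / 2" and x: "x < n" and t: "k * T \<le> t"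
  shows "(\<Sum>y<n. \<bar>G t x y\<bar>) \<le> 2 * (1 / 2) ^ k"
  using t
proof (induction k arbitrary: t)
  case 0
  then show ?case using L1_dist_le_2[OF x] by simp
next
  case (Suc k)
  then obtain s where s: "t = s + T" "k * T \<le> s" using le_Suc_ex[OF Suc.prems] by (auto simp: add_ac)
  have "(\<Sum>y<n. \<bar>G t x y\<bar>) \<le> (\<Sum>y<n. \<bar>G s x y\<bar>) * (1 / 2)" unfolding s(1) by (rule L1_contraction[OF T x])
  also have "\<dots> \<le> 2 * (1 / 2) ^ k * (1 / 2)" using Suc.IH[OF s(2)] by (intro mult_right_mono) auto
  finally show ?case by simp
qed

end

section \<open>Exact output from pointwise domination\<close>

lemma spmf_eq_of_pmf_le:
  assumes "\<And>y. pmf \<pi> y \<le> spmf q y"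
  shows "q = spmf_of_pmf \<pi>"
proof (rule spmf_eqI)
  fix y
  have ord: "1 \<le> weight_spmf q"
  proof -
    have "ennreal 1 = (\<integral>\<^sup>+ y. pmf \<pi> y \<partial>count_space UNIV)" by (simp add: nn_integral_pmf_eq_1)
    also have "\<dots> \<le> (\<integral>\<^sup>+ y. spmf q y \<partial>count_space UNIV)"
      using assms by (intro nn_integral_mono ennreal_leI)
    also have "\<dots> = ennreal (weight_spmf q)" by (simp add: weight_spmf_eq_nn_integral_spmf)
    finally show ?thesis by (simp add: ennreal_le_iff)
  qed
  have fin: "(\<integral>\<^sup>+ y. pmf \<pi> y \<partial>count_space UNIV) \<noteq> \<infinity>" by (simp add: nn_integral_pmf_eq_1)
  have "(\<integral>\<^sup>+ y. ennreal (spmf q y) - ennreal (pmf \<pi> y) \<partial>count_space UNIV)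
     = (\<integral>\<^sup>+ y. spmf q y \<partial>count_space UNIV) - (\<integral>\<^sup>+ y. pmf \<pi> y \<partial>count_space UNIV)"
    using fin assms by (intro nn_integral_diff) (auto simp: AE_count_space ennreal_leI)
  also have "\<dots> = 0"
    using weight_spmf_le_1[of q] ord by (simp add: nn_integral_pmf_eq_1 weight_spmf_eq_nn_integral_spmf[symmetric] ennreal_minus_eq_0)
  finally have "ennreal (spmf q y) - ennreal (pmf \<pi> y) = 0"
    by (subst (asm) nn_integral_0_iff_AE) (auto simp: AE_count_space)
  then have "spmf q y \<le> pmf \<pi> y" by (simp add: ennreal_minus ennreal_eq_0_iff)
  then show "spmf q y = spmf (spmf_of_pmf \<pi>) y" using assms[of y] by simp
qed

lemma perfect_samplerI:
  assumes supp: "set_pmf \<pi> \<subseteq> {..<n}"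
    and ge: "\<And>y. y < n \<Longrightarrow> ennreal (pmf \<pi> y) \<le> (\<integral>\<^sup>+ x. indicator {y} (nvars x ''out'') \<partial>measure_spmf (exec M A s))"
  shows "perfect_sampler M A s \<pi>"
proof -
  let ?q = "map_spmf (\<lambda>s'. nvars s' ''out'') (exec M A s)"
  have "pmf \<pi> y \<le> spmf ?q y" for y
  proof (cases "y < n")
    case True
    have ind: "(\<lambda>x. indicator {y} (nvars x ''out'') :: ennreal) = indicator ((\<lambda>s'. nvars s' ''out'') -` {y})"
      by (auto simp: indicator_def fun_eq_iff)
    have "ennreal (pmf \<pi> y) \<le> ennreal (spmf ?q y)"
      using ge[OF True] unfolding ind ennreal_spmf_map_conv_nn_integral .
    then show ?thesis by simp
  next
    case False
    then have "y \<notin> set_pmf \<pi>" using supp by auto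
    then show ?thesis by (simp add: set_pmf_iff)
  qed
  then have q: "?q = spmf_of_pmf \<pi>" by (rule spmf_eq_of_pmf_le)
  have "lossless_spmf ?q" unfolding q by simp
  then have "lossless_spmf (exec M A s)" by (simp only: lossless_map_spmf)
  then show ?thesis using q unfolding perfect_sampler_def by (intro conjI)
qed

section \<open>The two samplers\<close>

text \<open>The midpoint between 1 and another point of the closed unit disc lies strictly inside,
  by strict convexity. Laziness thereby removes periodicity.\<close>

lemma cmod_lazy_less_1:
  assumes "cmod l \<le> 1" "l \<noteq> 1"
  shows "cmod ((1 + l) / 2) < 1"
proof -
  have sq: "Re l ^ 2 + Im l ^ 2 \<le> 1" using assms(1) by (simp add: cmod_def)
  have "Re l < 1"
  proof (rule ccontr)
    assume "\<not> Re l < 1"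
    then have "1 \<le> Re l ^ 2" by (simp add: one_le_power)
    then have "Im l ^ 2 \<le> 0" using sq by linarith
    then have "Im l = 0" by simp
    moreover have "Re l \<le> 1" using complex_Re_le_cmod[of l] assms(1) by linarith
    ultimately show False using \<open>\<not> Re l < 1\<close> assms(2) by (simp add: complex_eq_iff)
  qed
  then have "(1 + Re l) ^ 2 + Im l ^ 2 < 4" using sq by (simp add: power2_sum)
  then have "cmod (1 + l) < sqrt 4" unfolding cmod_def by (subst real_sqrt_less_iff) simp
  then show ?thesis by (simp add: norm_divide)
qed

context lazy_stationary
begin

lemma lazy_tendsto:
  assumes uniq: "\<And>\<rho>. stationary n K \<rho> \<Longrightarrow> \<rho> = \<pi>" and lz1: "lz = 1" and xy: "x < n" "y < n"
  shows "(\<lambda>t. L t x y) \<longlonglongrightarrow> pmf \<pi> y"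
proof -
  have n: "0 < n" using xy by simp
  let ?E = "(\<lambda>l. cmod ((1 + l) / 2)) ` {l \<in> spectrum P. l \<noteq> 1}"
  have fin: "finite ?E" using card_finite_spectrum[OF P_carrier] by auto
  have lt: "e < 1" if "e \<in> ?E" for e
    using that eigenvalue_P_le_1 cmod_lazy_less_1 by (auto simp: spectrum_def)
  \<comment> \<open>Finitely many eigenvalues give a uniform bound below 1; inserting 0 covers an
    empty set of eigenvalues other than 1.\<close>
  define m where "m = Max (insert 0 ?E)"
  have m: "0 \<le> m" "m < 1" "\<And>e. e \<in> ?E \<Longrightarrow> e \<le> m"
    unfolding m_def using fin lt by auto
  define r where "r = (m + 1) / 2"
  have r: "0 < r" "r < 1" "m < r" using m by (auto simp: r_def)
  have "\<exists>c. \<forall>t. \<forall>x<n. \<forall>y<n. \<bar>G (Suc t) x y\<bar> \<le> c * r ^ Suc t"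
  proof (rule G_decay[OF uniq n r(1)])
    fix l assume l: "eigenvalue P ((1 + complex_of_real lz) * l - complex_of_real lz)"
      "(1 + complex_of_real lz) * l - complex_of_real lz \<noteq> 1"
    define l' where "l' = 2 * l - 1"
    have "l' \<in> {l \<in> spectrum P. l \<noteq> 1}" using l by (simp add: lz1 l'_def spectrum_def)
    then have "cmod ((1 + l') / 2) \<le> m" by (intro m(3)) (rule imageI)
    then show "cmod l < r" using r(3) by (simp add: l'_def)
  qed
  then obtain c where c: "\<And>t. \<bar>G (Suc t) x y\<bar> \<le> c * r ^ Suc t" using xy by blast
  have "(\<lambda>t. c * r ^ Suc t) \<longlonglongrightarrow> c * 0"
    using r by (intro tendsto_intros LIMSEQ_Suc[OF LIMSEQ_power_zero]) auto
  then have "(\<lambda>t. G (Suc t) x y) \<longlonglongrightarrow> 0"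
    using c by (intro Lim_null_comparison[of "\<lambda>t. G (Suc t) x y" "\<lambda>t. c * r ^ Suc t"]) (auto simp: real_norm_def)
  then have "(\<lambda>t. G (Suc t) x y + pmf \<pi> y) \<longlonglongrightarrow> 0 + pmf \<pi> y" by (intro tendsto_intros)
  then have "(\<lambda>t. L (Suc t) x y) \<longlonglongrightarrow> pmf \<pi> y" by (simp add: G_def del: lazy_pow.simps)
  then show ?thesis by (rule LIMSEQ_imp_Suc)
qed

end

lemma lazy_core_ge:
  assumes kernel: "chain_kernel (num_states M) (trans_kernel M) 1" and x0: "x0 < num_states M" and y: "y < num_states M"
    and lim: "\<And>x. x < num_states M \<Longrightarrow> (\<lambda>t. lazy_pow (trans_kernel M) (num_states M) 1 t x y) \<longlonglongrightarrow> pmf \<pi> y"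
    and s: "nvars s ''n'' = num_states M" "nvars s ''start'' = x0" "nvars s ''t0'' = 0"
      "arrays s ''lz'' 0 0 = 1" "arrays s ''eps'' 0 0 = 1" "\<forall>i j. arrays s ''X'' i j = 0"
  shows "ennreal (pmf \<pi> y) \<le> (\<integral>\<^sup>+ x. indicator {y} (nvars x ''out'') \<partial>measure_spmf (exec M core s))" (is "_ \<le> ?I")
proof -
  interpret chain_kernel "num_states M" "trans_kernel M" 1 by fact
  let ?n = "num_states M"
  interpret run: sampler_run M ?n x0 0 1 1 by unfold_locales simp
  have flag: "run.flag x" for x using L_nonneg[of 0 x0 x] by (simp add: run.flag_def)
  interpret run: good_sampler_run M ?n x0 0 1 1
  proof unfold_locales
    show "(\<Sum>z<?n. L 0 x0 z) = 1" using x0 by (rule L_sum)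
    fix j
    show "(\<Sum>z<?n. run.level j z) \<le> 1"
    proof (cases j)
      case (Suc i)
      have "(\<Sum>z<?n. run.level (Suc i) z) \<le> (\<Sum>z<?n. L (0 + i) x0 z)"
        unfolding run.level.simps using x0 flag by (intro sum_mono flagged_min_le)
      then show ?thesis using Suc L_sum[OF x0] by simp
    qed simp
    fix z assume z: "z < ?n"
    show "run.level j z \<le> run.level (Suc j) z"
    proof (cases j)
      case 0
      then show ?thesis by (simp, intro flagged_min_ge) (auto simp: L_nonneg)
    next
      case (Suc i)
      then show ?thesis
        using flagged_min_mono_step[OF kernel _ z, of run.flag i] flag by simp
    qed
  qed (use x0 in auto)
  have ready: "run.ready s" using s by (simp add: run.ready_def)
  have lev: "ennreal (run.level J y) \<le> ?I" for J by (rule run.core_ge[OF ready y])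
  show ?thesis
  proof (cases ?I)
    case (real c)
    have c: "run.level J y \<le> c" for J using lev[of J] real by (simp add: ennreal_le_iff)
    have "pmf \<pi> y \<le> c + e" if e: "0 < e" for e
    proof -
      \<comment> \<open>Finitely many rows allow one time \<open>t\<close> that works for all of
        them, hence for their minimum.\<close>
      have "\<forall>\<^sub>F t in sequentially. \<forall>x\<in>{..<?n}. pmf \<pi> y - e < L t x y"
        using lim e by (intro eventually_ball_finite) (auto intro!: order_tendstoD)
      then obtain t where t: "\<And>x. x < ?n \<Longrightarrow> pmf \<pi> y - e < L t x y"
        unfolding eventually_sequentially by auto
      have "pmf \<pi> y - e \<le> run.level (Suc t) y"
        unfolding run.level.simps
      proof (rule flagged_min_ge)
        show "pmf \<pi> y - e \<le> 1" using e pmf_le_1[of \<pi> y] by linarith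
      qed (use t in \<open>auto intro: less_imp_le\<close>)
      then show ?thesis using c[of "Suc t"] by linarith
    qed
    then have "pmf \<pi> y \<le> c" by (rule field_le_epsilon)
    then show ?thesis using real by (simp add: ennreal_leI)
  qed simp
qed

text \<open>With a single state the answer 0 is already the initial value of \<open>out\<close>.
  There ln (n / pi_min) is 0, so this case has its own time bound.\<close>

definition mixing_sampler :: com where
  "mixing_sampler = Cond (NLess (NVar ''n'') (NConst 2)) Skip
     (Seq (SetScal ''rho'' (RDivide (OfNat (NConst 1)) (OfNat (NConst 2)))) (Seq setup_rate core))"

text \<open>
  For \<open>gap \<le> 0\<close> the chain may be periodic and no rate is available; the lazy chain still converges,
  and setting \<open>eps\<close> to 1 skips the simulation.  The time bound is infinite in this case.
\<close>

definition gap_sampler :: com where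
  "gap_sampler = Cond (NLess (NVar ''n'') (NConst 2)) Skip
     (Cond (RLess (OfNat (NConst 0)) (Scal ''gap''))
        (Seq (SetScal ''rho'' (RMinus (OfNat (NConst 1)) (Scal ''gap'')))
           (Seq (NAssign ''T'' (NConst 1)) (Seq setup_rate core)))
        (Seq (SetScal ''lz'' (OfNat (NConst 1))) (Seq (SetScal ''eps'' (OfNat (NConst 1))) core)))"

lemma one_state_sampler:
  assumes supp: "set_pmf \<pi> \<subseteq> {..<1}" and ex: "exec M A s = return_spmf s'" and out: "nvars s' ''out'' = 0"
  shows "perfect_sampler M A s \<pi>" "expected_time M A s = of_nat (clock s')"
proof -
  show "perfect_sampler M A s \<pi>"
  proof (rule perfect_samplerI[OF supp])
    fix y :: nat assume "y < 1"
    then show "ennreal (pmf \<pi> y) \<le> (\<integral>\<^sup>+ x. indicator {y} (nvars x ''out'') \<partial>measure_spmf (exec M A s))"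
      unfolding ex nn_integral_return_spmf using out by (simp add: pmf_le_1)
  qed
  show "expected_time M A s = of_nat (clock s')"
    unfolding expected_time_def ex nn_integral_return_spmf ..
qed

lemma mixing_sampler_correct:
  assumes acc: "efficient_access cs cm M" and stat: "stationary (num_states M) (trans_kernel M) \<pi>"
    and mix: "mixes_in_time (num_states M) (trans_kernel M) \<pi> T" and x0: "x0 \<in> set_pmf \<pi>"
  defines "s \<equiv> mixing_input (num_states M) x0 (pi_min \<pi>) T" and "n \<equiv> num_states M"
  shows "perfect_sampler M mixing_sampler s \<pi> \<and>
    expected_time M mixing_sampler s \<le> ennreal (2 * (600 + 2 * real cm + 8 * real cs) *
      (if n = 1 then 1 else real T * ln (real n / pi_min \<pi>)))"
proof -
  let ?K = "trans_kernel M"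
  have kernel: "chain_kernel n ?K 0"
    using acc by unfold_locales (auto simp: efficient_access_def markov_chain_def n_def)
  interpret ls: lazy_stationary n ?K 0 \<pi>
    using kernel stat by (auto simp: lazy_stationary_def lazy_stationary_axioms_def n_def)
  interpret st: stationary_chain n ?K \<pi>
    using kernel stat by (auto simp: stationary_chain_def stationary_chain_axioms_def n_def)
  have x0n: "x0 < n" using x0 st.supp_subset by auto
  show ?thesis
  proof (cases "n = 1")
    case True
    have ex: "exec M mixing_sampler s = return_spmf (tick 1 (tick 1 s))"
      using True by (simp add: mixing_sampler_def s_def n_def mixing_input_def)
    have "nvars (tick 1 (tick 1 s)) ''out'' = 0" by (simp add: s_def mixing_input_def)
    note * = one_state_sampler[OF st.supp_subset[unfolded True] ex this]
    have "expected_time M mixing_sampler s = ennreal 2"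
      unfolding *(2) by (simp add: s_def mixing_input_def)
    also have "\<dots> \<le> ennreal (2 * (600 + 2 * real cm + 8 * real cs) * 1)" by (rule ennreal_leI) simp
    finally show ?thesis using *(1) True by simp
  next
    case False
    then have n2: "2 \<le> n" using x0n by simp
    have half: "(\<Sum>y<n. \<bar>ls.G T x y\<bar>) \<le> 1 / 2" if "x < n" for x
    proof -
      have "d_TV n (step_dist ?K T x) \<pi> \<le> Max ((\<lambda>x. d_TV n (step_dist ?K T x) \<pi>) ` {..<n})"
        using that by (intro Max_ge) auto
      also have "\<dots> \<le> 1 / 4" using mix by (simp add: mixes_in_time_def n_def)
      finally show ?thesis using that by (simp add: d_TV_def ls.G_def ls.L_eq_step_dist)
    qed
    \<comment> \<open>At \<open>T = 0\<close> the point masses at states 0 and 1 would both be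
      within L1 distance 1/2 of \<pi>, although they are at distance 2 from each other.\<close>
    have T: "1 \<le> T"
    proof (rule ccontr)
      assume "\<not> 1 \<le> T"
      then have T0: "T = 0" by simp
      have two: "\<bar>ls.G T x 0\<bar> + \<bar>ls.G T x 1\<bar> \<le> 1 / 2" if "x < n" for x
      proof -
        have "(\<Sum>y\<in>{0, 1}. \<bar>ls.G T x y\<bar>) \<le> (\<Sum>y<n. \<bar>ls.G T x y\<bar>)" using n2 by (intro sum_mono2) auto
        then show ?thesis using half[OF that] by simp
      qed
      have "\<bar>1 - pmf \<pi> 0\<bar> + pmf \<pi> 1 \<le> 1 / 2" using two[of 0] n2 by (simp add: T0 ls.G_def)
      moreover have "pmf \<pi> 0 + \<bar>1 - pmf \<pi> 1\<bar> \<le> 1 / 2" using two[of 1] n2 by (simp add: T0 ls.G_def)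
      ultimately show False
        using abs_ge_self[of "1 - pmf \<pi> 0"] abs_ge_self[of "1 - pmf \<pi> 1"] by linarith
    qed
    interpret rc: rate_chain M \<pi> x0 T "1 / 2"
    proof (unfold_locales, fold n_def)
      show "set_pmf (?K x) \<subseteq> {..<n}" if "x < n" for x using ls.closed[OF that] .
      fix x y k t assume xy: "x \<in> set_pmf \<pi>" "y \<in> set_pmf \<pi>" and t: "k * T \<le> t"
      have xyn: "x < n" "y < n" using xy st.supp_subset by auto
      have "\<bar>pmf (step_dist ?K t x) y - pmf \<pi> y\<bar> = \<bar>ls.G t x y\<bar>"
        using xyn by (simp add: ls.G_def ls.L_eq_step_dist)
      also have "\<dots> \<le> (\<Sum>y<n. \<bar>ls.G t x y\<bar>)" using xyn by (intro member_le_sum) auto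
      also have "\<dots> \<le> 2 * (1 / 2) ^ k" using half xyn(1) t by (rule ls.L1_dist_halving)
      \<comment> \<open>The absolute error becomes a relative one at the price of a factor 1 /
        pi_min.\<close>
      also have "\<dots> \<le> 2 * (1 / 2) ^ k * (pmf \<pi> y / pi_min \<pi>)"
      proof -
        have "1 \<le> pmf \<pi> y / pi_min \<pi>" using st.pi_min_le[OF xy(2)] st.pi_min_pos by simp
        from mult_left_mono[OF this, of "2 * (1 / 2) ^ k"] show ?thesis by simp
      qed
      finally show "\<bar>pmf (step_dist ?K t x) y - pmf \<pi> y\<bar> \<le> 2 * (1 / 2) ^ k / pi_min \<pi> * pmf \<pi> y" by simp
    qed (use stat n2 x0 T in \<open>auto simp: n_def\<close>)
    define s2 where "s2 = tick 1 (set_entry ''rho'' 0 0 (1 / 2) (tick 1 s))"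
    have ex: "exec M mixing_sampler s = exec M (Seq setup_rate core) s2"
      using n2 by (simp add: mixing_sampler_def s_def s2_def n_def mixing_input_def)
    have s2: "nvars s2 ''n'' = num_states M" "nvars s2 ''start'' = x0" "nvars s2 ''T'' = T" "nvars s2 ''t0'' = 0"
      "arrays s2 ''rho'' 0 0 = 1 / 2" "arrays s2 ''pi_min'' 0 0 = pi_min \<pi>" "arrays s2 ''lz'' 0 0 = 0"
      "\<forall>i j. arrays s2 ''X'' i j = 0" "clock s2 \<le> 5"
      by (simp_all add: s2_def s_def mixing_input_def n_def)
    have "perfect_sampler M mixing_sampler s \<pi>"
      unfolding perfect_sampler_def ex using perfect_samplerI[OF st.supp_subset, of M "Seq setup_rate core" s2]
        rc.rate_core_ge[OF s2(1-8)] by (auto simp: perfect_sampler_def n_def)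
    moreover have "expected_time M mixing_sampler s \<le>
        ennreal (2 * (600 + 2 * real cm + 8 * real cs) * (real T * ln (real n / pi_min \<pi>)))"
    proof -
      have "expected_time M mixing_sampler s \<le>
          ennreal ((600 + 2 * real cm + 8 * real cs) * (real T / (1 - 1 / 2) * ln (real n / pi_min \<pi>)))"
        unfolding expected_time_def ex n_def
        by (rule rc.rate_core_time[OF s2(1-8) _ _ s2(9)]) (use acc in \<open>auto simp: efficient_access_def\<close>)
      \<comment> \<open>The leading factor 2 is 1 / (1 - \<rho>) for \<rho> = 1/2.\<close>
      also have "(600 + 2 * real cm + 8 * real cs) * (real T / (1 - 1 / 2) * ln (real n / pi_min \<pi>))
         = 2 * (600 + 2 * real cm + 8 * real cs) * (real T * ln (real n / pi_min \<pi>))" by simp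
      finally show ?thesis .
    qed
    ultimately show ?thesis using False by (simp only: if_False simp_thms)
  qed
qed

lemma gap_sampler_correct:
  assumes acc: "efficient_access cs cm M" and uniq: "unique_stationary (num_states M) (trans_kernel M) \<pi>"
    and rev: "reversible (num_states M) (trans_kernel M) \<pi>" and x0: "x0 \<in> set_pmf \<pi>"
  defines "n \<equiv> num_states M" and "\<gamma> \<equiv> abs_spectral_gap (num_states M) (trans_kernel M)"
  defines "s \<equiv> gap_input (num_states M) x0 (pi_min \<pi>) \<gamma>"
  shows "perfect_sampler M gap_sampler s \<pi> \<and>
    expected_time M gap_sampler s \<le> ennreal (600 + 2 * real cm + 8 * real cs) *
      (if n = 1 then 1 else 1 / ennreal \<gamma> * ennreal (ln (real n / pi_min \<pi>)))"
proof -
  let ?K = "trans_kernel M"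
  have stat: "stationary n ?K \<pi>" and unq: "\<And>\<rho>. stationary n ?K \<rho> \<Longrightarrow> \<rho> = \<pi>"
    using uniq by (auto simp: unique_stationary_def n_def)
  have kernel: "chain_kernel n ?K lz" if "0 \<le> lz" for lz
    using acc that by unfold_locales (auto simp: efficient_access_def markov_chain_def n_def)
  interpret ls: lazy_stationary n ?K 0 \<pi>
    using kernel stat by (auto simp: lazy_stationary_def lazy_stationary_axioms_def n_def)
  interpret st: stationary_chain n ?K \<pi>
    using kernel stat by (auto simp: stationary_chain_def stationary_chain_axioms_def n_def)
  have x0n: "x0 < n" using x0 st.supp_subset by auto
  consider (one) "n = 1" | (gap) "2 \<le> n" "0 < \<gamma>" | (nogap) "2 \<le> n" "\<gamma> \<le> 0" using x0n by linarith
  then show ?thesis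
  proof cases
    case one
    have ex: "exec M gap_sampler s = return_spmf (tick 1 (tick 1 s))"
      using one by (simp add: gap_sampler_def s_def n_def gap_input_def)
    have "nvars (tick 1 (tick 1 s)) ''out'' = 0" by (simp add: s_def gap_input_def)
    note * = one_state_sampler[OF st.supp_subset[unfolded one] ex this]
    have "expected_time M gap_sampler s = ennreal 2"
      unfolding *(2) by (simp add: s_def gap_input_def)
    also have "\<dots> \<le> ennreal (600 + 2 * real cm + 8 * real cs)" by (rule ennreal_leI) simp
    finally show ?thesis using *(1) one by simp
  next
    case gap
    have \<gamma>: "\<gamma> \<le> 1" and ev: "\<And>l. eigenvalue ls.P l \<Longrightarrow> l \<noteq> 1 \<Longrightarrow> cmod l \<le> 1 - \<gamma>"
      using ls.abs_spectral_gap_le[OF unq gap(1)] by (simp_all add: \<gamma>_def n_def)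
    have decay: "\<exists>c. \<forall>t. \<forall>x<n. \<forall>y<n. \<bar>ls.G (Suc t) x y\<bar> \<le> c * r ^ Suc t" if "1 - \<gamma> < r" for r
    proof (rule ls.G_decay[OF unq])
      show "0 < n" "0 < r" using gap \<gamma> that by auto
      fix l assume "eigenvalue ls.P ((1 + complex_of_real 0) * l - complex_of_real 0)"
        "(1 + complex_of_real 0) * l - complex_of_real 0 \<noteq> 1"
      then have "cmod l \<le> 1 - \<gamma>" by (intro ev) simp_all
      then show "cmod l < r" using that by simp
    qed
    interpret rc: rate_chain M \<pi> x0 1 "1 - \<gamma>"
    proof (unfold_locales, fold n_def)
      show "set_pmf (?K x) \<subseteq> {..<n}" if "x < n" for x using ls.closed[OF that] .
      fix x y k t assume xy: "x \<in> set_pmf \<pi>" "y \<in> set_pmf \<pi>" and t: "k * 1 \<le> (t::nat)"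
      have xyn: "x < n" "y < n" using xy st.supp_subset by auto
      have "\<bar>pmf (step_dist ?K t x) y - pmf \<pi> y\<bar> = \<bar>ls.G t x y\<bar>"
        using xyn by (simp add: ls.G_def ls.L_eq_step_dist)
      also have "\<dots> \<le> (1 - \<gamma>) ^ t / pi_min \<pi> * pmf \<pi> y"
        using rev gap \<gamma> decay xyn st.pi_min_pos st.pi_min_le xy by (intro ls.reversible_rate) (auto simp: n_def)
      \<comment> \<open>The bound is loosened to the form that \<open>rate_chain\<close> shares with
        the mixing case.\<close>
      also have "\<dots> \<le> 2 * (1 - \<gamma>) ^ k / pi_min \<pi> * pmf \<pi> y"
      proof (intro mult_right_mono divide_right_mono)
        have "(1 - \<gamma>) ^ t \<le> (1 - \<gamma>) ^ k" using t gap \<gamma> by (intro power_decreasing) auto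
        moreover have "0 \<le> (1 - \<gamma>) ^ k" using \<gamma> by simp
        ultimately show "(1 - \<gamma>) ^ t \<le> 2 * (1 - \<gamma>) ^ k" by linarith
      qed (use st.pi_min_pos in auto)
      finally show "\<bar>pmf (step_dist ?K t x) y - pmf \<pi> y\<bar> \<le> 2 * (1 - \<gamma>) ^ k / pi_min \<pi> * pmf \<pi> y" .
    qed (use stat gap \<gamma> x0 in \<open>auto simp: n_def\<close>)
    define s2 where "s2 = tick 1 (set_nvar ''T'' 1 (tick 1 (set_entry ''rho'' 0 0 (1 - \<gamma>) (tick 1 (tick 1 s)))))"
    have ex: "exec M gap_sampler s = exec M (Seq setup_rate core) s2"
      using gap by (simp add: gap_sampler_def s_def s2_def n_def gap_input_def)
    have s2: "nvars s2 ''n'' = num_states M" "nvars s2 ''start'' = x0" "nvars s2 ''T'' = 1" "nvars s2 ''t0'' = 0"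
      "arrays s2 ''rho'' 0 0 = 1 - \<gamma>" "arrays s2 ''pi_min'' 0 0 = pi_min \<pi>" "arrays s2 ''lz'' 0 0 = 0"
      "\<forall>i j. arrays s2 ''X'' i j = 0" "clock s2 \<le> 5"
      by (simp_all add: s2_def s_def gap_input_def n_def)
    have "perfect_sampler M gap_sampler s \<pi>"
      unfolding perfect_sampler_def ex using perfect_samplerI[OF st.supp_subset, of M "Seq setup_rate core" s2]
        rc.rate_core_ge[OF s2(1-8)] by (auto simp: perfect_sampler_def n_def)
    moreover have time: "expected_time M gap_sampler s \<le>
        ennreal ((600 + 2 * real cm + 8 * real cs) * (real 1 / (1 - (1 - \<gamma>)) * ln (real n / pi_min \<pi>)))"
      unfolding expected_time_def ex n_def
      by (rule rc.rate_core_time[OF s2(1-8) _ _ s2(9)]) (use acc in \<open>auto simp: efficient_access_def\<close>)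
    have eq: "ennreal ((600 + 2 * real cm + 8 * real cs) * (real 1 / (1 - (1 - \<gamma>)) * ln (real n / pi_min \<pi>)))
      = ennreal (600 + 2 * real cm + 8 * real cs) * (1 / ennreal \<gamma> * ennreal (ln (real n / pi_min \<pi>)))"
    proof -
      have "1 / ennreal \<gamma> = ennreal (1 / \<gamma>)" using gap(2) by (simp add: divide_ennreal flip: ennreal_1)
      moreover have "0 \<le> ln (real n / pi_min \<pi>)" using rc.ln_ge by (simp add: n_def)
      moreover define C where "C = 600 + 2 * real cm + 8 * real cs"
      moreover have "0 \<le> C" by (simp add: C_def)
      ultimately show ?thesis using gap(2) unfolding C_def[symmetric] by (simp add: ennreal_mult[symmetric])
    qed
    have "n \<noteq> 1" using gap(1) by simp
    ultimately show ?thesis using time[unfolded eq] by (simp only: if_False simp_thms)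
  next
    case nogap
    interpret lz: lazy_stationary n ?K 1 \<pi>
      using kernel[of 1] stat by (auto simp: lazy_stationary_def lazy_stationary_axioms_def)
    define s2 where "s2 = tick 1 (set_entry ''eps'' 0 0 1 (tick 1 (set_entry ''lz'' 0 0 1 (tick 1 (tick 1 s)))))"
    have ex: "exec M gap_sampler s = exec M core s2"
      using nogap by (simp add: gap_sampler_def s_def s2_def n_def gap_input_def)
    have s2: "nvars s2 ''n'' = num_states M" "nvars s2 ''start'' = x0" "nvars s2 ''t0'' = 0"
      "arrays s2 ''lz'' 0 0 = 1" "arrays s2 ''eps'' 0 0 = 1" "\<forall>i j. arrays s2 ''X'' i j = 0"
      by (simp_all add: s2_def s_def gap_input_def n_def)
    have "perfect_sampler M core s2 \<pi>"
    proof (rule perfect_samplerI[OF st.supp_subset])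
      fix y assume y: "y < n"
      show "ennreal (pmf \<pi> y) \<le> (\<integral>\<^sup>+ x. indicator {y} (nvars x ''out'') \<partial>measure_spmf (exec M core s2))"
        by (rule lazy_core_ge[OF _ _ _ _ s2])
          (use kernel[of 1] x0n y lz.lazy_tendsto[OF unq] in \<open>auto simp: n_def\<close>)
    qed
    then have "perfect_sampler M gap_sampler s \<pi>" by (simp add: perfect_sampler_def ex)
    \<comment> \<open>Positivity of the logarithm for \<open>n \<ge> 2\<close> is essential, as
      infinity times 0 would be 0.\<close>
    moreover have "1 / ennreal \<gamma> * ennreal (ln (real n / pi_min \<pi>)) = \<infinity>"
    proof -
      have "1 < real n / pi_min \<pi>"
        using st.pi_min_pos st.pi_min_le_1 nogap(1) by (simp add: less_divide_eq)
      then have "0 < ln (real n / pi_min \<pi>)" by simp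
      then show ?thesis using nogap(2) by (simp add: ennreal_neg ennreal_top_mult)
    qed
    ultimately show ?thesis using nogap(1) by (simp add: ennreal_mult_top)
  qed
qed

theorem mainTheorem1:
  fixes c_step c_mat :: nat
  shows
    "(\<exists>(A :: com) (C :: real). \<forall>(M :: chain_access) (\<pi> :: nat pmf) (T :: nat).
        efficient_access c_step c_mat M \<longrightarrow>
        stationary (num_states M) (trans_kernel M) \<pi> \<longrightarrow>
        mixes_in_time (num_states M) (trans_kernel M) \<pi> T \<longrightarrow>
        (\<forall>x\<^sub>0\<in>set_pmf \<pi>.
          perfect_sampler M A (mixing_input (num_states M) x\<^sub>0 (pi_min \<pi>) T) \<pi> \<and>
          expected_time M A (mixing_input (num_states M) x\<^sub>0 (pi_min \<pi>) T)
            \<le> ennreal (C * (if num_states M = 1 then 1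
                            else real T * ln (real (num_states M) / pi_min \<pi>)))))
     \<and>
     (\<exists>(A :: com) (C :: real). \<forall>(M :: chain_access) (\<pi> :: nat pmf) (\<gamma> :: real).
        efficient_access c_step c_mat M \<longrightarrow>
        unique_stationary (num_states M) (trans_kernel M) \<pi> \<longrightarrow>
        reversible (num_states M) (trans_kernel M) \<pi> \<longrightarrow>
        \<gamma> = abs_spectral_gap (num_states M) (trans_kernel M) \<longrightarrow>
        (\<forall>x\<^sub>0\<in>set_pmf \<pi>.
          perfect_sampler M A (gap_input (num_states M) x\<^sub>0 (pi_min \<pi>) \<gamma>) \<pi> \<and>
          expected_time M A (gap_input (num_states M) x\<^sub>0 (pi_min \<pi>) \<gamma>)
            \<le> ennreal C * (if num_states M = 1 then 1
                           else 1 / ennreal \<gamma> * ennreal (ln (real (num_states M) / pi_min \<pi>)))))"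
proof (intro conjI exI allI impI ballI)
  fix M \<pi> T x\<^sub>0
  assume "efficient_access c_step c_mat M" "stationary (num_states M) (trans_kernel M) \<pi>"
    "mixes_in_time (num_states M) (trans_kernel M) \<pi> T" "x\<^sub>0 \<in> set_pmf \<pi>"
  note * = mixing_sampler_correct[OF this]
  show "perfect_sampler M mixing_sampler (mixing_input (num_states M) x\<^sub>0 (pi_min \<pi>) T) \<pi>"
    using * by blast
  show "expected_time M mixing_sampler (mixing_input (num_states M) x\<^sub>0 (pi_min \<pi>) T)
      \<le> ennreal (2 * (600 + 2 * real c_mat + 8 * real c_step) *
          (if num_states M = 1 then 1 else real T * ln (real (num_states M) / pi_min \<pi>)))"
    using * by blast
next
  fix M \<pi> \<gamma> x\<^sub>0
  assume a: "efficient_access c_step c_mat M" "unique_stationary (num_states M) (trans_kernel M) \<pi>"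
    "reversible (num_states M) (trans_kernel M) \<pi>" and \<gamma>: "\<gamma> = abs_spectral_gap (num_states M) (trans_kernel M)"
    and x: "x\<^sub>0 \<in> set_pmf \<pi>"
  note * = gap_sampler_correct[OF a x, folded \<gamma>]
  show "perfect_sampler M gap_sampler (gap_input (num_states M) x\<^sub>0 (pi_min \<pi>) \<gamma>) \<pi>"
    using * by blast
  show "expected_time M gap_sampler (gap_input (num_states M) x\<^sub>0 (pi_min \<pi>) \<gamma>)
      \<le> ennreal (600 + 2 * real c_mat + 8 * real c_step) * (if num_states M = 1 then 1
          else 1 / ennreal \<gamma> * ennreal (ln (real (num_states M) / pi_min \<pi>)))"
    using * by blast
qed

end
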